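(* Let $d\ge 1$, $T>0$ and $\gamma>\frac d2$. Let $u$ be the solution on $[0,T]$ of the cubic nonlinear Schrödinger equation $$i\partial_t u+\Delta u+|u|^2u=0,\quad t>0,\ x\in\mathbb T^d,\qquad u(0,\cdot)=u_0,$$ where $u_0\in H^{\gamma+2}(\mathbb T^d)$ and $u\in L^\infty((0,T);H^{\gamma+2}(\mathbb T^d))$. For a step size $\tau>0$ define the numerical solution $u^n$ by $u^0=u_0$ and, for $n\ge 0$, $$u^{n+1}=\mathrm e^{i\tau\Delta}u^n+i\tau\,\mathrm e^{i\tau\Delta}\Big\{\big[\varphi(-2i\tau\Delta)+\psi(-2i\tau\Delta)\big]\overline{u^n}\cdot (u^n)^2\Big\}-i\tau\big[\mathrm e^{i\tau\Delta}\psi(-2i\tau\Delta)\overline{u^n}\big]\cdot\big(\mathrm e^{i\tau\Delta}u^n\big)^2-\frac{\tau^2}{2}\mathrm e^{i\tau\Delta}\big[|u^n|^4u^n\big].$$ Then there exist constants $\tau_0,C>0$, depending only on $T$ and $\|u\|_{L^\infty((0,T);H^{\gamma+2}(\mathbb T^d))}$, such that for all $0<\tau\le\tau_0$, $$\|u(t_n,\cdot)-u^n\|_{H^\gamma(\mathbb T^d)}\le C\tau^2\qquad\text{for all } n\ge 0 \text{ with } 0\le n\tau\le T,$$ where $t_n=n\tau$.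
   Context: $\mathbb T=(0,2\pi)$ with periodic boundary conditions. The functions $\varphi,\psi$ are $\varphi(z)=\frac{e^z-1}{z}$ for $z\neq0$, $\varphi(0)=1$, and $\psi(z)=\frac{e^z-1-ze^z}{z^2}$ for $z\ne0$, $\psi(0)=-\frac12$. For such a function $f$, the operator $f(-2i\tau\Delta)$ is the Fourier multiplier acting on the Fourier coefficient at $\boldsymbol\xi\in\mathbb Z^d$ by multiplication with $f(2i\tau|\boldsymbol\xi|^2)$; likewise $\mathrm e^{it\Delta}$ multiplies the $\boldsymbol\xi$-th Fourier coefficient by $\mathrm e^{-it|\boldsymbol\xi|^2}$. $H^s(\mathbb T^d)$ is the Sobolev space with norm $\|f\|_{H^s}=\|(1-\Delta)^{s/2}f\|_{L^2}$. *)

theory Defs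
  imports "HOL-Analysis.Analysis"
begin

text \<open>A function on the torus is represented by a function real^'d => complex; only its
values on the fundamental cube [0,2pi]^d matter.  The dimension d is CARD('d).\<close>

definition torus_cube :: "(real ^ 'd) set" where
  "torus_cube = {x. \<forall>i. 0 \<le> x $ i \<and> x $ i \<le> 2 * pi}"

definition freq_dot :: "int ^ 'd \<Rightarrow> real ^ 'd \<Rightarrow> real" where
  "freq_dot \<xi> x = (\<Sum>i\<in>UNIV. real_of_int (\<xi> $ i) * x $ i)"

definition freq_sq :: "int ^ 'd \<Rightarrow> real" where
  "freq_sq \<xi> = (\<Sum>i\<in>UNIV. real_of_int (\<xi> $ i) ^ 2)"

definition fcoeff :: "(real ^ 'd \<Rightarrow> complex) \<Rightarrow> int ^ 'd \<Rightarrow> complex" where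
  "fcoeff f \<xi> = set_lebesgue_integral lborel torus_cube
        (\<lambda>x. f x * cis (- freq_dot \<xi> x)) / of_real ((2 * pi) ^ CARD('d))"

definition in_Hs :: "real \<Rightarrow> (real ^ 'd \<Rightarrow> complex) \<Rightarrow> bool" where
  "in_Hs s f \<longleftrightarrow> set_borel_measurable lborel torus_cube f
     \<and> set_integrable lborel torus_cube (\<lambda>x. (cmod (f x))\<^sup>2)
     \<and> (\<lambda>\<xi>. (1 + freq_sq \<xi>) powr s * (cmod (fcoeff f \<xi>))\<^sup>2) summable_on UNIV"

text \<open>The H^s norm ||(1-Delta)^(s/2) f||_{L^2(T^d)}, computed via Parseval.\<close>
definition Hs_norm :: "real \<Rightarrow> (real ^ 'd \<Rightarrow> complex) \<Rightarrow> real" where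
  "Hs_norm s f = sqrt ((2 * pi) ^ CARD('d) *
      (\<Sum>\<^sub>\<infinity>\<xi>. (1 + freq_sq \<xi>) powr s * (cmod (fcoeff f \<xi>))\<^sup>2))"

definition fmult :: "(int ^ 'd \<Rightarrow> complex) \<Rightarrow> (real ^ 'd \<Rightarrow> complex) \<Rightarrow> real ^ 'd \<Rightarrow> complex" where
  "fmult m f x = (\<Sum>\<^sub>\<infinity>\<xi>. m \<xi> * fcoeff f \<xi> * cis (freq_dot \<xi> x))"

definition schr :: "real \<Rightarrow> (real ^ 'd \<Rightarrow> complex) \<Rightarrow> real ^ 'd \<Rightarrow> complex" where
  "schr t = fmult (\<lambda>\<xi>. cis (- t * freq_sq \<xi>))"

definition phi :: "complex \<Rightarrow> complex" where
  "phi z = (if z = 0 then 1 else (exp z - 1) / z)"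

definition psi :: "complex \<Rightarrow> complex" where
  "psi z = (if z = 0 then - 1 / 2 else (exp z - 1 - z * exp z) / z ^ 2)"

text \<open>f(-2 i tau Delta): multiplication of the xi-th coefficient by f(2 i tau |xi|^2).\<close>
definition op_fun :: "(complex \<Rightarrow> complex) \<Rightarrow> real \<Rightarrow> (real ^ 'd \<Rightarrow> complex) \<Rightarrow> real ^ 'd \<Rightarrow> complex" where
  "op_fun g \<tau> = fmult (\<lambda>\<xi>. g (2 * \<i> * of_real \<tau> * of_real (freq_sq \<xi>)))"

definition scheme_step :: "real \<Rightarrow> (real ^ 'd \<Rightarrow> complex) \<Rightarrow> real ^ 'd \<Rightarrow> complex" where
  "scheme_step \<tau> v = (\<lambda>x.
      schr \<tau> v x
    + \<i> * of_real \<tau> * schr \<tau>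
        (\<lambda>y. (op_fun phi \<tau> (\<lambda>z. cnj (v z)) y + op_fun psi \<tau> (\<lambda>z. cnj (v z)) y) * (v y)\<^sup>2) x
    - \<i> * of_real \<tau> * schr \<tau> (op_fun psi \<tau> (\<lambda>z. cnj (v z))) x * (schr \<tau> v x)\<^sup>2
    - of_real (\<tau>\<^sup>2 / 2) * schr \<tau> (\<lambda>y. of_real (cmod (v y) ^ 4) * v y) x)"

definition scheme :: "real \<Rightarrow> (real ^ 'd \<Rightarrow> complex) \<Rightarrow> nat \<Rightarrow> real ^ 'd \<Rightarrow> complex" where
  "scheme \<tau> u0 n = (scheme_step \<tau> ^^ n) u0"

text \<open>u solves i u_t + Delta u + |u|^2 u = 0 on [0,T] with u(t) in H^s for all t in [0,T]:
  every Fourier mode satisfies d/dt u_xi = i(-|xi|^2 u_xi + (|u|^2 u)_xi).\<close>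
definition nls_solution :: "real \<Rightarrow> real \<Rightarrow> (real \<Rightarrow> real ^ 'd \<Rightarrow> complex) \<Rightarrow> bool" where
  "nls_solution s T u \<longleftrightarrow>
     (\<forall>t\<in>{0..T}. in_Hs s (u t)) \<and>
     (\<forall>\<xi>. \<forall>t\<in>{0..T}.
        ((\<lambda>t'. fcoeff (u t') \<xi>) has_vector_derivative
           \<i> * (- of_real (freq_sq \<xi>) * fcoeff (u t) \<xi>
                + fcoeff (\<lambda>x. of_real ((cmod (u t x))\<^sup>2) * u t x) \<xi>)) (at t within {0..T}))"

end

theory Submission
  imports Defs
begin

text \<open>
  In terms of Fourier coefficients every nonlinear term is a triple convolution with a kernel, and for
  \<open>\<gamma> > d/2\<close> such convolutions with bounded kernels are bounded on \<open>H\<^sup>\<gamma>\<close> and on \<open>H\<^bsup>\<gamma>+2\<^esup>\<close>. In the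
  interaction picture \<open>w(t) = e\<^bsup>-it\<Delta>\<^esup>u(t\<^sub>n + t)\<close> the interaction of frequencies \<open>x, y, z\<close> (the first one
  belonging to the conjugated factor) carries the phase \<open>e\<^bsup>it(\<alpha> + \<beta>)\<^esup>\<close> with \<open>\<alpha> = 2|x|\<^sup>2\<close> and
  \<open>\<beta> = |x + y + z|\<^sup>2 - |x|\<^sup>2 - |y|\<^sup>2 - |z|\<^sup>2\<close>. The scheme integrates \<open>e\<^bsup>it\<alpha>\<^esup>\<close> exactly and interpolates
  \<open>e\<^bsup>it\<beta>\<^esup>\<close> linearly between \<open>0\<close> and \<open>\<tau>\<close>. The interpolation error is at most \<open>2\<tau>\<^sup>2\<beta>\<^sup>2\<close>, and since \<open>\<beta>\<close> contains
  only products of different frequencies, \<open>\<beta>\<^sup>2\<close> puts at most two derivatives on each factor. The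
  quintic term is the first-order change of \<open>w\<close> inside the nonlinearity. The local error is
  therefore \<open>O(\<tau>\<^sup>3)\<close> in \<open>H\<^sup>\<gamma>\<close>, and the scheme is Lipschitz with constant \<open>1 + O(\<tau>)\<close> on bounded
  sets of \<open>H\<^sup>\<gamma>\<close>.
\<close>

section \<open>Weighted square-summable coefficient sequences\<close>

text \<open>No bound in the smoother space is available for the numerical solution. Derivatives are
  therefore spent only on the exact solution, and stability is measured in
  \<open>hs_le \<gamma>\<close> alone. The Lipschitz constant is uniform only on balls, so the error
  bound itself has to confine the iterates to radius M + 1; this is what makes the step size small.
  The quintic coefficient comes from signs. Inserting w = a + i t G, with G the cubic term, changes
  the conjugated slot by -i t and the other two by +i t, in total i t times the quintic product; the
  factor i of the equation and integration over [0, \<tau>] give -\<tau>^2 / 2. A second obstacle is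
  the gap between functions and coefficients: coefficients fix a function only almost everywhere,
  while products are formed pointwise. Hence completeness of the trigonometric system, obtained from
  Stone-Weierstrass, and the relation \<open>represents\<close>, under which pointwise products
  become convolutions. Norm bounds are proved by duality over finite sets of frequencies, so that
  integration in time reduces to a scalar mean value inequality.\<close>

lemma freq_sq_nonneg: "0 \<le> freq_sq \<xi>"
  by (simp add: freq_sq_def sum_nonneg)

lemma freq_sq_minus: "freq_sq (- \<xi>) = freq_sq \<xi>"
  by (simp add: freq_sq_def)

definition freq_ip :: "int ^ 'd \<Rightarrow> int ^ 'd \<Rightarrow> real" where
  "freq_ip x y = (\<Sum>i\<in>UNIV. real_of_int (x $ i) * real_of_int (y $ i))"

lemma freq_sq_add: "freq_sq (x + y) = freq_sq x + freq_sq y + 2 * freq_ip x y"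
  by (simp add: freq_sq_def freq_ip_def sum.distrib sum_distrib_left power2_eq_square algebra_simps)

lemma freq_ip_add: "freq_ip (x + y) z = freq_ip x z + freq_ip y z"
  by (simp add: freq_ip_def sum.distrib algebra_simps)

lemma freq_ip_Cauchy_Schwarz: "\<bar>freq_ip x y\<bar> \<le> sqrt (freq_sq x) * sqrt (freq_sq y)"
proof -
  have "\<bar>freq_ip x y\<bar> \<le> (\<Sum>i\<in>UNIV. \<bar>real_of_int (x $ i)\<bar> * \<bar>real_of_int (y $ i)\<bar>)"
    unfolding freq_ip_def by (rule order_trans[OF sum_abs]) (simp add: abs_mult)
  also have "\<dots> \<le> L2_set (\<lambda>i. real_of_int (x $ i)) UNIV * L2_set (\<lambda>i. real_of_int (y $ i)) UNIV"
    by (rule L2_set_mult_ineq)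
  finally show ?thesis
    by (simp add: L2_set_def freq_sq_def)
qed

text \<open>The exponent is s / 2 because \<open>Hs_norm\<close> puts the power s on the squared
  coefficient.\<close>

definition wt :: "real \<Rightarrow> int ^ 'd \<Rightarrow> real" where
  "wt s \<xi> = (1 + freq_sq \<xi>) powr (s / 2)"

lemma wt_pos: "0 < wt s \<xi>"
  using freq_sq_nonneg[of \<xi>] by (simp add: wt_def)

lemma wt_nonneg: "0 \<le> wt s \<xi>"
  by (rule less_imp_le[OF wt_pos])

lemma wt_sq: "(wt s \<xi>)\<^sup>2 = (1 + freq_sq \<xi>) powr s"
  using freq_sq_nonneg[of \<xi>] by (simp add: wt_def powr_realpow[symmetric] powr_powr)

lemma wt_minus: "wt s (- \<xi>) = wt s \<xi>"
  by (simp add: wt_def freq_sq_minus)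

lemma wt_add_2: "wt (s + 2) \<xi> = wt s \<xi> * (1 + freq_sq \<xi>)"
  using freq_sq_nonneg[of \<xi>] by (simp add: wt_def add_divide_distrib powr_add)

lemma wt_mono: "s \<le> t \<Longrightarrow> wt s \<xi> \<le> wt t \<xi>"
  using freq_sq_nonneg[of \<xi>] by (simp add: wt_def powr_mono)

text \<open>The bracket sqrt (1 + |\<xi>|^2) is subadditive by Cauchy-Schwarz, a sum of three terms
  is at most three times the largest, and the power of the largest is one of the summands on the
  right. This takes the place of a fractional Leibniz rule.\<close>

lemma wt_triangle:
  assumes "0 \<le> s"
  shows "wt s (x + y + z :: int ^ 'd) \<le> 3 powr s * (wt s x + wt s y + wt s z)"
proof -
  define j :: "int ^ 'd \<Rightarrow> real" where "j \<xi> = sqrt (1 + freq_sq \<xi>)" for \<xi>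
  have j_pos: "0 < j \<xi>" for \<xi>
    using freq_sq_nonneg[of \<xi>] by (simp add: j_def)
  have wt_j: "wt s \<xi> = j \<xi> powr s" for \<xi>
    using freq_sq_nonneg[of \<xi>] by (simp add: wt_def j_def powr_half_sqrt[symmetric] powr_powr)
  have j_add: "j (a + b) \<le> j a + j b" for a b
  proof -
    have "1 + freq_sq (a + b) \<le> (j a)\<^sup>2 + (j b)\<^sup>2 + 2 * (sqrt (freq_sq a) * sqrt (freq_sq b))"
      using freq_ip_Cauchy_Schwarz[of a b] freq_sq_nonneg[of a] freq_sq_nonneg[of b]
      by (simp add: j_def freq_sq_add)
    also have "\<dots> \<le> (j a)\<^sup>2 + (j b)\<^sup>2 + 2 * (j a * j b)"
      by (intro add_mono mult_left_mono mult_mono order_refl)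
         (auto simp: j_def freq_sq_nonneg)
    also have "\<dots> = (j a + j b)\<^sup>2"
      by (simp add: power2_sum)
    finally have "j (a + b) \<le> sqrt ((j a + j b)\<^sup>2)"
      unfolding j_def[of "a + b"] by (rule real_sqrt_le_mono)
    then show ?thesis
      using j_pos[of a] j_pos[of b] by simp
  qed
  define m where "m = max (j x) (max (j y) (j z))"
  have "j (x + y + z) \<le> j x + j y + j z"
    using j_add[of "x + y" z] j_add[of x y] by linarith
  also have "\<dots> \<le> 3 * m"
    by (simp add: m_def)
  finally have "j (x + y + z) powr s \<le> (3 * m) powr s"
    using assms j_pos[of "x + y + z"] by (intro powr_mono2) auto
  also have "\<dots> = 3 powr s * m powr s"
    using j_pos[of x] by (simp add: powr_mult m_def)
  also have "m powr s \<le> j x powr s + j y powr s + j z powr s"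
    by (auto simp: m_def max_def)
  finally show ?thesis
    by (simp add: wt_j)
qed

text \<open>\<open>hs_le s a B\<close> says that the \<open>H\<^sup>s\<close> norm of the coefficients \<open>a\<close> is finite and at most \<open>B\<close>; testing finite
  sets only avoids the junk value of a divergent sum.\<close>

definition hs_le :: "real \<Rightarrow> (int ^ 'd \<Rightarrow> complex) \<Rightarrow> real \<Rightarrow> bool" where
  "hs_le s a B \<longleftrightarrow> (\<forall>F. finite F \<longrightarrow> L2_set (\<lambda>\<xi>. wt s \<xi> * cmod (a \<xi>)) F \<le> B)"

lemma hs_le_nonneg: "hs_le s a B \<Longrightarrow> 0 \<le> B"
  unfolding hs_le_def by (drule spec[of _ "{}"]) simp

lemma hs_le_trans: "hs_le s a B \<Longrightarrow> B \<le> B' \<Longrightarrow> hs_le s a B'"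
  unfolding hs_le_def by (meson order_trans)

lemma hs_le_zero: "hs_le s (\<lambda>\<xi>. 0) 0"
  by (simp add: hs_le_def L2_set_def)

lemma hs_le_add:
  assumes "hs_le s a A" "hs_le s b B"
  shows "hs_le s (\<lambda>\<xi>. a \<xi> + b \<xi>) (A + B)"
  unfolding hs_le_def
proof (intro allI impI)
  fix F :: "(int ^ 'a) set"
  assume F: "finite F"
  have "L2_set (\<lambda>\<xi>. wt s \<xi> * cmod (a \<xi> + b \<xi>)) F
      \<le> L2_set (\<lambda>\<xi>. wt s \<xi> * cmod (a \<xi>) + wt s \<xi> * cmod (b \<xi>)) F"
    unfolding distrib_left[symmetric]
    by (intro L2_set_mono mult_left_mono norm_triangle_ineq mult_nonneg_nonneg wt_nonneg) auto
  also have "\<dots> \<le> L2_set (\<lambda>\<xi>. wt s \<xi> * cmod (a \<xi>)) F + L2_set (\<lambda>\<xi>. wt s \<xi> * cmod (b \<xi>)) F"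
    by (rule L2_set_triangle_ineq)
  also have "\<dots> \<le> A + B"
    using assms F by (intro add_mono) (auto simp: hs_le_def)
  finally show "L2_set (\<lambda>\<xi>. wt s \<xi> * cmod (a \<xi> + b \<xi>)) F \<le> A + B" .
qed

lemma hs_le_uminus: "hs_le s a A \<Longrightarrow> hs_le s (\<lambda>\<xi>. - a \<xi>) A"
  by (simp add: hs_le_def)

lemma hs_le_diff:
  assumes "hs_le s a A" "hs_le s b B"
  shows "hs_le s (\<lambda>\<xi>. a \<xi> - b \<xi>) (A + B)"
  using hs_le_add[OF assms(1) hs_le_uminus[OF assms(2)]] by simp

lemma hs_le_mult:
  assumes "hs_le s a A" "\<And>\<xi>. cmod (m \<xi>) \<le> \<mu>"
  shows "hs_le s (\<lambda>\<xi>. m \<xi> * a \<xi>) (\<mu> * A)"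
proof -
  have \<mu>: "0 \<le> \<mu>"
    by (rule order_trans[OF norm_ge_zero assms(2)])
  show ?thesis
    unfolding hs_le_def
  proof (intro allI impI)
    fix F :: "(int ^ 'a) set"
    assume F: "finite F"
    have "L2_set (\<lambda>\<xi>. wt s \<xi> * cmod (m \<xi> * a \<xi>)) F \<le> L2_set (\<lambda>\<xi>. \<mu> * (wt s \<xi> * cmod (a \<xi>))) F"
    proof (rule L2_set_mono)
      fix \<xi>
      have "wt s \<xi> * (cmod (m \<xi>) * cmod (a \<xi>)) \<le> wt s \<xi> * (\<mu> * cmod (a \<xi>))"
        by (intro mult_left_mono mult_right_mono assms wt_nonneg) auto
      then show "wt s \<xi> * cmod (m \<xi> * a \<xi>) \<le> \<mu> * (wt s \<xi> * cmod (a \<xi>))"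
        by (simp add: norm_mult mult_ac)
    qed (simp add: wt_nonneg)
    also have "\<dots> = \<mu> * L2_set (\<lambda>\<xi>. wt s \<xi> * cmod (a \<xi>)) F"
      by (rule L2_set_right_distrib[OF \<mu>, symmetric])
    also have "\<dots> \<le> \<mu> * A"
      using assms(1) F \<mu> by (intro mult_left_mono) (auto simp: hs_le_def)
    finally show "L2_set (\<lambda>\<xi>. wt s \<xi> * cmod (m \<xi> * a \<xi>)) F \<le> \<mu> * A" .
  qed
qed

lemma hs_le_cmult: "hs_le s a A \<Longrightarrow> hs_le s (\<lambda>\<xi>. c * a \<xi>) (cmod c * A)"
  by (rule hs_le_mult) auto

lemma hs_le_unimodular:
  assumes "hs_le s a A" "\<And>\<xi>. cmod (m \<xi>) = 1"
  shows "hs_le s (\<lambda>\<xi>. m \<xi> * a \<xi>) A"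
  using hs_le_mult[of s a A m 1] assms by simp

lemma hs_le_order:
  assumes "hs_le t a A" "s \<le> t"
  shows "hs_le s a A"
  unfolding hs_le_def
proof (intro allI impI)
  fix F :: "(int ^ 'a) set"
  assume "finite F"
  have "L2_set (\<lambda>\<xi>. wt s \<xi> * cmod (a \<xi>)) F \<le> L2_set (\<lambda>\<xi>. wt t \<xi> * cmod (a \<xi>)) F"
    by (intro L2_set_mono mult_right_mono wt_mono assms mult_nonneg_nonneg wt_nonneg norm_ge_zero)
  also have "\<dots> \<le> A"
    using assms(1) \<open>finite F\<close> by (simp add: hs_le_def)
  finally show "L2_set (\<lambda>\<xi>. wt s \<xi> * cmod (a \<xi>)) F \<le> A" .
qed

lemma hs_le_weight:
  assumes "hs_le (s + 2) a A"
  shows "hs_le s (\<lambda>\<xi>. of_real (1 + freq_sq \<xi>) * a \<xi>) A"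
proof -
  have "wt s \<xi> * cmod (of_real (1 + freq_sq \<xi>) * a \<xi>) = wt (s + 2) \<xi> * cmod (a \<xi>)" for \<xi>
    unfolding norm_mult norm_of_real wt_add_2 using freq_sq_nonneg[of \<xi>] by simp
  then show ?thesis
    using assms by (simp add: hs_le_def)
qed

text \<open>The coefficients of the conjugate function: conjugation sends frequency \<xi> to
  -\<xi>.\<close>

definition conjs :: "(int ^ 'd \<Rightarrow> complex) \<Rightarrow> int ^ 'd \<Rightarrow> complex" where
  "conjs a \<xi> = cnj (a (- \<xi>))"

lemma hs_le_conjs: "hs_le s a A \<Longrightarrow> hs_le s (conjs a) A"
  unfolding hs_le_def
proof (intro allI impI)
  fix F :: "(int ^ 'a) set"
  assume a: "\<forall>F. finite F \<longrightarrow> L2_set (\<lambda>\<xi>. wt s \<xi> * cmod (a \<xi>)) F \<le> A" and F: "finite F"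
  have "L2_set (\<lambda>\<xi>. wt s \<xi> * cmod (conjs a \<xi>)) F = L2_set (\<lambda>\<xi>. wt s \<xi> * cmod (a \<xi>)) (uminus ` F)"
    by (simp add: L2_set_def sum.reindex conjs_def wt_minus)
  also have "\<dots> \<le> A"
    using a F by simp
  finally show "L2_set (\<lambda>\<xi>. wt s \<xi> * cmod (conjs a \<xi>)) F \<le> A" .
qed

text \<open>Since \<xi>_i^2 \<le> |\<xi>|^2 for every coordinate, the weight is dominated by a
  product of d one-dimensional weights with exponent s / d > 1/2, and over a cube the sum factors
  into convergent one-dimensional sums.\<close>

lemma sum_inverse_weight_bounded:
  assumes "real CARD('d) / 2 < s"
  shows "\<exists>B. \<forall>F :: (int ^ 'd::finite) set. finite F \<longrightarrow> (\<Sum>\<xi>\<in>F. (1 + freq_sq \<xi>) powr (- s)) \<le> B"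
proof -
  define d where "d = real CARD('d)"
  have d: "d > 0" by (simp add: d_def)
  define p where "p = s / d"
  have p: "1/2 < p"
    using assms d by (simp add: p_def d_def field_simps)
  define f :: "int \<Rightarrow> real" where "f n = (1 + (real_of_int n)\<^sup>2) powr (- p)" for n
  have f0: "0 \<le> f n" for n by (simp add: f_def)
  have summ: "summable (\<lambda>n. real n powr (- 2 * p))"
    using p by (simp add: summable_real_powr_iff)
  \<comment> \<open>The extra 1 pays for n = 0, where \<open>f 0 = 1\<close> but
    \<open>0 powr _\<close> is 0.\<close>
  define S where "S = 1 + (\<Sum>n. real n powr (- 2 * p))"
  have fle: "f (int n) \<le> real n powr (- 2 * p)" if "n \<noteq> 0" for n
  proof -
    have "real n powr (- 2 * p) = ((real n)\<^sup>2) powr (- p)"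
      using that by (simp add: powr_powr flip: powr_numeral)
    then show ?thesis
      using that p by (simp add: f_def powr_mono2')
  qed
  have nat_bd: "(\<Sum>n\<in>{0..N}. f (int n)) \<le> S" for N
  proof -
    have "(\<Sum>n\<in>{0..N}. f (int n)) \<le> (\<Sum>n\<in>{0..N}. (if n = 0 then 1 else 0) + real n powr (- 2 * p))"
      by (intro sum_mono) (use fle in \<open>auto simp: f_def\<close>)
    also have "\<dots> = 1 + (\<Sum>n\<in>{0..N}. real n powr (- 2 * p))"
      by (simp add: sum.distrib)
    also have "\<dots> \<le> S"
      unfolding S_def using summ by (intro add_left_mono sum_le_suminf) auto
    finally show ?thesis .
  qed
  have int_bd: "(\<Sum>n\<in>{- int N..int N}. f n) \<le> 2 * S" for N
  proof -
    have "(\<Sum>n\<in>{- int N..int N}. f n) \<le> (\<Sum>n\<in>int ` {0..N} \<union> (\<lambda>n. - int n) ` {0..N}. f n)"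
    proof (rule sum_mono2)
      show "{- int N..int N} \<subseteq> int ` {0..N} \<union> (\<lambda>n. - int n) ` {0..N}"
      proof
        fix n assume n: "n \<in> {- int N..int N}"
        show "n \<in> int ` {0..N} \<union> (\<lambda>n. - int n) ` {0..N}"
        proof (cases "0 \<le> n")
          case True
          then have "n = int (nat n)" "nat n \<in> {0..N}" using n by auto
          then show ?thesis by blast
        next
          case False
          then have "n = - int (nat (-n))" "nat (-n) \<in> {0..N}" using n by auto
          then show ?thesis by blast
        qed
      qed
    qed (auto simp: f0)
    also have "\<dots> \<le> (\<Sum>n\<in>int ` {0..N}. f n) + (\<Sum>n\<in>(\<lambda>n. - int n) ` {0..N}. f n)"
      by (subst sum.union_inter[symmetric]) (auto simp: f0 sum_nonneg)
    also have "\<dots> = (\<Sum>n\<in>{0..N}. f (int n)) + (\<Sum>n\<in>{0..N}. f (int n))"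
      by (simp add: sum.reindex inj_on_def f_def)
    also have "\<dots> \<le> 2 * S" using nat_bd[of N] by simp
    finally show ?thesis .
  qed
  have term_le: "(1 + freq_sq \<xi>) powr (- s) \<le> (\<Prod>i\<in>UNIV. f (\<xi> $ i))" for \<xi> :: "int ^ 'd"
  proof -
    have pos: "0 < 1 + (real_of_int (\<xi> $ i))\<^sup>2" for i
      by (simp add: add_pos_nonneg)
    have "(1 + freq_sq \<xi>) powr (- s) = (\<Prod>i\<in>(UNIV::'d set). (1 + freq_sq \<xi>) powr (- p))"
      using d freq_sq_nonneg[of \<xi>]
      by (simp add: p_def d_def powr_realpow[symmetric] powr_powr)
    also have "\<dots> \<le> (\<Prod>i\<in>UNIV. f (\<xi> $ i))"
    proof (rule prod_mono)
      fix i :: 'd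
      have "(real_of_int (\<xi> $ i))\<^sup>2 \<le> freq_sq \<xi>"
        unfolding freq_sq_def by (rule member_le_sum) auto
      then show "0 \<le> (1 + freq_sq \<xi>) powr - p \<and> (1 + freq_sq \<xi>) powr - p \<le> f (\<xi> $ i)"
        using p pos[of i] by (auto simp: f_def intro!: powr_mono2')
    qed
    finally show ?thesis .
  qed
  have "(\<Sum>\<xi>\<in>F. (1 + freq_sq \<xi>) powr (- s))
      \<le> (2 * S) ^ CARD('d)" if F: "finite F" for F :: "(int ^ 'd) set"
  proof -
    \<comment> \<open>A bound for all coordinates occurring in \<open>F\<close>. It encloses
      \<open>F\<close> in a cube, over which the sum of products is a product of sums.\<close>
    define N where "N = nat (\<Sum>\<xi>\<in>F. \<Sum>i\<in>UNIV. \<bar>\<xi> $ i\<bar>)"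
    have mem: "vec_nth \<xi> \<in> (\<Pi>\<^sub>E i\<in>UNIV. {- int N..int N})" if "\<xi> \<in> F" for \<xi>
    proof -
      have "\<bar>\<xi> $ i\<bar> \<le> int N" for i
      proof -
        have "\<bar>\<xi> $ i\<bar> \<le> (\<Sum>i\<in>UNIV. \<bar>\<xi> $ i\<bar>)" by (rule member_le_sum) auto
        also have "\<dots> \<le> (\<Sum>\<xi>\<in>F. \<Sum>i\<in>UNIV. \<bar>\<xi> $ i\<bar>)"
          using that F by (intro member_le_sum[of \<xi> F "\<lambda>\<xi>. \<Sum>i\<in>UNIV. \<bar>\<xi> $ i\<bar>"]) (auto intro: sum_nonneg)
        finally show ?thesis by (simp add: N_def sum_nonneg)
      qed
      then show ?thesis by (auto simp: abs_le_iff minus_le_iff)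
    qed
    have "(\<Sum>\<xi>\<in>F. (1 + freq_sq \<xi>) powr (- s)) \<le> (\<Sum>\<xi>\<in>F. \<Prod>i\<in>UNIV. f (\<xi> $ i))"
      by (intro sum_mono term_le)
    also have "\<dots> = (\<Sum>g\<in>vec_nth ` F. \<Prod>i\<in>UNIV. f (g i))"
      by (subst sum.reindex) (auto simp: inj_on_def vec_nth_inject)
    also have "\<dots> \<le> (\<Sum>g\<in>(\<Pi>\<^sub>E i\<in>(UNIV::'d set). {- int N..int N}). \<Prod>i\<in>UNIV. f (g i))"
      using mem by (intro sum_mono2 finite_PiE) (auto simp: f0 prod_nonneg)
    also have "\<dots> = (\<Prod>i\<in>(UNIV::'d set). \<Sum>n\<in>{- int N..int N}. f n)"
      by (rule prod_sum_PiE[symmetric]) auto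
    also have "\<dots> \<le> (\<Prod>i\<in>(UNIV::'d set). 2 * S)"
      by (intro prod_mono) (auto simp: int_bd f0 sum_nonneg)
    finally show ?thesis by simp
  qed
  then show ?thesis by blast
qed

text \<open>Cauchy-Schwarz against \<open>wt (- s)\<close>: the embedding of H^s into absolutely
  summable sequences, through which s > d/2 enters the product estimates. The constant sqrt B + 1 is
  chosen to be strictly positive.\<close>

lemma hs_le_sum_bound:
  assumes "real CARD('d) / 2 < s"
  obtains K where "0 < K" "\<And>(a :: int ^ 'd::finite \<Rightarrow> complex) A F. hs_le s a A \<Longrightarrow> finite F \<Longrightarrow> (\<Sum>\<xi>\<in>F. cmod (a \<xi>)) \<le> K * A"
proof -
  obtain B where B: "\<And>F :: (int ^ 'd) set. finite F \<Longrightarrow> (\<Sum>\<xi>\<in>F. (1 + freq_sq \<xi>) powr (- s)) \<le> B"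
    using sum_inverse_weight_bounded[OF assms] by blast
  have B0: "0 \<le> B" using B[of "{}"] by simp
  have "(\<Sum>\<xi>\<in>F. cmod (a \<xi>)) \<le> (sqrt B + 1) * A" if a: "hs_le s a A" and F: "finite F"
    for a :: "int ^ 'd \<Rightarrow> complex" and A and F :: "(int ^ 'd) set"
  proof -
    have A0: "0 \<le> A" by (rule hs_le_nonneg[OF a])
    have "(\<Sum>\<xi>\<in>F. cmod (a \<xi>)) = (\<Sum>\<xi>\<in>F. \<bar>wt (- s) \<xi>\<bar> * \<bar>wt s \<xi> * cmod (a \<xi>)\<bar>)"
    proof (rule sum.cong)
      fix \<xi> :: "int ^ 'd"
      have "wt (- s) \<xi> * wt s \<xi> = 1"
        using freq_sq_nonneg[of \<xi>] by (simp add: wt_def powr_add[symmetric])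
      then show "cmod (a \<xi>) = \<bar>wt (- s) \<xi>\<bar> * \<bar>wt s \<xi> * cmod (a \<xi>)\<bar>"
        by (simp add: wt_nonneg abs_mult flip: mult.assoc)
    qed simp
    also have "\<dots> \<le> L2_set (wt (- s)) F * L2_set (\<lambda>\<xi>. wt s \<xi> * cmod (a \<xi>)) F"
      by (rule L2_set_mult_ineq)
    also have "\<dots> \<le> sqrt B * A"
      using a F B[OF F] by (intro mult_mono) (auto simp: hs_le_def L2_set_def wt_sq B0 sum_nonneg)
    also have "\<dots> \<le> (sqrt B + 1) * A"
      using A0 by (simp add: algebra_simps)
    finally show ?thesis .
  qed
  then show thesis
    using B0 by (intro that[of "sqrt B + 1"]) (auto simp: add_nonneg_pos)
qed

section \<open>Twisted triple convolutions\<close>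

lemma has_sum_sum:
  fixes f :: "'i \<Rightarrow> 'a \<Rightarrow> 'b::topological_comm_monoid_add"
  assumes "finite I" "\<And>i. i \<in> I \<Longrightarrow> (f i has_sum S i) A"
  shows "((\<lambda>x. \<Sum>i\<in>I. f i x) has_sum (\<Sum>i\<in>I. S i)) A"
  using assms by (induction I rule: finite_induct) (auto intro!: has_sum_add)

text \<open>Young's inequality for l2 * l1 * l1 in dual form: for fixed y and z, Cauchy-Schwarz in x
  is insensitive to the shift by y + z, and the sums over y and z then meet only the l1
  bounds.\<close>

lemma sum_trilinear_le:
  fixes d A B C :: "int ^ 'd::finite \<Rightarrow> real"
  assumes "\<And>F. finite F \<Longrightarrow> L2_set d F \<le> D" "\<And>F. finite F \<Longrightarrow> L2_set A F \<le> \<alpha>"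
    and "\<And>F. finite F \<Longrightarrow> sum B F \<le> \<beta>" "\<And>F. finite F \<Longrightarrow> sum C F \<le> \<kappa>"
    and nonneg: "\<And>x. 0 \<le> d x" "\<And>x. 0 \<le> A x" "\<And>x. 0 \<le> B x" "\<And>x. 0 \<le> C x"
    and fin: "finite F1" "finite F2" "finite F3"
  shows "(\<Sum>x\<in>F1. \<Sum>y\<in>F2. \<Sum>z\<in>F3. d (x + y + z) * (A x * B y * C z)) \<le> D * (\<alpha> * \<beta> * \<kappa>)"
proof -
  have D: "0 \<le> D" and \<alpha>: "0 \<le> \<alpha>" and \<beta>: "0 \<le> \<beta>" and \<kappa>: "0 \<le> \<kappa>"
    using assms(1)[of "{}"] assms(2)[of "{}"] assms(3)[of "{}"] assms(4)[of "{}"] by auto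
  have inner: "(\<Sum>x\<in>F1. d (x + (y + z)) * A x) \<le> D * \<alpha>" for y z
  proof -
    have "(\<Sum>x\<in>F1. d (x + (y + z)) * A x) = (\<Sum>x\<in>F1. \<bar>d (x + (y + z))\<bar> * \<bar>A x\<bar>)"
      by (simp add: nonneg)
    also have "\<dots> \<le> L2_set (\<lambda>x. d (x + (y + z))) F1 * L2_set A F1"
      by (rule L2_set_mult_ineq)
    also have "L2_set (\<lambda>x. d (x + (y + z))) F1 = L2_set d ((\<lambda>x. x + (y + z)) ` F1)"
      by (simp add: L2_set_def sum.reindex)
    also have "\<dots> * L2_set A F1 \<le> D * \<alpha>"
      using fin D by (intro mult_mono assms) auto
    finally show ?thesis .
  qed
  have "(\<Sum>x\<in>F1. \<Sum>y\<in>F2. \<Sum>z\<in>F3. d (x + y + z) * (A x * B y * C z))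
      = (\<Sum>y\<in>F2. \<Sum>z\<in>F3. \<Sum>x\<in>F1. d (x + y + z) * (A x * B y * C z))"
    by (subst sum.swap, rule sum.cong[OF refl], rule sum.swap)
  also have "\<dots> = (\<Sum>y\<in>F2. \<Sum>z\<in>F3. B y * C z * (\<Sum>x\<in>F1. d (x + (y + z)) * A x))"
    by (simp add: sum_distrib_left mult_ac add_ac)
  also have "\<dots> \<le> (\<Sum>y\<in>F2. \<Sum>z\<in>F3. B y * C z * (D * \<alpha>))"
    by (intro sum_mono mult_left_mono inner mult_nonneg_nonneg nonneg)
  also have "\<dots> = sum B F2 * sum C F3 * (D * \<alpha>)"
    by (simp only: sum_distrib_left[symmetric] sum_distrib_right[symmetric])
  also have "\<dots> \<le> \<beta> * \<kappa> * (D * \<alpha>)"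
    using fin D \<alpha> \<beta> by (intro mult_right_mono mult_mono assms) (auto intro: sum_nonneg nonneg)
  finally show ?thesis by (simp add: mult_ac)
qed

text \<open>\<open>wt_triangle\<close> moves the weight onto one factor, which stays in l2, while
  the other two go to l1 at the price of K each. The three choices of the weighted factor give 3
  K^2; the triangle inequality gives 3 powr s.\<close>

lemma sum_weighted_trilinear_le:
  fixes d :: "int ^ 'd::finite \<Rightarrow> real" and a b c :: "int ^ 'd \<Rightarrow> complex"
  assumes K: "\<And>(a :: int ^ 'd \<Rightarrow> complex) A F. hs_le s a A \<Longrightarrow> finite F \<Longrightarrow> (\<Sum>\<xi>\<in>F. cmod (a \<xi>)) \<le> K * A"
    and s: "0 \<le> s"
    and d: "\<And>F. finite F \<Longrightarrow> L2_set d F \<le> D" "\<And>x. 0 \<le> d x"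
    and a: "hs_le s a \<alpha>" and b: "hs_le s b \<beta>" and c: "hs_le s c \<kappa>"
    and fin: "finite F1" "finite F2" "finite F3"
  shows "(\<Sum>x\<in>F1. \<Sum>y\<in>F2. \<Sum>z\<in>F3. d (x + y + z) * (wt s (x + y + z) * (cmod (a x) * cmod (b y) * cmod (c z))))
      \<le> 3 powr s * 3 * K\<^sup>2 * D * (\<alpha> * \<beta> * \<kappa>)"
proof -
  define w :: "int ^ 'd \<Rightarrow> real" where "w = wt s"
  define p where "p = (3::real) powr s"
  have p0: "0 \<le> p" by (simp add: p_def)
  have w0: "0 \<le> w x" for x by (simp add: w_def wt_nonneg)
  note l2 = a[unfolded hs_le_def, rule_format, folded w_def] b[unfolded hs_le_def, rule_format, folded w_def]
    c[unfolded hs_le_def, rule_format, folded w_def]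
  note l1 = K[OF a] K[OF b] K[OF c]
  have t1: "(\<Sum>x\<in>F1. \<Sum>y\<in>F2. \<Sum>z\<in>F3. d (x + y + z) * ((w x * cmod (a x)) * cmod (b y) * cmod (c z)))
      \<le> D * (\<alpha> * (K * \<beta>) * (K * \<kappa>))"
    by (rule sum_trilinear_le[OF d(1) l2(1) l1(2) l1(3)]) (simp_all add: d w0 fin)
  have t2: "(\<Sum>y\<in>F2. \<Sum>x\<in>F1. \<Sum>z\<in>F3. d (y + x + z) * ((w y * cmod (b y)) * cmod (a x) * cmod (c z)))
      \<le> D * (\<beta> * (K * \<alpha>) * (K * \<kappa>))"
    by (rule sum_trilinear_le[OF d(1) l2(2) l1(1) l1(3)]) (simp_all add: d w0 fin)
  have t3: "(\<Sum>z\<in>F3. \<Sum>x\<in>F1. \<Sum>y\<in>F2. d (z + x + y) * ((w z * cmod (c z)) * cmod (a x) * cmod (b y)))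
      \<le> D * (\<kappa> * (K * \<alpha>) * (K * \<beta>))"
    by (rule sum_trilinear_le[OF d(1) l2(3) l1(1) l1(2)]) (simp_all add: d w0 fin)
  have t2': "(\<Sum>y\<in>F2. \<Sum>x\<in>F1. \<Sum>z\<in>F3. d (y + x + z) * ((w y * cmod (b y)) * cmod (a x) * cmod (c z)))
     = (\<Sum>x\<in>F1. \<Sum>y\<in>F2. \<Sum>z\<in>F3. d (x + y + z) * (w y * (cmod (a x) * cmod (b y) * cmod (c z))))"
    by (subst sum.swap) (simp add: ac_simps)
  have t3': "(\<Sum>z\<in>F3. \<Sum>x\<in>F1. \<Sum>y\<in>F2. d (z + x + y) * ((w z * cmod (c z)) * cmod (a x) * cmod (b y)))
     = (\<Sum>x\<in>F1. \<Sum>y\<in>F2. \<Sum>z\<in>F3. d (x + y + z) * (w z * (cmod (a x) * cmod (b y) * cmod (c z))))"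
    by (subst sum.swap, rule sum.cong[OF refl], subst sum.swap) (simp add: ac_simps)
  have "(\<Sum>x\<in>F1. \<Sum>y\<in>F2. \<Sum>z\<in>F3. d (x + y + z) * (w (x + y + z) * (cmod (a x) * cmod (b y) * cmod (c z))))
     \<le> (\<Sum>x\<in>F1. \<Sum>y\<in>F2. \<Sum>z\<in>F3. d (x + y + z) * (p * (w x + w y + w z) * (cmod (a x) * cmod (b y) * cmod (c z))))"
    unfolding w_def p_def
    by (intro sum_mono mult_left_mono mult_right_mono wt_triangle s d) auto
  also have "\<dots> = p * ((\<Sum>x\<in>F1. \<Sum>y\<in>F2. \<Sum>z\<in>F3. d (x + y + z) * ((w x * cmod (a x)) * cmod (b y) * cmod (c z)))
     + (\<Sum>x\<in>F1. \<Sum>y\<in>F2. \<Sum>z\<in>F3. d (x + y + z) * (w y * (cmod (a x) * cmod (b y) * cmod (c z))))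
     + (\<Sum>x\<in>F1. \<Sum>y\<in>F2. \<Sum>z\<in>F3. d (x + y + z) * (w z * (cmod (a x) * cmod (b y) * cmod (c z)))))"
    unfolding sum.distrib[symmetric] sum_distrib_left by (intro sum.cong refl) (simp add: algebra_simps)
  also have "\<dots> \<le> p * (D * (\<alpha> * (K * \<beta>) * (K * \<kappa>)) + D * (\<beta> * (K * \<alpha>) * (K * \<kappa>)) + D * (\<kappa> * (K * \<alpha>) * (K * \<beta>)))"
    using t1 t2 t3 t2' t3' p0 by (intro mult_left_mono add_mono) auto
  also have "\<dots> = p * 3 * K\<^sup>2 * D * (\<alpha> * \<beta> * \<kappa>)"
    by (simp add: algebra_simps power2_eq_square)
  finally show ?thesis by (simp add: w_def p_def)
qed

text \<open>There are only two summation variables because the output frequency fixes the third. The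
  kernel \<open>m\<close> absorbs phases and Fourier multipliers, so that all nonlinear terms of the
  equation and the scheme are built from this one form.\<close>

definition tri :: "(int ^ 'd \<Rightarrow> int ^ 'd \<Rightarrow> int ^ 'd \<Rightarrow> complex) \<Rightarrow> (int ^ 'd \<Rightarrow> complex) \<Rightarrow>
    (int ^ 'd \<Rightarrow> complex) \<Rightarrow> (int ^ 'd \<Rightarrow> complex) \<Rightarrow> int ^ 'd \<Rightarrow> complex" where
  "tri m a b c \<xi> = (\<Sum>\<^sub>\<infinity>p. m (fst p) (snd p) (\<xi> - fst p - snd p) *
      (a (fst p) * b (snd p) * c (\<xi> - fst p - snd p)))"

text \<open>The passage from an output frequency and a pair to the triple of input frequencies is
  injective, so a nonnegative double sum is part of a sum over a finite box of triples.\<close>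

lemma sum_pairs_le_sum_triples:
  fixes g :: "int ^ 'd::finite \<Rightarrow> int ^ 'd \<Rightarrow> int ^ 'd \<Rightarrow> real"
  assumes g: "\<And>x y z. 0 \<le> g x y z" and fin: "finite F" "finite P"
  shows "\<exists>F1 F2 F3. finite F1 \<and> finite F2 \<and> finite F3 \<and>
    (\<Sum>\<xi>\<in>F. \<Sum>p\<in>P. g (fst p) (snd p) (\<xi> - fst p - snd p)) \<le> (\<Sum>x\<in>F1. \<Sum>y\<in>F2. \<Sum>z\<in>F3. g x y z)"
proof -
  define f :: "_ \<Rightarrow> (int ^ 'd) \<times> (int ^ 'd) \<times> (int ^ 'd)"
    where "f = (\<lambda>(\<xi>, p). (fst p, snd p, \<xi> - fst p - snd p))"
  define F1 F2 F3 where "F1 = fst ` P" and "F2 = snd ` P"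
    and "F3 = (\<lambda>(\<xi>, p). \<xi> - fst p - snd p) ` (F \<times> P)"
  have fin': "finite F1" "finite F2" "finite F3"
    using fin by (auto simp: F1_def F2_def F3_def)
  have "inj_on f (F \<times> P)"
    by (auto simp: inj_on_def f_def)
  then have "(\<Sum>\<xi>\<in>F. \<Sum>p\<in>P. g (fst p) (snd p) (\<xi> - fst p - snd p))
      = (\<Sum>(x, y, z)\<in>f ` (F \<times> P). g x y z)"
    by (simp add: sum.reindex sum.cartesian_product) (simp add: f_def case_prod_unfold)
  also have "\<dots> \<le> (\<Sum>(x, y, z)\<in>F1 \<times> F2 \<times> F3. g x y z)"
  proof (rule sum_mono2)
    show "f ` (F \<times> P) \<subseteq> F1 \<times> F2 \<times> F3"
      by (force simp: f_def F1_def F2_def F3_def)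
  qed (use fin' in \<open>auto simp: g\<close>)
  also have "\<dots> = (\<Sum>x\<in>F1. \<Sum>y\<in>F2. \<Sum>z\<in>F3. g x y z)"
    by (simp add: sum.cartesian_product)
  finally show ?thesis using fin' by blast
qed

lemma tri_abs_summable:
  assumes s: "real CARD('d) / 2 < s"
    and a: "hs_le s a \<alpha>" and b: "hs_le s b \<beta>" and c: "hs_le s (c :: int ^ 'd::finite \<Rightarrow> complex) \<kappa>"
  shows "(\<lambda>p. cmod (a (fst p) * b (snd p) * c (\<xi> - fst p - snd p))) summable_on UNIV"
proof -
  obtain K where "K > 0" and K: "\<And>(a :: int ^ 'd \<Rightarrow> complex) A F. hs_le s a A \<Longrightarrow> finite F \<Longrightarrow> (\<Sum>\<xi>\<in>F. cmod (a \<xi>)) \<le> K * A"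
    using hs_le_sum_bound[OF s] by metis
  have s0: "0 \<le> s" using s by (smt (verit) divide_nonneg_nonneg of_nat_0_le_iff)
  \<comment> \<open>A point mass at \<xi>, normalised by the weight there: testing with it turns the
    trilinear bound into a bound for the sum that defines a single coefficient.\<close>
  define d :: "int ^ 'd \<Rightarrow> real" where "d \<eta> = (if \<eta> = \<xi> then 1 / wt s \<xi> else 0)" for \<eta>
  have dL2: "L2_set d F \<le> 1 / wt s \<xi>" if "finite F" for F
  proof -
    have "(\<Sum>x\<in>F. (d x)\<^sup>2) = (if \<xi> \<in> F then (1 / wt s \<xi>)\<^sup>2 else 0)"
      unfolding d_def if_distrib[of "\<lambda>t. t ^ 2"] zero_power2 using that by simp
    then show ?thesis using wt_pos[of s \<xi>] by (simp add: L2_set_def real_sqrt_divide)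
  qed
  show ?thesis
  proof (rule nonneg_bdd_above_summable_on)
    show "bdd_above (sum (\<lambda>p. cmod (a (fst p) * b (snd p) * c (\<xi> - fst p - snd p))) ` {F. F \<subseteq> UNIV \<and> finite F})"
    proof (rule bdd_aboveI2)
      fix P :: "((int ^ 'd) \<times> (int ^ 'd)) set"
      assume "P \<in> {F. F \<subseteq> UNIV \<and> finite F}"
      then have P: "finite P" by simp
      define g where "g x y z = d (x + y + z) * (wt s (x + y + z) * (cmod (a x) * cmod (b y) * cmod (c z)))" for x y z
      have "g x y z \<ge> 0" for x y z
        using wt_pos[of s \<xi>] by (simp add: g_def d_def)
      then obtain F1 F2 F3 where F: "finite F1" "finite F2" "finite F3"
        "(\<Sum>\<eta>\<in>{\<xi>}. \<Sum>p\<in>P. g (fst p) (snd p) (\<eta> - fst p - snd p)) \<le> (\<Sum>x\<in>F1. \<Sum>y\<in>F2. \<Sum>z\<in>F3. g x y z)"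
        using sum_pairs_le_sum_triples[of g "{\<xi>}" P] P by auto
      have "(\<Sum>p\<in>P. cmod (a (fst p) * b (snd p) * c (\<xi> - fst p - snd p)))
          = (\<Sum>\<eta>\<in>{\<xi>}. \<Sum>p\<in>P. g (fst p) (snd p) (\<eta> - fst p - snd p))"
        using wt_pos[of s \<xi>] by (simp add: g_def d_def norm_mult)
      also note F(4)
      also have "(\<Sum>x\<in>F1. \<Sum>y\<in>F2. \<Sum>z\<in>F3. g x y z) \<le> 3 powr s * 3 * K\<^sup>2 * (1 / wt s \<xi>) * (\<alpha> * \<beta> * \<kappa>)"
        unfolding g_def using wt_pos[of s \<xi>]
        by (intro sum_weighted_trilinear_le K s0 dL2 a b c F) (auto simp: d_def)
      finally show "(\<Sum>p\<in>P. cmod (a (fst p) * b (snd p) * c (\<xi> - fst p - snd p)))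
        \<le> 3 powr s * 3 * K\<^sup>2 * (1 / wt s \<xi>) * (\<alpha> * \<beta> * \<kappa>)" .
    qed
  qed simp
qed

lemma tri_summable:
  assumes s: "real CARD('d) / 2 < s"
    and m: "\<And>x y z. cmod (m x y z) \<le> \<mu>"
    and "hs_le s a \<alpha>" "hs_le s b \<beta>" "hs_le s (c :: int ^ 'd::finite \<Rightarrow> complex) \<kappa>"
  shows "(\<lambda>p. cmod (m (fst p) (snd p) (\<xi> - fst p - snd p) *
      (a (fst p) * b (snd p) * c (\<xi> - fst p - snd p)))) summable_on UNIV"
    and "(\<lambda>p. m (fst p) (snd p) (\<xi> - fst p - snd p) *
      (a (fst p) * b (snd p) * c (\<xi> - fst p - snd p))) summable_on UNIV"
proof -
  show "(\<lambda>p. cmod (m (fst p) (snd p) (\<xi> - fst p - snd p) *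
      (a (fst p) * b (snd p) * c (\<xi> - fst p - snd p)))) summable_on UNIV"
  proof (rule summable_on_comparison_test)
    show "(\<lambda>p. \<mu> * cmod (a (fst p) * b (snd p) * c (\<xi> - fst p - snd p))) summable_on UNIV"
      by (intro summable_on_cmult_right tri_abs_summable[OF assms(1,3,4,5)])
  qed (simp_all only: norm_mult mult_right_mono[OF m] norm_ge_zero mult_nonneg_nonneg)
  then show "(\<lambda>p. m (fst p) (snd p) (\<xi> - fst p - snd p) *
      (a (fst p) * b (snd p) * c (\<xi> - fst p - snd p))) summable_on UNIV"
    by (rule abs_summable_summable)
qed

text \<open>Duality: the weighted square norm of \<open>tri m a b c\<close> over a finite set is tested against
  \<open>d = wt s * \<bar>tri m a b c\<bar>\<close> itself.\<close>

lemma hs_le_tri_bound: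
  assumes s: "real CARD('d) / 2 < s"
  obtains K where "0 < K" "\<And>m (a :: int ^ 'd::finite \<Rightarrow> complex) b c \<mu> \<alpha> \<beta> \<kappa>.
    (\<And>x y z. cmod (m x y z) \<le> \<mu>) \<Longrightarrow> hs_le s a \<alpha> \<Longrightarrow> hs_le s b \<beta> \<Longrightarrow> hs_le s c \<kappa>
    \<Longrightarrow> hs_le s (tri m a b c) (K * (\<mu> * \<alpha> * \<beta> * \<kappa>))"
proof -
  obtain K where "K > 0" and K: "\<And>(a :: int ^ 'd \<Rightarrow> complex) A F. hs_le s a A \<Longrightarrow> finite F \<Longrightarrow> (\<Sum>\<xi>\<in>F. cmod (a \<xi>)) \<le> K * A"
    using hs_le_sum_bound[OF s] by metis
  have s0: "0 \<le> s" using s by (smt (verit) divide_nonneg_nonneg of_nat_0_le_iff)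
  define K' where "K' = 3 powr s * 3 * K\<^sup>2"
  have "hs_le s (tri m a b c) (K' * (\<mu> * \<alpha> * \<beta> * \<kappa>))"
    if m: "\<And>x y z. cmod (m x y z) \<le> \<mu>" and a: "hs_le s a \<alpha>" and b: "hs_le s b \<beta>" and c: "hs_le s c \<kappa>"
    for m and a b c :: "int ^ 'd \<Rightarrow> complex" and \<mu> \<alpha> \<beta> \<kappa>
    unfolding hs_le_def
  proof (intro allI impI)
    fix F :: "(int ^ 'd) set"
    assume F: "finite F"
    have \<mu>: "0 \<le> \<mu>" by (rule order_trans[OF norm_ge_zero m])
    define t where "t = tri m a b c"
    define d where "d \<xi> = (if \<xi> \<in> F then wt s \<xi> * cmod (t \<xi>) else 0)" for \<xi>
    define N where "N = L2_set d F"
    have d0: "0 \<le> d \<xi>" for \<xi> by (simp add: d_def wt_nonneg)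
    have dL2: "L2_set d G \<le> N" if "finite G" for G
    proof -
      have "(\<Sum>x\<in>G. (d x)\<^sup>2) = (\<Sum>x\<in>G \<inter> F. (d x)\<^sup>2)"
        using that by (intro sum.mono_neutral_right) (auto simp: d_def)
      also have "\<dots> \<le> (\<Sum>x\<in>F. (d x)\<^sup>2)"
        using F by (intro sum_mono2) auto
      finally show ?thesis by (simp add: N_def L2_set_def)
    qed
    define h where "h \<xi> p = cmod (a (fst p) * b (snd p) * c (\<xi> - fst p - snd p))" for \<xi> p
    have hs: "h \<xi> summable_on UNIV" for \<xi>
      unfolding h_def by (rule tri_abs_summable[OF s a b c])
    have t_le: "cmod (t \<xi>) \<le> \<mu> * infsum (h \<xi>) UNIV" for \<xi>
    proof -
      have "cmod (t \<xi>) \<le> (\<Sum>\<^sub>\<infinity>p. cmod (m (fst p) (snd p) (\<xi> - fst p - snd p) *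
          (a (fst p) * b (snd p) * c (\<xi> - fst p - snd p))))"
        unfolding t_def tri_def by (rule norm_infsum_bound[OF tri_summable(1)[OF s m a b c]])
      also have "\<dots> \<le> (\<Sum>\<^sub>\<infinity>p. \<mu> * h \<xi> p)"
      proof (rule infsum_mono[OF tri_summable(1)[OF s m a b c]])
        show "(\<lambda>p. \<mu> * h \<xi> p) summable_on UNIV" by (intro summable_on_cmult_right hs)
      qed (simp only: h_def norm_mult mult_right_mono[OF m] norm_ge_zero mult_nonneg_nonneg)
      also have "\<dots> = \<mu> * infsum (h \<xi>) UNIV" by (rule infsum_cmult_right')
      finally show ?thesis .
    qed
    have hsum: "((\<lambda>p. \<Sum>\<xi>\<in>F. d \<xi> * (wt s \<xi> * h \<xi> p)) has_sum
        (\<Sum>\<xi>\<in>F. d \<xi> * (wt s \<xi> * infsum (h \<xi>) UNIV))) UNIV"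
      by (intro has_sum_sum F has_sum_cmult_right has_sum_infsum hs)
    have le: "(\<Sum>\<xi>\<in>F. d \<xi> * (wt s \<xi> * infsum (h \<xi>) UNIV)) \<le> K' * N * (\<alpha> * \<beta> * \<kappa>)"
    proof (rule has_sum_le_finite_sums[OF hsum])
      fix P :: "((int ^ 'd) \<times> (int ^ 'd)) set"
      assume P: "finite P"
      define g where "g x y z = d (x + y + z) * (wt s (x + y + z) * (cmod (a x) * cmod (b y) * cmod (c z)))" for x y z
      have "g x y z \<ge> 0" for x y z
        by (simp add: g_def d0 wt_nonneg)
      then obtain F1 F2 F3 where F': "finite F1" "finite F2" "finite F3"
        "(\<Sum>\<xi>\<in>F. \<Sum>p\<in>P. g (fst p) (snd p) (\<xi> - fst p - snd p)) \<le> (\<Sum>x\<in>F1. \<Sum>y\<in>F2. \<Sum>z\<in>F3. g x y z)"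
        using sum_pairs_le_sum_triples[of g F P] P F by auto
      have "(\<Sum>p\<in>P. \<Sum>\<xi>\<in>F. d \<xi> * (wt s \<xi> * h \<xi> p)) = (\<Sum>\<xi>\<in>F. \<Sum>p\<in>P. g (fst p) (snd p) (\<xi> - fst p - snd p))"
        by (subst sum.swap) (simp add: g_def h_def norm_mult)
      also note F'(4)
      also have "(\<Sum>x\<in>F1. \<Sum>y\<in>F2. \<Sum>z\<in>F3. g x y z) \<le> K' * N * (\<alpha> * \<beta> * \<kappa>)"
        unfolding g_def K'_def
        by (intro sum_weighted_trilinear_le K s0 dL2 d0 a b c F')
      finally show "(\<Sum>p\<in>P. \<Sum>\<xi>\<in>F. d \<xi> * (wt s \<xi> * h \<xi> p)) \<le> K' * N * (\<alpha> * \<beta> * \<kappa>)" .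
    qed
    have "N\<^sup>2 = (\<Sum>\<xi>\<in>F. (d \<xi>)\<^sup>2)"
      by (simp add: N_def L2_set_def sum_nonneg)
    also have "\<dots> = (\<Sum>\<xi>\<in>F. d \<xi> * (wt s \<xi> * cmod (t \<xi>)))"
      by (intro sum.cong refl) (simp add: d_def power2_eq_square)
    also have "\<dots> \<le> (\<Sum>\<xi>\<in>F. d \<xi> * (wt s \<xi> * (\<mu> * infsum (h \<xi>) UNIV)))"
      by (intro sum_mono mult_left_mono t_le d0 wt_nonneg)
    also have "\<dots> = \<mu> * (\<Sum>\<xi>\<in>F. d \<xi> * (wt s \<xi> * infsum (h \<xi>) UNIV))"
      by (simp add: sum_distrib_left mult_ac)
    also have "\<dots> \<le> \<mu> * (K' * N * (\<alpha> * \<beta> * \<kappa>))"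
      by (intro mult_left_mono le \<mu>)
    finally have N: "N * N \<le> (K' * (\<mu> * \<alpha> * \<beta> * \<kappa>)) * N"
      by (simp add: power2_eq_square mult_ac)
    have "0 \<le> K' * (\<mu> * \<alpha> * \<beta> * \<kappa>)"
      using \<mu> hs_le_nonneg[OF a] hs_le_nonneg[OF b] hs_le_nonneg[OF c] by (simp add: K'_def)
    then have "N \<le> K' * (\<mu> * \<alpha> * \<beta> * \<kappa>)"
      using N mult_right_le_imp_le[of N N "K' * (\<mu> * \<alpha> * \<beta> * \<kappa>)"]
      by (cases "N > 0") auto
    moreover have "N = L2_set (\<lambda>\<xi>. wt s \<xi> * cmod (tri m a b c \<xi>)) F"
      unfolding N_def by (intro L2_set_cong) (simp_all add: d_def t_def)
    ultimately show "L2_set (\<lambda>\<xi>. wt s \<xi> * cmod (tri m a b c \<xi>)) F \<le> K' * (\<mu> * \<alpha> * \<beta> * \<kappa>)"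
      by simp
  qed
  then show thesis
    using \<open>K > 0\<close> by (intro that[of K']) (auto simp: K'_def)
qed

section \<open>Multilinearity and multiplier calculus of twisted convolutions\<close>

context
  fixes s :: real and m :: "int ^ 'd::finite \<Rightarrow> int ^ 'd \<Rightarrow> int ^ 'd \<Rightarrow> complex" and \<mu> :: real
  assumes s: "real CARD('d) / 2 < s" and m: "\<And>x y z. cmod (m x y z) \<le> \<mu>"
begin

text \<open>Additivity rests on the summability supplied by the \<open>hs_le\<close> hypotheses,
  since \<open>infsum\<close> is 0 on a non-summable family. The rules for constant factors further
  below hold in any case.\<close>

lemma tri_add_left:
  assumes "hs_le s a \<alpha>" "hs_le s a' \<alpha>'" "hs_le s b \<beta>" "hs_le s c \<kappa>"
  shows "tri m (\<lambda>\<xi>. a \<xi> + a' \<xi>) b c \<xi> = tri m a b c \<xi> + tri m a' b c \<xi>"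
  unfolding tri_def
  by (subst infsum_add[OF tri_summable(2)[OF s m assms(1,3,4)] tri_summable(2)[OF s m assms(2,3,4)], symmetric])
     (simp add: algebra_simps)

lemma tri_add_mid:
  assumes "hs_le s a \<alpha>" "hs_le s b \<beta>" "hs_le s b' \<beta>'" "hs_le s c \<kappa>"
  shows "tri m a (\<lambda>\<xi>. b \<xi> + b' \<xi>) c \<xi> = tri m a b c \<xi> + tri m a b' c \<xi>"
  unfolding tri_def
  by (subst infsum_add[OF tri_summable(2)[OF s m assms(1,2,4)] tri_summable(2)[OF s m assms(1,3,4)], symmetric])
     (simp add: algebra_simps)

lemma tri_add_right:
  assumes "hs_le s a \<alpha>" "hs_le s b \<beta>" "hs_le s c \<kappa>" "hs_le s c' \<kappa>'"
  shows "tri m a b (\<lambda>\<xi>. c \<xi> + c' \<xi>) \<xi> = tri m a b c \<xi> + tri m a b c' \<xi>"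
  unfolding tri_def
  by (subst infsum_add[OF tri_summable(2)[OF s m assms(1,2,3)] tri_summable(2)[OF s m assms(1,2,4)], symmetric])
     (simp add: algebra_simps)

lemma tri_kernel_add:
  assumes m': "\<And>x y z. cmod (m' x y z) \<le> \<mu>'" and "hs_le s a \<alpha>" "hs_le s b \<beta>" "hs_le s c \<kappa>"
  shows "tri (\<lambda>x y z. m x y z + m' x y z) a b c \<xi> = tri m a b c \<xi> + tri m' a b c \<xi>"
  unfolding tri_def
  by (subst infsum_add[OF tri_summable(2)[OF s m assms(2-4)] tri_summable(2)[OF s m' assms(2-4)], symmetric])
     (simp add: algebra_simps)

end

lemma tri_kernel_cmult: "tri (\<lambda>x y z. k * m x y z) a b c \<xi> = k * tri m a b c \<xi>"
  unfolding tri_def by (subst infsum_cmult_right'[symmetric]) (simp add: mult_ac)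

lemma tri_cmult_left: "tri m (\<lambda>\<xi>. k * a \<xi>) b c \<xi> = k * tri m a b c \<xi>"
  unfolding tri_def by (subst infsum_cmult_right'[symmetric]) (simp add: mult_ac)

lemma tri_cmult_mid: "tri m a (\<lambda>\<xi>. k * b \<xi>) c \<xi> = k * tri m a b c \<xi>"
  unfolding tri_def by (subst infsum_cmult_right'[symmetric]) (simp add: mult_ac)

lemma tri_cmult_right: "tri m a b (\<lambda>\<xi>. k * c \<xi>) \<xi> = k * tri m a b c \<xi>"
  unfolding tri_def by (subst infsum_cmult_right'[symmetric]) (simp add: mult_ac)

lemma tri_multipliers:
  "tri m (\<lambda>\<xi>. p \<xi> * a \<xi>) (\<lambda>\<xi>. q \<xi> * b \<xi>) (\<lambda>\<xi>. r \<xi> * c \<xi>)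
    = tri (\<lambda>x y z. m x y z * (p x * q y * r z)) a b c"
  unfolding tri_def by (intro ext infsum_cong) (simp add: mult_ac)

text \<open>In every summand the three frequencies add up to \<xi>, so an output multiplier is a
  kernel as well.\<close>

lemma tri_outer_multiplier:
  "h \<xi> * tri m a b c \<xi> = tri (\<lambda>x y z. h (x + y + z) * m x y z) a b c \<xi>"
  unfolding tri_def by (subst infsum_cmult_right'[symmetric]) (simp add: mult_ac)

text \<open>A kernel growing like the product of the squared frequencies costs two derivatives on each factor.\<close>

lemma tri_weighted:
  fixes J :: "int ^ 'd::finite \<Rightarrow> complex"
  assumes J: "\<And>\<xi>. J \<xi> \<noteq> 0"
  shows "tri m a b c = tri (\<lambda>x y z. m x y z / (J x * J y * J z)) (\<lambda>\<xi>. J \<xi> * a \<xi>) (\<lambda>\<xi>. J \<xi> * b \<xi>) (\<lambda>\<xi>. J \<xi> * c \<xi>)"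
  by (simp add: tri_multipliers J)

lemma hs_le_tri_weighted:
  assumes K: "\<And>m (a :: int ^ 'd::finite \<Rightarrow> complex) b c \<mu> \<alpha> \<beta> \<kappa>.
    (\<And>x y z. cmod (m x y z) \<le> \<mu>) \<Longrightarrow> hs_le s a \<alpha> \<Longrightarrow> hs_le s b \<beta> \<Longrightarrow> hs_le s c \<kappa>
    \<Longrightarrow> hs_le s (tri m a b c) (K * (\<mu> * \<alpha> * \<beta> * \<kappa>))"
    and m: "\<And>x y z. cmod (m x y z) \<le> \<mu> * ((1 + freq_sq x) * (1 + freq_sq y) * (1 + freq_sq z))"
    and "hs_le (s + 2) a \<alpha>" "hs_le (s + 2) b \<beta>" "hs_le (s + 2) (c :: int ^ 'd \<Rightarrow> complex) \<kappa>"
  shows "hs_le s (tri m a b c) (K * (\<mu> * \<alpha> * \<beta> * \<kappa>))"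
proof (subst tri_weighted[where J = "\<lambda>\<xi>. of_real (1 + freq_sq \<xi>)"], goal_cases)
  case (1 \<xi>)
  show ?case
    unfolding of_real_eq_0_iff using freq_sq_nonneg[of \<xi>] by linarith
next
  case 2
  show ?case
  proof (rule K)
    fix x y z :: "int ^ 'd"
    have "0 < (1 + freq_sq x) * (1 + freq_sq y) * (1 + freq_sq z)"
      using freq_sq_nonneg[of x] freq_sq_nonneg[of y] freq_sq_nonneg[of z] by simp
    moreover have "cmod (of_real (1 + freq_sq x) * of_real (1 + freq_sq y) * of_real (1 + freq_sq z))
        = (1 + freq_sq x) * (1 + freq_sq y) * (1 + freq_sq z)"
      unfolding of_real_mult[symmetric] norm_of_real using calculation by simp
    ultimately show "cmod (m x y z / (of_real (1 + freq_sq x) * of_real (1 + freq_sq y) * of_real (1 + freq_sq z))) \<le> \<mu>"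
      using m[of x y z] by (simp only: norm_divide pos_divide_le_eq)
  qed (intro hs_le_weight assms)+
qed

section \<open>Mean value estimates and termwise differentiation\<close>

lemma norm_diff_le_vector_derivative:
  fixes f :: "real \<Rightarrow> 'a::real_normed_vector"
  assumes "convex S" "\<And>t. t \<in> S \<Longrightarrow> (f has_vector_derivative f' t) (at t within S)"
    and "\<And>t. t \<in> S \<Longrightarrow> norm (f' t) \<le> B" "x \<in> S" "y \<in> S"
  shows "norm (f x - f y) \<le> B * \<bar>x - y\<bar>"
  unfolding real_norm_def[symmetric]
proof (rule differentiable_bound[where S = S and f' = "\<lambda>t x. x *\<^sub>R f' t"])
  fix t assume t: "t \<in> S"
  show "(f has_derivative (\<lambda>x. x *\<^sub>R f' t)) (at t within S)"
    using assms(2)[OF t] by (simp add: has_vector_derivative_def)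
  show "onorm (\<lambda>x. x *\<^sub>R f' t) \<le> B"
    by (rule onorm_le) (use mult_left_mono[OF assms(3)[OF t] abs_ge_zero] in \<open>simp add: mult_ac\<close>)
qed (use assms in auto)

text \<open>Duality reduces the claim to one scalar function: pairing the family over a finite set
  with the weighted conjugate of its own increment gives a function whose increment is N^2, while
  Cauchy-Schwarz bounds its derivative by N * B.\<close>

lemma mean_value_hs_le:
  fixes D D' :: "int ^ 'd::finite \<Rightarrow> real \<Rightarrow> complex"
  assumes deriv: "\<And>\<xi> t. t \<in> {0..T} \<Longrightarrow> (D \<xi> has_vector_derivative D' \<xi> t) (at t within {0..T})"
    and bound: "\<And>t. t \<in> {0..T} \<Longrightarrow> hs_le s (\<lambda>\<xi>. D' \<xi> t) B" and T: "0 \<le> T"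
  shows "hs_le s (\<lambda>\<xi>. D \<xi> T - D \<xi> 0) (B * T)"
  unfolding hs_le_def
proof (intro allI impI)
  fix F :: "(int ^ 'd) set"
  assume F: "finite F"
  define e where "e \<xi> = D \<xi> T - D \<xi> 0" for \<xi>
  define N where "N = L2_set (\<lambda>\<xi>. wt s \<xi> * cmod (e \<xi>)) F"
  define q where "q \<xi> = of_real ((wt s \<xi>)\<^sup>2) * cnj (e \<xi>)" for \<xi>
  define g where "g t = (\<Sum>\<xi>\<in>F. q \<xi> * D \<xi> t)" for t
  define g' where "g' t = (\<Sum>\<xi>\<in>F. q \<xi> * D' \<xi> t)" for t
  have N0: "0 \<le> N" by (simp add: N_def)
  have B0: "0 \<le> B" using bound[of 0] T by (auto intro: hs_le_nonneg)
  have g: "(g has_vector_derivative g' t) (at t within {0..T})" if "t \<in> {0..T}" for t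
    unfolding g_def g'_def using that by (intro has_vector_derivative_sum has_vector_derivative_mult_right deriv)
  have g'_le: "cmod (g' t) \<le> N * B" if t: "t \<in> {0..T}" for t
  proof -
    have "cmod (g' t) \<le> (\<Sum>\<xi>\<in>F. cmod (q \<xi> * D' \<xi> t))"
      unfolding g'_def by (rule norm_sum)
    also have "\<dots> = (\<Sum>\<xi>\<in>F. \<bar>wt s \<xi> * cmod (e \<xi>)\<bar> * \<bar>wt s \<xi> * cmod (D' \<xi> t)\<bar>)"
      by (intro sum.cong refl) (simp add: q_def norm_mult wt_nonneg power2_eq_square norm_power abs_mult)
    also have "\<dots> \<le> N * L2_set (\<lambda>\<xi>. wt s \<xi> * cmod (D' \<xi> t)) F"
      unfolding N_def by (rule L2_set_mult_ineq)
    also have "\<dots> \<le> N * B"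
      using bound[OF t] F N0 by (intro mult_left_mono) (auto simp: hs_le_def)
    finally show ?thesis .
  qed
  have "cmod (g T - g 0) \<le> N * B * \<bar>T - 0\<bar>"
    by (rule norm_diff_le_vector_derivative[OF _ g g'_le]) (use T in auto)
  moreover have "g T - g 0 = of_real (N\<^sup>2)"
  proof -
    have "g T - g 0 = (\<Sum>\<xi>\<in>F. q \<xi> * e \<xi>)"
      by (simp add: g_def e_def sum_subtractf right_diff_distrib)
    also have "\<dots> = (\<Sum>\<xi>\<in>F. of_real ((wt s \<xi> * cmod (e \<xi>))\<^sup>2))"
      by (intro sum.cong refl)
         (simp add: q_def power_mult_distrib mult.assoc complex_norm_square[symmetric] mult.commute[of "cnj _"] del: of_real_power)
    also have "\<dots> = of_real (N\<^sup>2)"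
      by (simp add: N_def L2_set_def sum_nonneg)
    finally show ?thesis .
  qed
  ultimately have "N * N \<le> (B * T) * N"
    using T by (simp add: power2_eq_square mult_ac norm_mult N0)
  then have "N \<le> B * T"
    using N0 B0 T mult_right_le_imp_le[of N N "B * T"] by (cases "N > 0") auto
  then show "L2_set (\<lambda>\<xi>. wt s \<xi> * cmod (D \<xi> T - D \<xi> 0)) F \<le> B * T"
    by (simp add: N_def e_def)
qed

lemma has_sum_diff:
  fixes f g :: "'a \<Rightarrow> 'b::real_normed_vector"
  assumes "(f has_sum x) A" "(g has_sum y) A"
  shows "((\<lambda>k. f k - g k) has_sum (x - y)) A"
  using has_sum_add[OF assms(1), of "\<lambda>k. - g k" "- y"] assms(2) by (simp add: has_sum_uminus)

text \<open>Puncturing the set keeps the quotient away from u = t, where division by 0 would give 0.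
  In this form a derivative is a limit along one fixed set, as the exchange with a uniform limit
  requires.\<close>

lemma has_vector_derivative_iff_quotient:
  fixes f :: "real \<Rightarrow> 'a::real_normed_vector"
  shows "(f has_vector_derivative D) (at t within S) \<longleftrightarrow>
    ((\<lambda>u. (f u - f t) /\<^sub>R (u - t)) \<longlongrightarrow> D) (at t within S - {t})"
proof -
  have eq: "norm ((f u - f t - (u - t) *\<^sub>R D) /\<^sub>R norm (u - t)) = norm ((f u - f t) /\<^sub>R (u - t) - D)"
    if "u \<noteq> t" for u
  proof -
    have "(f u - f t) /\<^sub>R (u - t) - D = (f u - f t - (u - t) *\<^sub>R D) /\<^sub>R (u - t)"
      using that by (simp add: scaleR_right_diff_distrib)
    then show ?thesis by simp
  qed
  have "(f has_vector_derivative D) (at t within S) \<longleftrightarrow>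
      ((\<lambda>u. norm ((f u - f t - (u - t) *\<^sub>R D) /\<^sub>R norm (u - t))) \<longlongrightarrow> 0) (at t within S)"
    unfolding has_vector_derivative_def has_derivative_at_within tendsto_norm_zero_iff
    by (simp add: bounded_linear_scaleR_left)
  also have "\<dots> \<longleftrightarrow> ((\<lambda>u. norm ((f u - f t) /\<^sub>R (u - t) - D)) \<longlongrightarrow> 0) (at t within S)"
    by (rule filterlim_cong[OF refl refl], unfold eventually_at_filter, rule always_eventually) (use eq in blast)
  also have "\<dots> \<longleftrightarrow> ((\<lambda>u. (f u - f t) /\<^sub>R (u - t)) \<longlongrightarrow> D) (at t within S)"
    by (simp only: tendsto_norm_zero_iff LIM_zero_iff)
  finally show ?thesis
    by (simp add: at_within_def Diff_idemp)
qed

text \<open>By the mean value inequality the difference quotients of the terms are at most B * |c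
  k|, uniformly in u, so the Weierstrass M-test permits u to tend to t under the sum. The bound B'
  makes the series itself converge.\<close>

lemma has_vector_derivative_infsum:
  fixes h h' :: "'k \<Rightarrow> real \<Rightarrow> complex"
  assumes c: "(\<lambda>k. cmod (c k)) summable_on UNIV"
    and deriv: "\<And>k t. t \<in> {0..T} \<Longrightarrow> (h k has_vector_derivative h' k t) (at t within {0..T})"
    and bound: "\<And>k t. t \<in> {0..T} \<Longrightarrow> cmod (h' k t) \<le> B" "\<And>k t. t \<in> {0..T} \<Longrightarrow> cmod (h k t) \<le> B'"
    and t: "t \<in> {0..T}"
  shows "((\<lambda>t. \<Sum>\<^sub>\<infinity>k. h k t * c k) has_vector_derivative (\<Sum>\<^sub>\<infinity>k. h' k t * c k)) (at t within {0..T})"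
proof -
  define S where "S = {0..T} - {t}"
  define q where "q k u = (h k u - h k t) /\<^sub>R (u - t) * c k" for k u
  have bq: "cmod (q k u) \<le> B * cmod (c k)" if u: "u \<in> S" for k u
  proof -
    have "cmod (h k u - h k t) \<le> B * \<bar>u - t\<bar>"
      by (rule norm_diff_le_vector_derivative[OF _ deriv bound(1)]) (use t u in \<open>auto simp: S_def\<close>)
    moreover have "u \<noteq> t" using u by (simp add: S_def)
    ultimately have "cmod (h k u - h k t) / \<bar>u - t\<bar> \<le> B"
      by (simp add: divide_le_eq)
    then have "cmod ((h k u - h k t) /\<^sub>R (u - t)) \<le> B"
      by (simp add: divide_inverse mult.commute)
    then show ?thesis
      unfolding q_def norm_mult by (rule mult_right_mono) simp
  qed
  have sumB: "(\<lambda>k. B * cmod (c k)) summable_on UNIV" "(\<lambda>k. B' * cmod (c k)) summable_on UNIV"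
    by (intro summable_on_cmult_right c)+
  have "uniform_limit S (\<lambda>X u. \<Sum>k\<in>X. q k u) (\<lambda>u. \<Sum>\<^sub>\<infinity>k. q k u) (finite_subsets_at_top UNIV)"
    by (rule Weierstrass_m_test_general[OF bq sumB(1)]) auto
  moreover have "\<forall>\<^sub>F X in finite_subsets_at_top UNIV. ((\<lambda>u. \<Sum>k\<in>X. q k u) \<longlongrightarrow> (\<Sum>k\<in>X. h' k t * c k)) (at t within S)"
  proof (intro always_eventually allI tendsto_sum)
    fix k
    have "((\<lambda>u. (h k u - h k t) /\<^sub>R (u - t)) \<longlongrightarrow> h' k t) (at t within S)"
      using deriv[OF t, of k]
      by (simp add: has_vector_derivative_iff_quotient S_def)
    then show "(q k \<longlongrightarrow> h' k t * c k) (at t within S)"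
      unfolding q_def by (intro tendsto_mult tendsto_const)
  qed
  moreover have sum_h': "(\<lambda>k. h' k t * c k) summable_on UNIV"
    by (rule abs_summable_summable, rule summable_on_comparison_test[OF sumB(1)])
       (use mult_right_mono[OF bound(1)[OF t] norm_ge_zero] in \<open>simp_all add: norm_mult\<close>)
  then have "((\<lambda>X. \<Sum>k\<in>X. h' k t * c k) \<longlongrightarrow> (\<Sum>\<^sub>\<infinity>k. h' k t * c k)) (finite_subsets_at_top UNIV)"
    by (rule infsum_tendsto)
  ultimately have lim: "((\<lambda>u. \<Sum>\<^sub>\<infinity>k. q k u) \<longlongrightarrow> (\<Sum>\<^sub>\<infinity>k. h' k t * c k)) (at t within S)"
    by (intro swap_uniform_limit) auto
  have sum_h: "(\<lambda>k. h k u * c k) summable_on UNIV" if "u \<in> {0..T}" for u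
    by (rule abs_summable_summable, rule summable_on_comparison_test[OF sumB(2)])
       (use mult_right_mono[OF bound(2)[OF that] norm_ge_zero] in \<open>simp_all add: norm_mult\<close>)
  have "(\<Sum>\<^sub>\<infinity>k. q k u) = ((\<Sum>\<^sub>\<infinity>k. h k u * c k) - (\<Sum>\<^sub>\<infinity>k. h k t * c k)) /\<^sub>R (u - t)" if "u \<in> S" for u
  proof -
    have u: "u \<in> {0..T}" using that by (simp add: S_def)
    have "((\<lambda>k. (h k u * c k - h k t * c k) /\<^sub>R (u - t)) has_sum
        ((\<Sum>\<^sub>\<infinity>k. h k u * c k) - (\<Sum>\<^sub>\<infinity>k. h k t * c k)) /\<^sub>R (u - t)) UNIV"
      using sum_h[OF u] sum_h[OF t] by (intro has_sum_scaleR has_sum_diff has_sum_infsum)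
    then show ?thesis
      by (simp add: q_def infsumI left_diff_distrib)
  qed
  then have "((\<lambda>u. ((\<Sum>\<^sub>\<infinity>k. h k u * c k) - (\<Sum>\<^sub>\<infinity>k. h k t * c k)) /\<^sub>R (u - t)) \<longlongrightarrow> (\<Sum>\<^sub>\<infinity>k. h' k t * c k)) (at t within S)"
    by (intro Lim_transform_within[OF lim zero_less_one]) auto
  then show ?thesis
    by (simp add: has_vector_derivative_iff_quotient S_def)
qed

lemma has_vector_derivative_tri:
  assumes s: "real CARD('d) / 2 < s"
    and a: "hs_le s a \<alpha>" and b: "hs_le s b \<beta>" and c: "hs_le s (c :: int ^ 'd::finite \<Rightarrow> complex) \<kappa>"
    and deriv: "\<And>x y z t. t \<in> {0..T} \<Longrightarrow> ((\<lambda>t. h t x y z) has_vector_derivative h' t x y z) (at t within {0..T})"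
    and bound: "\<And>x y z t. t \<in> {0..T} \<Longrightarrow> cmod (h' t x y z) \<le> B" "\<And>x y z t. t \<in> {0..T} \<Longrightarrow> cmod (h t x y z) \<le> B'"
    and t: "t \<in> {0..T}"
  shows "((\<lambda>t. tri (h t) a b c \<xi>) has_vector_derivative tri (h' t) a b c \<xi>) (at t within {0..T})"
  unfolding tri_def
  by (rule has_vector_derivative_infsum[OF tri_abs_summable[OF s a b c] deriv bound t])

section \<open>Fourier coefficients on the torus\<close>

lemma torus_cube_eq: "torus_cube = cbox 0 (\<chi> i. 2 * pi)"
  by (auto simp: torus_cube_def mem_box_cart)

lemma sets_torus_cube[measurable]: "torus_cube \<in> sets lborel"
  by (simp add: torus_cube_eq)

lemma measure_torus_cube: "measure lborel (torus_cube :: (real ^ 'd::finite) set) = (2 * pi) ^ CARD('d)"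
  unfolding torus_cube_eq by (subst content_cbox_cart) (auto simp: less_eq_vec_def interval_ne_empty_cart)

lemma emeasure_torus_cube_finite: "emeasure lborel (torus_cube :: (real ^ 'd::finite) set) < \<infinity>"
  unfolding torus_cube_eq by (rule emeasure_bounded_finite[OF bounded_cbox])

lemma freq_dot_eq_inner: "freq_dot \<xi> x = (\<chi> i. real_of_int (\<xi> $ i)) \<bullet> x"
  by (simp add: freq_dot_def inner_vec_def)

lemma continuous_freq_dot[continuous_intros]: "continuous_on A (freq_dot \<xi>)"
  unfolding freq_dot_eq_inner[abs_def] by (intro continuous_intros)

lemma measurable_freq_dot[measurable]: "freq_dot \<xi> \<in> borel_measurable borel"
  by (intro borel_measurable_continuous_onI continuous_freq_dot)

lemma freq_dot_add: "freq_dot (\<xi> + \<eta>) x = freq_dot \<xi> x + freq_dot \<eta> x"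
  by (simp add: freq_dot_def sum.distrib algebra_simps)

lemma freq_dot_minus: "freq_dot (- \<xi>) x = - freq_dot \<xi> x"
  by (simp add: freq_dot_def sum_negf)

lemma freq_dot_diff: "freq_dot (\<xi> - \<eta>) x = freq_dot \<xi> x - freq_dot \<eta> x"
  by (simp add: freq_dot_def sum_subtractf algebra_simps)

lemma freq_dot_0: "freq_dot 0 x = 0"
  by (simp add: freq_dot_def)

lemma measurable_cis[measurable]: "cis \<in> borel_measurable borel"
  by (intro borel_measurable_continuous_onI continuous_intros)

lemma integral_cis_period:
  fixes k :: int
  assumes "k \<noteq> 0"
  shows "(LINT t|lborel. indicator {0..2 * pi} t *\<^sub>R cis (real_of_int k * t)) = 0"
proof -
  define F where "F t = cis (real_of_int k * t) / (\<i> * of_int k)" for t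
  have "(LINT t|lborel. indicator {0..2 * pi} t *\<^sub>R cis (real_of_int k * t)) = F (2 * pi) - F 0"
  proof (rule integral_FTC_Icc)
    fix t :: real
    show "(F has_vector_derivative cis (real_of_int k * t)) (at t within {0..2 * pi})"
    proof -
      have "((\<lambda>z. exp (\<i> * (of_int k * z)) / (\<i> * of_int k)) has_field_derivative exp (\<i> * (of_int k * of_real t)))
          (at (of_real t))"
        by (rule derivative_eq_intros refl | use assms in \<open>simp add: field_simps\<close>)+
      from has_vector_derivative_real_field[OF this] show ?thesis
        by (simp add: F_def[abs_def] cis_conv_exp)
    qed
  qed (auto intro!: continuous_intros)
  also have "F (2 * pi) = F 0"
    using cis_multiple_2pi[of "of_int k"] by (simp add: F_def mult_ac)
  finally show ?thesis by simp
qed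

text \<open>Lebesgue measure is the image of a product of line measures under the map from
  coordinates to vectors. The integral therefore factors over the basis, and a coordinate with
  nonzero frequency runs through full periods and contributes the factor 0.\<close>

lemma integral_cis_torus:
  fixes n :: "int ^ 'd::finite"
  assumes "n \<noteq> 0"
  shows "(LINT x:torus_cube|lborel. cis (freq_dot n x)) = 0"
proof -
  define v :: "real ^ 'd" where "v = (\<chi> i. real_of_int (n $ i))"
  define g :: "real ^ 'd \<Rightarrow> complex" where "g x = indicator torus_cube x *\<^sub>R cis (freq_dot n x)" for x
  define f where "f b t = indicator {0..2 * pi} t *\<^sub>R cis ((v \<bullet> b) * t)" for b :: "real ^ 'd" and t
  have [measurable]: "g \<in> borel_measurable borel"
    unfolding g_def using sets_torus_cube by measurable
  interpret product_sigma_finite "\<lambda>b::real^'d. lborel :: real measure"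
    by standard
  have g: "g (\<Sum>b\<in>Basis. y b *\<^sub>R b) = (\<Prod>b\<in>Basis. f b (y b))" for y
  proof -
    have mem: "(\<Sum>b\<in>Basis. y b *\<^sub>R b) \<in> torus_cube \<longleftrightarrow> (\<forall>b\<in>Basis. y b \<in> {0..2 * pi})"
    proof -
      have "(\<chi> i. 2 * pi) \<bullet> b = 2 * pi" if "b \<in> Basis" for b :: "real ^ 'd"
        using that by (auto simp: Basis_vec_def inner_axis)
      then show ?thesis by (simp add: torus_cube_eq mem_box)
    qed
    have "freq_dot n (\<Sum>b\<in>Basis. y b *\<^sub>R b) = (\<Sum>b\<in>Basis. (v \<bullet> b) * y b)"
      by (simp add: freq_dot_eq_inner v_def inner_sum_right mult.commute)
    then have c: "cis (freq_dot n (\<Sum>b\<in>Basis. y b *\<^sub>R b)) = (\<Prod>b\<in>Basis. cis ((v \<bullet> b) * y b))"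
      by (simp add: cis_conv_exp exp_sum sum_distrib_left)
    show ?thesis
    proof (cases "\<forall>b\<in>Basis. y b \<in> {0..2 * pi}")
      case True
      then have "f b (y b) = cis ((v \<bullet> b) * y b)" if "b \<in> Basis" for b
        using that by (simp add: f_def)
      then show ?thesis
        using True mem c by (simp add: g_def)
    next
      case False
      then obtain b where b: "b \<in> Basis" "y b \<notin> {0..2 * pi}" by blast
      then have "f b (y b) = 0" by (simp add: f_def)
      then have "(\<Prod>b\<in>Basis. f b (y b)) = 0"
        using b(1) by (intro prod_zero) auto
      then show ?thesis using False mem by (simp add: g_def)
    qed
  qed
  have fint: "integrable lborel (f b)" for b
    unfolding f_def
    by (rule borel_integrable_compact) (auto intro!: continuous_intros)
  have "(LINT x:torus_cube|lborel. cis (freq_dot n x)) = (LINT x|lborel. g x)"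
    by (simp add: set_lebesgue_integral_def g_def)
  also have "\<dots> = (LINT y|(\<Pi>\<^sub>M b\<in>(Basis::(real ^ 'd) set). lborel). g (\<Sum>b\<in>Basis. y b *\<^sub>R b))"
    by (subst lborel_eq, subst integral_distr) simp_all
  also have "\<dots> = (\<Prod>b\<in>Basis. LINT t|lborel. f b t)"
    unfolding g by (rule product_integral_prod) (auto intro: fint)
  also have "\<dots> = 0"
  proof -
    obtain i where i: "n $ i \<noteq> 0"
      using assms by (auto simp: vec_eq_iff)
    have "(LINT t|lborel. f (axis i 1) t) = 0"
      using integral_cis_period[OF i] by (simp add: f_def v_def inner_axis)
    moreover have "axis i 1 \<in> (Basis :: (real ^ 'd) set)" by (simp add: axis_in_Basis_iff)
    ultimately show ?thesis by (intro prod_zero) auto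
  qed
  finally show ?thesis .
qed

lemma set_integrable_bounded_torus:
  fixes f :: "real ^ 'd::finite \<Rightarrow> complex"
  assumes "set_borel_measurable lborel torus_cube f" "\<And>x. x \<in> torus_cube \<Longrightarrow> cmod (f x) \<le> B"
  shows "set_integrable lborel torus_cube f"
  unfolding set_integrable_def
proof (rule Bochner_Integration.integrable_bound)
  show "integrable lborel (\<lambda>x. indicator (torus_cube :: (real ^ 'd) set) x *\<^sub>R B)"
    using emeasure_torus_cube_finite sets_torus_cube by (intro integrable_indicator) auto
  show "AE x in lborel. cmod (indicat_real torus_cube x *\<^sub>R f x) \<le> norm (indicat_real torus_cube x *\<^sub>R B)"
    using assms(2) by (auto intro!: AE_I2 simp: indicator_def) (meson abs_ge_self order_trans)
qed (use assms(1) in \<open>simp add: set_borel_measurable_def\<close>)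

lemma set_integrable_mult_cis:
  assumes "set_integrable lborel torus_cube (f :: real ^ 'd::finite \<Rightarrow> complex)"
  shows "set_integrable lborel torus_cube (\<lambda>x. f x * cis (freq_dot \<xi> x))"
  unfolding set_integrable_def
proof (rule Bochner_Integration.integrable_bound)
  show "integrable lborel (\<lambda>x. indicator torus_cube x *\<^sub>R f x)"
    using assms by (simp add: set_integrable_def)
  then have "(\<lambda>x. (indicator torus_cube x *\<^sub>R f x) * cis (freq_dot \<xi> x)) \<in> borel_measurable lborel"
    by measurable
  then show "(\<lambda>x. indicator torus_cube x *\<^sub>R (f x * cis (freq_dot \<xi> x))) \<in> borel_measurable lborel"
    by simp
qed (auto simp: norm_mult)

lemma fcoeff_integrable:
  assumes "set_integrable lborel torus_cube (f :: real ^ 'd::finite \<Rightarrow> complex)"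
  shows "set_integrable lborel torus_cube (\<lambda>x. f x * cis (- freq_dot \<xi> x))"
  using set_integrable_mult_cis[OF assms, of "- \<xi>"] by (simp add: freq_dot_minus)

lemma fcoeff_add:
  assumes "set_integrable lborel torus_cube f" "set_integrable lborel torus_cube g"
  shows "fcoeff (\<lambda>x. f x + g x) \<xi> = fcoeff f \<xi> + fcoeff g \<xi>"
  unfolding fcoeff_def
  using set_integral_add(2)[OF fcoeff_integrable[OF assms(1), of \<xi>] fcoeff_integrable[OF assms(2), of \<xi>]]
  by (simp add: distrib_right add_divide_distrib)

lemma fcoeff_diff:
  assumes "set_integrable lborel torus_cube f" "set_integrable lborel torus_cube g"
  shows "fcoeff (\<lambda>x. f x - g x) \<xi> = fcoeff f \<xi> - fcoeff g \<xi>"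
  unfolding fcoeff_def
  using set_integral_diff(2)[OF fcoeff_integrable[OF assms(1), of \<xi>] fcoeff_integrable[OF assms(2), of \<xi>]]
  by (simp add: left_diff_distrib diff_divide_distrib)

lemma fcoeff_cong_AE:
  assumes "AE x in lborel. x \<in> torus_cube \<longrightarrow> f x = g x"
    and "set_borel_measurable lborel torus_cube f" "set_borel_measurable lborel torus_cube g"
  shows "fcoeff f \<xi> = fcoeff g \<xi>"
proof -
  have m: "(\<lambda>x. indicator torus_cube x *\<^sub>R (h x * cis (- freq_dot \<xi> x))) \<in> borel_measurable lborel"
    if "set_borel_measurable lborel torus_cube h" for h :: "real ^ 'a \<Rightarrow> complex"
  proof -
    have "(\<lambda>x. (indicator torus_cube x *\<^sub>R h x) * cis (- freq_dot \<xi> x)) \<in> borel_measurable lborel"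
      using that unfolding set_borel_measurable_def by measurable
    then show ?thesis by simp
  qed
  show ?thesis
    unfolding fcoeff_def set_lebesgue_integral_def
    by (intro arg_cong2[where f = "(/)"] refl integral_cong_AE m assms(2,3))
       (use assms(1) in \<open>auto simp: indicator_def\<close>)
qed

lemma cmod_fcoeff_le:
  assumes m: "set_borel_measurable lborel torus_cube (f :: real ^ 'd::finite \<Rightarrow> complex)"
    and B: "\<And>x. x \<in> torus_cube \<Longrightarrow> cmod (f x) \<le> B"
  shows "cmod (fcoeff f \<xi>) \<le> B"
proof -
  have "set_integrable lborel torus_cube (\<lambda>x. f x * cis (- freq_dot \<xi> x))"
    by (intro fcoeff_integrable set_integrable_bounded_torus[OF m B])
  then have "cmod (LINT x:torus_cube|lborel. f x * cis (- freq_dot \<xi> x))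
      \<le> (LINT x:torus_cube|lborel. cmod (f x * cis (- freq_dot \<xi> x)))"
    by (rule set_integral_norm_bound)
  also have "\<dots> \<le> (LINT x:(torus_cube :: (real ^ 'd) set)|lborel. B)"
  proof (rule set_integral_mono)
    show "set_integrable lborel torus_cube (\<lambda>x. cmod (f x * cis (- freq_dot \<xi> x)))"
      using \<open>set_integrable lborel torus_cube (\<lambda>x. f x * cis (- freq_dot \<xi> x))\<close> by (rule set_integrable_norm)
    show "set_integrable lborel (torus_cube :: (real ^ 'd) set) (\<lambda>x. B)"
      unfolding set_integrable_def using emeasure_torus_cube_finite sets_torus_cube
      by (intro integrable_indicator) auto
  qed (use B in \<open>auto simp: norm_mult\<close>)
  also have "\<dots> = (2 * pi) ^ CARD('d) * B"
    using sets_torus_cube emeasure_torus_cube_finite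
    by (simp add: set_lebesgue_integral_def measure_torus_cube)
  finally show ?thesis
    by (simp add: fcoeff_def norm_divide norm_mult norm_power divide_le_eq mult.commute)
qed

lemma fcoeff_cis: "fcoeff (\<lambda>x. c * cis (freq_dot \<eta> x)) \<xi> = (if \<xi> = \<eta> then c else 0)"
proof -
  have "c * cis (freq_dot \<eta> x) * cis (- freq_dot \<xi> x) = c * cis (freq_dot (\<eta> - \<xi>) x)" for x
    by (simp add: freq_dot_diff mult.assoc cis_mult)
  then have "fcoeff (\<lambda>x. c * cis (freq_dot \<eta> x)) \<xi>
      = c * (LINT x:torus_cube|lborel. cis (freq_dot (\<eta> - \<xi>) x)) / of_real ((2 * pi) ^ CARD('a))"
    by (simp only: fcoeff_def set_integral_mult_right)
  also have "\<dots> = (if \<xi> = \<eta> then c else 0)"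
  proof (cases "\<xi> = \<eta>")
    case True
    have "(LINT x:(torus_cube :: (real ^ 'a) set)|lborel. (1::complex)) = of_real ((2 * pi) ^ CARD('a))"
      using sets_torus_cube emeasure_torus_cube_finite
      by (simp add: set_lebesgue_integral_def measure_torus_cube scaleR_conv_of_real)
    then show ?thesis
      using True by (simp add: freq_dot_0)
  next
    case False
    then show ?thesis by (simp add: integral_cis_torus)
  qed
  finally show ?thesis .
qed

section \<open>Completeness of the trigonometric system\<close>

text \<open>The sets over which f integrates to 0 form a Dynkin system, and the boxes are an
  intersection-stable generator of the Borel sets. \<open>total\<close> serves complements, because
  the whole space is not a box.\<close>

lemma AE_zero_if_integral_boxes_zero:
  fixes f :: "'a::euclidean_space \<Rightarrow> complex"
  assumes f: "integrable lborel f"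
    and box: "\<And>a b. (LINT x:box a b|lborel. f x) = 0" and total: "(LINT x|lborel. f x) = 0"
  shows "AE x in lborel. f x = 0"
proof (rule sigma_finite_measure.density_zero[OF sigma_finite_lborel f])
  fix A :: "'a set" assume "A \<in> sets lborel"
  have fA: "set_integrable lborel A f" if "A \<in> sets borel" for A
    using that by (intro set_integrable_subset[of lborel UNIV f A]) (auto simp: set_integrable_def f)
  have "Int_stable (range (\<lambda>(a, b). box a b :: 'a set))"
    by (auto simp: Int_stable_def box_Int_box)
  moreover have "range (\<lambda>(a, b). box a b :: 'a set) \<subseteq> Pow UNIV"
    by auto
  moreover have "A \<in> sigma_sets UNIV (range (\<lambda>(a, b). box a b))"
    using \<open>A \<in> sets lborel\<close> unfolding sets_lborel borel_eq_box by simp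
  ultimately show "(LINT x:A|lborel. f x) = 0"
  proof (induction rule: sigma_sets_induct_disjoint)
    case (basic A)
    then show ?case using box by auto
  next
    case empty
    show ?case by (simp add: set_lebesgue_integral_def)
  next
    case (compl A)
    then have A: "A \<in> sets borel" by (simp add: borel_eq_box)
    have "(LINT x:UNIV - A|lborel. f x) + (LINT x:A|lborel. f x) = (LINT x:(UNIV - A) \<union> A|lborel. f x)"
      using A by (intro set_integral_Un[symmetric] fA) auto
    also have "\<dots> = 0"
      using total by (simp add: set_lebesgue_integral_def)
    finally show ?case using compl by simp
  next
    case (union F)
    then have F: "F i \<in> sets borel" for i by (auto simp: borel_eq_box)
    have "(LINT x:(\<Union>i. F i)|lborel. f x) = (\<Sum>i. LINT x:F i|lborel. f x)"
      using union.hyps(1) F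
      by (intro lebesgue_integral_countable_add fA) (auto simp: disjoint_family_on_def)
    then show ?case using union by simp
  qed
qed

section \<open>Trigonometric polynomials as polynomials on the embedded torus\<close>

inductive trig_poly :: "(real ^ 'd \<Rightarrow> complex) \<Rightarrow> bool" where
  trig_mono: "trig_poly (\<lambda>x. c * cis (freq_dot \<xi> x))"
| trig_add: "trig_poly F \<Longrightarrow> trig_poly G \<Longrightarrow> trig_poly (\<lambda>x. F x + G x)"

lemma trig_poly_const: "trig_poly (\<lambda>x. c)"
  using trig_mono[of c 0] by (simp add: freq_dot_0)

lemma trig_poly_mono_mult: "trig_poly G \<Longrightarrow> trig_poly (\<lambda>x. c * cis (freq_dot \<xi> x) * G x)"
proof (induction rule: trig_poly.induct)
  case (trig_mono c' \<eta>)
  have "trig_poly (\<lambda>x. (c * c') * cis (freq_dot (\<xi> + \<eta>) x))" by (rule trig_poly.trig_mono)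
  then show ?case by (simp add: freq_dot_add cis_mult[symmetric] mult_ac)
next
  case (trig_add F G)
  then show ?case by (simp add: distrib_left trig_poly.trig_add)
qed

lemma trig_poly_mult: "trig_poly F \<Longrightarrow> trig_poly G \<Longrightarrow> trig_poly (\<lambda>x. F x * G x)"
proof (induction rule: trig_poly.induct)
  case (trig_mono c \<xi>)
  then show ?case by (rule trig_poly_mono_mult)
next
  case (trig_add F F')
  then show ?case by (simp add: distrib_right trig_poly.trig_add)
qed

lemma trig_poly_sum: "finite I \<Longrightarrow> (\<And>i. i \<in> I \<Longrightarrow> trig_poly (F i)) \<Longrightarrow> trig_poly (\<lambda>x. \<Sum>i\<in>I. F i x)"
  by (induction I rule: finite_induct) (auto intro: trig_poly_const trig_add)

lemma freq_dot_axis: "freq_dot (axis i 1) x = x $ i"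
  by (simp add: freq_dot_def axis_def if_distrib[of "\<lambda>t. real_of_int t * _"] cong: if_cong)

lemma trig_poly_cos: "trig_poly (\<lambda>x. of_real (cos (x $ i)))"
proof -
  have "trig_poly (\<lambda>x. 1/2 * cis (freq_dot (axis i 1) x) + 1/2 * cis (freq_dot (- axis i 1) x))"
    by (intro trig_add trig_mono)
  moreover have "1/2 * cis t + 1/2 * cis (- t) = of_real (cos t)" for t
    by (simp add: complex_eq_iff)
  ultimately show ?thesis by (simp add: freq_dot_minus freq_dot_axis)
qed

lemma trig_poly_sin: "trig_poly (\<lambda>x. of_real (sin (x $ i)))"
proof -
  have "trig_poly (\<lambda>x. (-\<i>/2) * cis (freq_dot (axis i 1) x) + (\<i>/2) * cis (freq_dot (- axis i 1) x))"
    by (intro trig_add trig_mono)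
  moreover have "(-\<i>/2) * cis t + (\<i>/2) * cis (- t) = of_real (sin t)" for t
    by (simp add: complex_eq_iff)
  ultimately show ?thesis by (simp add: freq_dot_minus freq_dot_axis)
qed

text \<open>Places the torus in a Euclidean space of dimension 2 d and thereby glues opposite faces
  of the cube. There Stone-Weierstrass provides polynomials in cosines and sines, which pull back to
  trigonometric polynomials.\<close>

definition torus_embed :: "real ^ 'd \<Rightarrow> (real ^ 'd) \<times> (real ^ 'd)" where
  "torus_embed x = (\<chi> i. cos (x $ i), \<chi> i. sin (x $ i))"

lemma continuous_torus_embed: "continuous_on A torus_embed"
  unfolding torus_embed_def by (intro continuous_intros)

lemma trig_poly_polynomial:
  assumes "real_polynomial_function (p :: (real ^ 'd::finite) \<times> (real ^ 'd) \<Rightarrow> real)"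
  shows "trig_poly (\<lambda>x. of_real (p (torus_embed x)))"
  using assms
proof (induction rule: real_polynomial_function.induct)
  case (linear L)
  then interpret L: bounded_linear L .
  have expand: "L (u, v) = (\<Sum>i\<in>UNIV. u $ i * L (axis i 1, 0) + v $ i * L (0, axis i 1))" for u v
  proof -
    have "(u, v) = (\<Sum>i\<in>UNIV. (u $ i) *\<^sub>R (axis i 1, 0) + (v $ i) *\<^sub>R (0, axis i 1))"
      using basis_expansion[of u] basis_expansion[of v]
      by (simp add: prod_eq_iff fst_sum snd_sum scalar_mult_eq_scaleR)
    then have "L (u, v) = L (\<Sum>i\<in>UNIV. (u $ i) *\<^sub>R (axis i 1, 0) + (v $ i) *\<^sub>R (0, axis i 1))"
      by (rule arg_cong)
    also have "\<dots> = (\<Sum>i\<in>UNIV. u $ i * L (axis i 1, 0) + v $ i * L (0, axis i 1))"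
      by (simp only: L.sum L.add L.scaleR real_scaleR_def)
    finally show ?thesis .
  qed
  have "complex_of_real (L (torus_embed x)) = (\<Sum>i\<in>UNIV. of_real (cos (x $ i)) * of_real (L (axis i 1, 0))
      + of_real (sin (x $ i)) * of_real (L (0, axis i 1)))" for x
    unfolding torus_embed_def by (subst expand) simp
  then show ?case
    by (simp add: trig_poly_sum trig_add trig_poly_mult trig_poly_cos trig_poly_sin trig_poly_const)
next
  case (const c)
  then show ?case by (rule trig_poly_const)
next
  case (add f g)
  then show ?case by (simp add: trig_add)
next
  case (mult f g)
  then show ?case by (simp add: trig_poly_mult)
qed

lemma integral_trig_poly_zero:
  assumes f: "set_integrable lborel torus_cube (f :: real ^ 'd::finite \<Rightarrow> complex)"
    and "\<And>\<xi>. fcoeff f \<xi> = 0" and "trig_poly F"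
  shows "set_integrable lborel torus_cube (\<lambda>x. f x * F x) \<and> (LINT x:torus_cube|lborel. f x * F x) = 0"
  using assms(3)
proof (induction rule: trig_poly.induct)
  case (trig_mono c \<xi>)
  have "(LINT x:torus_cube|lborel. f x * cis (freq_dot \<xi> x)) = 0"
    using assms(2)[of "- \<xi>"] by (simp add: fcoeff_def freq_dot_minus)
  moreover have "f x * (c * cis (freq_dot \<xi> x)) = c * (f x * cis (freq_dot \<xi> x))" for x by simp
  ultimately show ?case
    using set_integrable_mult_cis[OF f, of \<xi>] by (simp only: set_integral_mult_right set_integrable_mult_right mult_zero_right)
next
  case (trig_add F G)
  then show ?case by (simp add: distrib_left)
qed

text \<open>On the compact image of the cube G is a uniform limit of polynomials, whose pullbacks
  integrate to 0 against f; the remainder costs at most e times the integral of |f|.\<close>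

lemma integral_continuous_torus_zero:
  fixes G :: "(real ^ 'd::finite) \<times> (real ^ 'd) \<Rightarrow> real"
  assumes f: "set_integrable lborel torus_cube f" and z: "\<And>\<xi>. fcoeff f \<xi> = 0"
    and G: "continuous_on UNIV G"
  shows "(LINT x:torus_cube|lborel. f x * of_real (G (torus_embed x))) = 0"
proof -
  define I where "I = (LINT x:torus_cube|lborel. cmod (f x))"
  have fn: "set_integrable lborel torus_cube (\<lambda>x. cmod (f x))"
    using f by (rule set_integrable_norm)
  have I0: "0 \<le> I"
    unfolding I_def set_lebesgue_integral_def by (intro integral_nonneg_AE) auto
  have cpt: "compact (torus_embed ` (torus_cube :: (real ^ 'd) set))"
    by (intro compact_continuous_image continuous_torus_embed) (simp add: torus_cube_eq)
  have Gc: "continuous_on UNIV (\<lambda>x :: real ^ 'd. G (torus_embed x))"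
    using continuous_on_compose2[OF G continuous_torus_embed] by auto
  have cont_int: "set_integrable lborel torus_cube (\<lambda>x. f x * of_real (H x))"
    if H: "continuous_on UNIV H" for H :: "real ^ 'd \<Rightarrow> real"
  proof -
    have "compact (H ` torus_cube)"
      by (intro compact_continuous_image continuous_on_subset[OF H]) (auto simp: torus_cube_eq)
    then obtain B where B: "\<And>x. x \<in> torus_cube \<Longrightarrow> \<bar>H x\<bar> \<le> B"
      using compact_imp_bounded bounded_iff by (metis image_eqI real_norm_def)
    have Hm[measurable]: "H \<in> borel_measurable borel" by (rule borel_measurable_continuous_onI[OF H])
    show ?thesis unfolding set_integrable_def
    proof (rule Bochner_Integration.integrable_bound)
      show i: "integrable lborel (\<lambda>x. B *\<^sub>R (indicator torus_cube x *\<^sub>R f x))"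
        using f by (intro integrable_scaleR_right) (simp add: set_integrable_def)
      have "(\<lambda>x. indicator torus_cube x *\<^sub>R f x) \<in> borel_measurable lborel"
        using f unfolding set_integrable_def by (rule borel_measurable_integrable)
      then have "(\<lambda>x. (indicator torus_cube x *\<^sub>R f x) * of_real (H x)) \<in> borel_measurable lborel"
        by measurable
      then show "(\<lambda>x. indicator torus_cube x *\<^sub>R (f x * of_real (H x))) \<in> borel_measurable lborel"
        by simp
      have "cmod (f x) * \<bar>H x\<bar> \<le> \<bar>B\<bar> * cmod (f x)" if "x \<in> torus_cube" for x
        using mult_left_mono[OF order_trans[OF B[OF that] abs_ge_self] norm_ge_zero[of "f x"]]
        by (simp add: mult.commute)
      then show "AE x in lborel. cmod (indicator torus_cube x *\<^sub>R (f x * of_real (H x)))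
          \<le> cmod (B *\<^sub>R (indicator torus_cube x *\<^sub>R f x))"
        by (intro AE_I2) (auto simp: indicator_def norm_mult)
    qed
  qed
  have "cmod (LINT x:torus_cube|lborel. f x * of_real (G (torus_embed x))) \<le> I * e" if "e > 0" for e
  proof -
    obtain p where p: "real_polynomial_function p"
      and pe: "\<And>y. y \<in> torus_embed ` (torus_cube :: (real ^ 'd) set) \<Longrightarrow> \<bar>G y - p y\<bar> < e"
      using Stone_Weierstrass_real_polynomial_function[OF cpt continuous_on_subset[OF G] \<open>e > 0\<close>] by blast
    have pc: "continuous_on UNIV (\<lambda>x :: real ^ 'd. p (torus_embed x))"
      using continuous_on_compose2[OF continuous_on_polymonial_function[OF real_polynomial_function_eq[THEN iffD1, OF p]] continuous_torus_embed]
      by auto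
    have zero: "(LINT x:torus_cube|lborel. f x * of_real (p (torus_embed x))) = 0"
      using integral_trig_poly_zero[OF f z trig_poly_polynomial[OF p]] by simp
    have dint: "set_integrable lborel torus_cube (\<lambda>x. f x * of_real (G (torus_embed x) - p (torus_embed x)))"
      by (intro cont_int continuous_intros Gc pc)
    have "(LINT x:torus_cube|lborel. f x * of_real (G (torus_embed x)))
        = (LINT x:torus_cube|lborel. f x * of_real (G (torus_embed x))) - (LINT x:torus_cube|lborel. f x * of_real (p (torus_embed x)))"
      by (simp add: zero)
    also have "\<dots> = (LINT x:torus_cube|lborel. f x * of_real (G (torus_embed x) - p (torus_embed x)))"
      by (subst set_integral_diff(2)[OF cont_int[OF Gc] cont_int[OF pc], symmetric]) (simp add: right_diff_distrib)
    also have "cmod \<dots> \<le> (LINT x:torus_cube|lborel. cmod (f x * of_real (G (torus_embed x) - p (torus_embed x))))"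
      by (rule set_integral_norm_bound[OF dint])
    also have "\<dots> \<le> (LINT x:torus_cube|lborel. cmod (f x) * e)"
    proof (rule set_integral_mono[OF set_integrable_norm[OF dint]])
      show "set_integrable lborel torus_cube (\<lambda>x. cmod (f x) * e)" using fn by simp
      fix x :: "real ^ 'd" assume "x \<in> torus_cube"
      then have "\<bar>G (torus_embed x) - p (torus_embed x)\<bar> \<le> e" using pe by (simp add: less_imp_le)
      then show "cmod (f x * of_real (G (torus_embed x) - p (torus_embed x))) \<le> cmod (f x) * e"
        unfolding norm_mult norm_of_real by (rule mult_left_mono) simp
    qed
    also have "\<dots> = I * e" by (simp add: I_def)
    finally show ?thesis .
  qed
  then have "cmod (LINT x:torus_cube|lborel. f x * of_real (G (torus_embed x))) \<le> 0 + e" if "e > 0" for e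
  proof -
    \<comment> \<open>Dividing by I + 1 rather than I covers I = 0 as well.\<close>
    have "I * (e / (I + 1)) \<le> e" using I0 that by (simp add: field_simps)
    then show ?thesis
      using \<open>\<And>e. e > 0 \<Longrightarrow> _ \<le> I * e\<close>[of "e / (I + 1)"] I0 that by force
  qed
  then have "cmod (LINT x:torus_cube|lborel. f x * of_real (G (torus_embed x))) \<le> 0"
    by (rule field_le_epsilon)
  then show ?thesis by simp
qed

text \<open>An arc of the circle is cut out by the linear inequality \<open>cos (x - c) > cos r\<close>.\<close>

lemma arc_iff_cos:
  fixes a b x :: real
  assumes "0 \<le> a" "a < b" "b \<le> 2 * pi" "0 \<le> x" "x \<le> 2 * pi"
  shows "cos ((b - a) / 2) < cos (x - (a + b) / 2) \<longleftrightarrow> a < x \<and> x < b"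
proof -
  define r where "r = (b - a) / 2"
  define t where "t = \<bar>x - (a + b) / 2\<bar>"
  have r: "0 < r" "r \<le> pi" and t: "0 \<le> t" "t \<le> 2 * pi - r"
    using assms by (auto simp: r_def t_def abs_if field_simps)
  have "cos (x - (a + b) / 2) = cos t"
    by (simp add: t_def)
  moreover have "cos r < cos t \<longleftrightarrow> t < r"
  proof (cases "t \<le> pi")
    case True
    then show ?thesis using r t by (intro cos_mono_less_eq) auto
  next
    case False
    \<comment> \<open>Past pi the cosine grows again. Reflection at pi together with t \<le> 2 pi -
      r gives 2 pi - t \<ge> r, so no point outside the arc is counted.\<close>
    have "cos t = cos (2 * pi - t)" by simp
    also have "\<dots> \<le> cos r" using False r t by (intro cos_monotone_0_pi_le) auto
    finally show ?thesis using False r by auto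
  qed
  moreover have "t < r \<longleftrightarrow> a < x \<and> x < b"
    by (auto simp: t_def r_def abs_if field_simps)
  ultimately show ?thesis by (simp add: r_def)
qed

text \<open>On the cube the indicator of the box is a pointwise limit of products of steep ramps in
  the differences of cosines from \<open>arc_iff_cos\<close>. Each such product is continuous on the
  embedded torus, hence integrates to 0 against f, and dominated convergence with majorant |f|
  concludes.\<close>

lemma integral_box_zero:
  fixes f :: "real ^ 'd::finite \<Rightarrow> complex"
  assumes f: "set_integrable lborel torus_cube f" and z: "\<And>\<xi>. fcoeff f \<xi> = 0"
    and ab: "\<And>i. 0 \<le> a $ i" "\<And>i. a $ i < b $ i" "\<And>i. b $ i \<le> 2 * pi"
  shows "(LINT x:box a b|lborel. indicator torus_cube x *\<^sub>R f x) = 0"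
proof -
  \<comment> \<open>\<open>G\<close> lives on the ambient space, where continuity is required; with
    cosines for p and sines for q the addition formula turns it into \<open>g\<close>.\<close>
  define G :: "nat \<Rightarrow> (real ^ 'd) \<times> (real ^ 'd) \<Rightarrow> real" where
    "G k = (\<lambda>(p, q). \<Prod>i\<in>UNIV. min 1 (real k * max 0 (p $ i * cos ((a $ i + b $ i) / 2) + q $ i * sin ((a $ i + b $ i) / 2)
      - cos ((b $ i - a $ i) / 2))))" for k
  define g where "g k x = (\<Prod>i\<in>UNIV. min 1 (real k * max 0 (cos (x $ i - (a $ i + b $ i) / 2) - cos ((b $ i - a $ i) / 2))))"
    for k and x :: "real ^ 'd"
  have Gg: "G k (torus_embed x) = g k x" for k x
    by (simp add: G_def g_def torus_embed_def cos_diff)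
  have Gc: "continuous_on UNIV (G k)" for k
    unfolding G_def case_prod_unfold by (intro continuous_intros)
  have gc: "continuous_on UNIV (g k)" for k
    unfolding g_def by (intro continuous_intros)
  have [measurable]: "g k \<in> borel_measurable borel" for k
    by (rule borel_measurable_continuous_onI[OF gc])
  have g01: "0 \<le> g k x" "g k x \<le> 1" for k x
    unfolding g_def by (auto intro!: prod_nonneg prod_le_1)
  have lim: "(\<lambda>k. g k x) \<longlonglongrightarrow> indicator (box a b) x" if x: "x \<in> torus_cube" for x
  proof -
    define h where "h i = cos (x $ i - (a $ i + b $ i) / 2) - cos ((b $ i - a $ i) / 2)" for i
    have "(\<lambda>k. min 1 (real k * max 0 (h i))) \<longlonglongrightarrow> indicator {a $ i<..<b $ i} (x $ i)" for i
    proof (cases "h i > 0")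
      case True
      then have "x $ i \<in> {a $ i<..<b $ i}"
        using arc_iff_cos[OF ab, of "x $ i" i] x by (auto simp: h_def torus_cube_def)
      moreover have "\<forall>\<^sub>F k in sequentially. min 1 (real k * max 0 (h i)) = 1"
      proof -
        obtain N where N: "1 / h i < real N" using reals_Archimedean2 by blast
        show ?thesis
        proof (rule eventually_sequentiallyI)
          fix k assume "N \<le> k"
          then have "1 / h i \<le> real k" using N by linarith
          then show "min 1 (real k * max 0 (h i)) = 1"
            using True by (simp add: field_simps min_def)
        qed
      qed
      ultimately show ?thesis by (simp add: tendsto_eventually)
    next
      case False
      then have "x $ i \<notin> {a $ i<..<b $ i}"
        using arc_iff_cos[OF ab, of "x $ i" i] x by (auto simp: h_def torus_cube_def)
      then show ?thesis using False by (simp add: max_def)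
    qed
    then have "(\<lambda>k. g k x) \<longlonglongrightarrow> (\<Prod>i\<in>UNIV. indicator {a $ i<..<b $ i} (x $ i))"
      unfolding g_def h_def[symmetric] by (intro tendsto_prod)
    also have "(\<Prod>i\<in>UNIV. indicator {a $ i<..<b $ i} (x $ i)) = (indicator (box a b) x :: real)"
      by (auto simp: indicator_def mem_box_cart)
    finally show ?thesis .
  qed
  define F where "F x = indicator torus_cube x *\<^sub>R f x" for x
  have F: "integrable lborel F" using f by (simp add: F_def[abs_def] set_integrable_def)
  then have [measurable]: "F \<in> borel_measurable borel" by (auto dest: borel_measurable_integrable)
  have "(\<lambda>k. LINT x|lborel. g k x *\<^sub>R F x) \<longlonglongrightarrow> (LINT x|lborel. indicator (box a b) x *\<^sub>R F x)"
  proof (rule integral_dominated_convergence[where w = "\<lambda>x. cmod (F x)"])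
    show "AE x in lborel. (\<lambda>k. g k x *\<^sub>R F x) \<longlonglongrightarrow> indicator (box a b) x *\<^sub>R F x"
    proof (rule AE_I2)
      fix x
      show "(\<lambda>k. g k x *\<^sub>R F x) \<longlonglongrightarrow> indicator (box a b) x *\<^sub>R F x"
      proof (cases "x \<in> torus_cube")
        case True
        show ?thesis by (rule tendsto_scaleR[OF lim[OF True] tendsto_const])
      qed (simp add: F_def)
    qed
    show "AE x in lborel. cmod (g k x *\<^sub>R F x) \<le> cmod (F x)" for k
      by (intro AE_I2) (simp add: g01 mult_left_le_one_le)
  qed (use F in auto)
  moreover have "(LINT x|lborel. g k x *\<^sub>R F x) = 0" for k
  proof -
    have "g k x *\<^sub>R F x = indicator torus_cube x *\<^sub>R (f x * of_real (G k (torus_embed x)))" for x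
      by (simp add: F_def Gg scaleR_conv_of_real)
    then show ?thesis
      using integral_continuous_torus_zero[OF f z Gc[of k]]
      by (simp only: set_lebesgue_integral_def)
  qed
  ultimately have "(LINT x|lborel. indicator (box a b) x *\<^sub>R F x) = 0"
    by (simp only: LIMSEQ_const_iff)
  then show ?thesis
    by (simp only: set_lebesgue_integral_def F_def)
qed

text \<open>This is what identifies an integrable function with its Fourier series. All boxes of the
  space have to be tested, but the arcs only reach boxes inside the cube, hence the clipped corners
  \<open>a'\<close> and \<open>b'\<close>.\<close>

theorem fcoeff_zero_imp_AE_zero:
  fixes f :: "real ^ 'd::finite \<Rightarrow> complex"
  assumes f: "set_integrable lborel torus_cube f" and z: "\<And>\<xi>. fcoeff f \<xi> = 0"
  shows "AE x in lborel. x \<in> torus_cube \<longrightarrow> f x = 0"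
proof -
  have "AE x in lborel. indicator torus_cube x *\<^sub>R f x = 0"
  proof (rule AE_zero_if_integral_boxes_zero)
    show "integrable lborel (\<lambda>x. indicator torus_cube x *\<^sub>R f x)"
      using f by (simp add: set_integrable_def)
    then have m: "(\<lambda>x. indicator torus_cube x *\<^sub>R f x) \<in> borel_measurable lborel"
      by (rule borel_measurable_integrable)
    show "(LINT x|lborel. indicator torus_cube x *\<^sub>R f x) = 0"
      using z[of 0] by (simp add: fcoeff_def set_lebesgue_integral_def freq_dot_0)
    fix a b :: "real ^ 'd"
    define a' where "a' = (\<chi> i. max 0 (a $ i))"
    define b' where "b' = (\<chi> i. min (2 * pi) (b $ i))"
    \<comment> \<open>Clipping to an open box can lose points on the faces of the cube; the faces
      have measure 0 because the open and the closed cube have the same measure.\<close>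
    have "AE x in lborel. x \<notin> (torus_cube - box 0 (\<chi> i. 2 * pi) :: (real ^ 'd) set)"
    proof (rule AE_not_in)
      have fin: "emeasure lborel (box 0 (\<chi> i. 2 * pi) :: (real ^ 'd) set) \<noteq> top"
        using emeasure_bounded_finite[OF bounded_box, of 0 "\<chi> i. 2 * pi"] by (simp only: less_top infinity_ennreal_def)
      have meas: "(torus_cube :: (real ^ 'd) set) \<in> sets borel"
        using sets_torus_cube by simp
      have "emeasure lborel (torus_cube - box 0 (\<chi> i. 2 * pi) :: (real ^ 'd) set)
          = emeasure lborel (torus_cube :: (real ^ 'd) set) - emeasure lborel (box 0 (\<chi> i. 2 * pi) :: (real ^ 'd) set)"
        unfolding torus_cube_eq
        by (rule emeasure_Diff) (use fin in \<open>simp_all add: box_subset_cbox\<close>)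
      also have "emeasure lborel (torus_cube :: (real ^ 'd) set) = emeasure lborel (box 0 (\<chi> i. 2 * pi) :: (real ^ 'd) set)"
        unfolding torus_cube_eq emeasure_lborel_cbox_eq emeasure_lborel_box_eq ..
      finally show "(torus_cube - box 0 (\<chi> i. 2 * pi) :: (real ^ 'd) set) \<in> null_sets lborel"
        using fin meas by (simp add: null_sets_def ennreal_diff_self)
    qed
    moreover have "indicator (box a b) x *\<^sub>R (indicator torus_cube x *\<^sub>R f x)
        = indicator (box a' b') x *\<^sub>R (indicator torus_cube x *\<^sub>R f x)"
      if "x \<notin> torus_cube - box 0 (\<chi> i. 2 * pi)" for x
    proof (cases "x \<in> torus_cube")
      case True
      then have "0 < x $ i" "x $ i < 2 * pi" for i
        using that by (simp_all add: mem_box_cart)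
      then have "x \<in> box a b \<longleftrightarrow> x \<in> box a' b'"
        by (simp add: mem_box_cart a'_def b'_def)
      then show ?thesis by (simp add: indicator_def)
    qed simp
    ultimately have "AE x in lborel. indicator (box a b) x *\<^sub>R (indicator torus_cube x *\<^sub>R f x)
        = indicator (box a' b') x *\<^sub>R (indicator torus_cube x *\<^sub>R f x)"
      by (rule eventually_mono)
    then have "(LINT x:box a b|lborel. indicator torus_cube x *\<^sub>R f x)
        = (LINT x:box a' b'|lborel. indicator torus_cube x *\<^sub>R f x)"
      unfolding set_lebesgue_integral_def
      by (intro integral_cong_AE borel_measurable_scaleR m borel_measurable_indicator) simp_all
    also have "\<dots> = 0"
    proof (cases "\<forall>i. a' $ i < b' $ i")
      case True
      then show ?thesis
        by (intro integral_box_zero f z) (auto simp: a'_def b'_def)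
    next
      case False
      then have "box a' b' = {}"
        unfolding interval_eq_empty_cart by (meson not_less)
      then show ?thesis by (simp add: set_lebesgue_integral_def)
    qed
    finally show "(LINT x:box a b|lborel. indicator torus_cube x *\<^sub>R f x) = 0" .
  qed
  then show ?thesis
    by eventually_elim auto
qed

section \<open>Absolutely convergent Fourier series\<close>

definition synth :: "(int ^ 'd \<Rightarrow> complex) \<Rightarrow> real ^ 'd \<Rightarrow> complex" where
  "synth a x = (\<Sum>\<^sub>\<infinity>\<xi>. a \<xi> * cis (freq_dot \<xi> x))"

abbreviation l1 :: "(int ^ 'd \<Rightarrow> complex) \<Rightarrow> bool" where
  "l1 a \<equiv> (\<lambda>\<xi>. cmod (a \<xi>)) summable_on UNIV"

lemma synth_summable:
  assumes "l1 a"
  shows "(\<lambda>\<xi>. a \<xi> * cis (freq_dot \<xi> x)) summable_on UNIV"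
  by (rule abs_summable_summable) (simp add: norm_mult assms)

lemma synth_uniform_limit:
  assumes "l1 (a :: int ^ 'd::finite \<Rightarrow> complex)"
  shows "uniform_limit UNIV (\<lambda>X x. \<Sum>\<xi>\<in>X. a \<xi> * cis (freq_dot \<xi> x)) (synth a) (finite_subsets_at_top UNIV)"
  unfolding synth_def[abs_def]
  by (rule Weierstrass_m_test_general[OF _ assms]) (simp add: norm_mult)

lemma continuous_synth:
  assumes "l1 (a :: int ^ 'd::finite \<Rightarrow> complex)"
  shows "continuous_on UNIV (synth a)"
proof (rule uniform_limit_theorem[OF _ synth_uniform_limit[OF assms]])
  show "\<forall>\<^sub>F X in finite_subsets_at_top UNIV. continuous_on UNIV (\<lambda>x. \<Sum>\<xi>\<in>X. a \<xi> * cis (freq_dot \<xi> x))"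
    by (intro always_eventually allI continuous_intros)
qed simp

lemma measurable_synth: "l1 (a :: int ^ 'd::finite \<Rightarrow> complex) \<Longrightarrow> synth a \<in> borel_measurable borel"
  by (intro borel_measurable_continuous_onI continuous_synth)

lemma set_measurable_torus:
  assumes "f \<in> borel_measurable borel"
  shows "set_borel_measurable lborel torus_cube (f :: real ^ 'd::finite \<Rightarrow> complex)"
  unfolding set_borel_measurable_def using assms by measurable

lemma cmod_synth_le:
  assumes "l1 a"
  shows "cmod (synth a x) \<le> (\<Sum>\<^sub>\<infinity>\<xi>. cmod (a \<xi>))"
  unfolding synth_def
  by (rule order_trans[OF norm_infsum_bound]) (simp_all add: norm_mult assms)

lemma set_integrable_synth:
  assumes "l1 (a :: int ^ 'd::finite \<Rightarrow> complex)"
  shows "set_integrable lborel torus_cube (synth a)"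
  using set_integrable_bounded_torus[OF set_measurable_torus[OF measurable_synth[OF assms]] cmod_synth_le[OF assms]]
  by blast

text \<open>A finite partial sum containing \<xi> has the right coefficient by orthogonality and is
  uniformly close to \<open>synth a\<close>, and \<open>fcoeff\<close> does not exceed the supremum
  norm.\<close>

lemma fcoeff_synth:
  assumes a: "l1 (a :: int ^ 'd::finite \<Rightarrow> complex)"
  shows "fcoeff (synth a) \<xi> = a \<xi>"
proof -
  have "cmod (fcoeff (synth a) \<xi> - a \<xi>) \<le> 0 + e" if e: "e > 0" for e
  proof -
    have "\<forall>\<^sub>F X in finite_subsets_at_top UNIV. finite X \<and> \<xi> \<in> X"
      unfolding eventually_finite_subsets_at_top by (intro exI[of _ "{\<xi>}"]) auto
    moreover have "\<forall>\<^sub>F X in finite_subsets_at_top UNIV. \<forall>x\<in>UNIV. dist (\<Sum>\<xi>\<in>X. a \<xi> * cis (freq_dot \<xi> x)) (synth a x) < e"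
      using uniform_limitD[OF synth_uniform_limit[OF a] e] .
    ultimately have "\<forall>\<^sub>F X in finite_subsets_at_top UNIV. (finite X \<and> \<xi> \<in> X) \<and>
        (\<forall>x\<in>UNIV. dist (\<Sum>\<xi>\<in>X. a \<xi> * cis (freq_dot \<xi> x)) (synth a x) < e)"
      by (rule eventually_conj)
    then have "\<exists>X. (finite X \<and> \<xi> \<in> X) \<and> (\<forall>x\<in>UNIV. dist (\<Sum>\<xi>\<in>X. a \<xi> * cis (freq_dot \<xi> x)) (synth a x) < e)"
      by (rule eventually_happens'[OF finite_subsets_at_top_neq_bot])
    then obtain X where XX: "(finite X \<and> \<xi> \<in> X) \<and> (\<forall>x\<in>UNIV. dist (\<Sum>\<xi>\<in>X. a \<xi> * cis (freq_dot \<xi> x)) (synth a x) < e)" ..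
    then have X: "finite X" "\<xi> \<in> X" by simp_all
    note d = XX[THEN conjunct2, rule_format, OF UNIV_I]
    define P where "P x = (\<Sum>\<xi>\<in>X. a \<xi> * cis (freq_dot \<xi> x))" for x
    have int1: "set_integrable lborel torus_cube (\<lambda>x. c * cis (freq_dot \<eta> x))" for c and \<eta> :: "int ^ 'd"
      by (rule set_integrable_bounded_torus[OF set_measurable_torus, where B = "cmod c"])
         (measurable, simp add: norm_mult)
    have "fcoeff P \<xi> = (\<Sum>\<eta>\<in>X. if \<xi> = \<eta> then a \<eta> else 0)
       \<and> set_integrable lborel torus_cube P" unfolding P_def
      using X(1)
    proof (induction X rule: finite_induct)
      case empty
      then show ?case by (simp add: fcoeff_def set_lebesgue_integral_def set_integrable_def)
    next
      case (insert \<eta> X)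
      then have i: "set_integrable lborel torus_cube (\<lambda>x. \<Sum>\<xi>\<in>X. a \<xi> * cis (freq_dot \<xi> x))" by blast
      from insert fcoeff_add[OF int1[of "a \<eta>" \<eta>] i, of \<xi>] set_integral_add(1)[OF int1[of "a \<eta>" \<eta>] i]
      show ?case by (simp add: fcoeff_cis)
    qed
    then have P: "fcoeff P \<xi> = a \<xi>" "set_integrable lborel torus_cube P"
      using X by (simp_all add: sum.delta')
    have Pm: "P \<in> borel_measurable borel" unfolding P_def by measurable
    have "fcoeff (synth a) \<xi> - a \<xi> = fcoeff (\<lambda>x. synth a x - P x) \<xi>"
      using fcoeff_diff[OF set_integrable_synth[OF a] P(2)] P(1) by simp
    also have "cmod \<dots> \<le> e"
    proof (rule cmod_fcoeff_le)
      show "set_borel_measurable lborel torus_cube (\<lambda>x. synth a x - P x)"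
        by (intro set_measurable_torus borel_measurable_diff measurable_synth a Pm)
      show "cmod (synth a x - P x) \<le> e" for x
        using d[of x] by (simp add: P_def dist_norm norm_minus_commute)
    qed
    finally show ?thesis by simp
  qed
  then have "cmod (fcoeff (synth a) \<xi> - a \<xi>) \<le> 0"
    by (rule field_le_epsilon)
  then show ?thesis by simp
qed

lemma synth_add:
  assumes "l1 a" "l1 b"
  shows "synth (\<lambda>\<xi>. a \<xi> + b \<xi>) x = synth a x + synth b x"
  unfolding synth_def
  by (subst infsum_add[symmetric, OF synth_summable[OF assms(1)] synth_summable[OF assms(2)]])
     (simp add: distrib_right)

lemma synth_cmult: "synth (\<lambda>\<xi>. k * a \<xi>) x = k * synth a x"
  unfolding synth_def by (subst infsum_cmult_right'[symmetric]) (simp add: mult_ac)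

lemma synth_conjs: "synth (conjs a) x = cnj (synth a x)"
proof -
  have "synth (conjs a) x = (\<Sum>\<^sub>\<infinity>\<xi>. cnj (a (- \<xi>) * cis (freq_dot (- \<xi>) x)))"
    unfolding synth_def by (simp add: conjs_def freq_dot_minus cis_cnj)
  also have "\<dots> = cnj (\<Sum>\<^sub>\<infinity>\<xi>. a (- \<xi>) * cis (freq_dot (- \<xi>) x))"
    by (rule infsum_cnj)
  also have "(\<Sum>\<^sub>\<infinity>\<xi>. a (- \<xi>) * cis (freq_dot (- \<xi>) x)) = (\<Sum>\<^sub>\<infinity>\<xi>. a \<xi> * cis (freq_dot \<xi> x))"
    by (rule infsum_reindex_bij_witness[of _ uminus uminus]) auto
  finally show ?thesis by (simp add: synth_def)
qed

section \<open>Products of absolutely convergent series\<close>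

lemma summable_on_mult_pairs:
  fixes f :: "'a \<Rightarrow> real" and g :: "'b \<Rightarrow> real"
  assumes f: "f summable_on UNIV" "\<And>x. 0 \<le> f x" and g: "g summable_on UNIV" "\<And>y. 0 \<le> g y"
  shows "(\<lambda>p. f (fst p) * g (snd p)) summable_on UNIV"
proof -
  have "(\<lambda>p. f (fst p) * g (snd p)) summable_on UNIV \<times> UNIV"
  proof (rule summable_on_SigmaI[where g = "\<lambda>x. f x * infsum g UNIV"])
    show "((\<lambda>y. f (fst (x, y)) * g (snd (x, y))) has_sum f x * infsum g UNIV) UNIV" for x
      using has_sum_cmult_right[OF has_sum_infsum[OF g(1)], of "f x"] by simp
    show "(\<lambda>x. f x * infsum g UNIV) summable_on UNIV"
      by (rule summable_on_cmult_left[OF f(1)])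
  qed (simp add: f g)
  then show ?thesis by simp
qed

lemma infsum_mult_pairs:
  fixes f :: "'a \<Rightarrow> complex" and g :: "'b \<Rightarrow> complex"
  assumes "(\<lambda>p. cmod (f (fst p)) * cmod (g (snd p))) summable_on UNIV"
  shows "(\<Sum>\<^sub>\<infinity>p. f (fst p) * g (snd p)) = infsum f UNIV * infsum g UNIV"
proof -
  have "(\<lambda>p. f (fst p) * g (snd p)) summable_on UNIV"
    by (rule abs_summable_summable) (simp add: norm_mult assms)
  then have "(\<Sum>\<^sub>\<infinity>p. f (fst p) * g (snd p)) = (\<Sum>\<^sub>\<infinity>x. \<Sum>\<^sub>\<infinity>y. f x * g y)"
    using infsum_Sigma'_banach[of "\<lambda>x y. f x * g y" UNIV "\<lambda>_. UNIV"] by (simp add: case_prod_unfold)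
  then show ?thesis
    by (simp add: infsum_cmult_right' infsum_cmult_left')
qed

text \<open>Both sides are the absolutely convergent sum over all triples of frequencies; on the right it
  is grouped by the total frequency.\<close>

lemma synth_mult3:
  fixes a b c :: "int ^ 'd::finite \<Rightarrow> complex"
  assumes a: "l1 a" and b: "l1 b" and c: "l1 c"
  shows "l1 (tri (\<lambda>_ _ _. 1) a b c)"
    and "synth (tri (\<lambda>_ _ _. 1) a b c) x = synth a x * synth b x * synth c x"
proof -
  define e where "e \<xi> = cis (freq_dot \<xi> x)" for \<xi> :: "int ^ 'd"
  have e: "cmod (e \<xi>) = 1" for \<xi> by (simp add: e_def)
  have e_add: "e (\<xi> + \<eta>) = e \<xi> * e \<eta>" for \<xi> \<eta> by (simp add: e_def freq_dot_add cis_mult)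
  define f where "f u v w = a u * e u * (b v * e v) * (c w * e w)" for u v w
  have bc: "(\<lambda>p. cmod (b (fst p)) * cmod (c (snd p))) summable_on UNIV"
    by (intro summable_on_mult_pairs b c) auto
  have abc: "(\<lambda>p. cmod (a (fst p)) * (cmod (b (fst (snd p))) * cmod (c (snd (snd p))))) summable_on UNIV"
    using summable_on_mult_pairs[OF a _ bc] by simp
  have abs_eq: "cmod (f u v w) = cmod (a u) * (cmod (b v) * cmod (c w))" for u v w
    by (simp add: f_def norm_mult e)
  \<comment> \<open>Here p is (\<xi>, (u, v)). The reindexing passes to the triple (u, v, w) with w
    = \<xi> - u - v and back; in the new variables the summand is a product.\<close>
  have "(\<lambda>p. cmod (f (fst (snd p)) (snd (snd p)) (fst p - fst (snd p) - snd (snd p)))) summable_on UNIV"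
    unfolding abs_eq
    by (subst summable_on_reindex_bij_witness[where T = UNIV
            and h = "\<lambda>p. cmod (a (fst p)) * (cmod (b (fst (snd p))) * cmod (c (snd (snd p))))"
            and j = "\<lambda>p. (fst (snd p), snd (snd p), fst p - fst (snd p) - snd (snd p))"
            and i = "\<lambda>p. (fst p + fst (snd p) + snd (snd p), fst p, fst (snd p))"]) (simp_all add: abc)
  then have summ: "(\<lambda>(\<xi>, p). cmod (f (fst p) (snd p) (\<xi> - fst p - snd p))) summable_on UNIV \<times> UNIV"
    by (simp add: case_prod_unfold)
  have summ': "(\<lambda>(\<xi>, p). f (fst p) (snd p) (\<xi> - fst p - snd p)) summable_on UNIV \<times> UNIV"
    by (rule abs_summable_summable) (use summ in \<open>simp add: case_prod_unfold\<close>)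
  have row: "(\<Sum>\<^sub>\<infinity>p. f (fst p) (snd p) (\<xi> - fst p - snd p)) = tri (\<lambda>_ _ _. 1) a b c \<xi> * e \<xi>" for \<xi>
  proof -
    have "f u v (\<xi> - u - v) = a u * b v * c (\<xi> - u - v) * e \<xi>" for u v
    proof -
      have "e \<xi> = e u * e v * e (\<xi> - u - v)" by (simp flip: e_add)
      then show ?thesis by (simp add: f_def)
    qed
    then show ?thesis
      unfolding tri_def by (simp add: infsum_cmult_left')
  qed
  have row_summable: "(\<lambda>p. cmod (f (fst p) (snd p) (\<xi> - fst p - snd p))) summable_on UNIV" for \<xi>
    using summable_on_SigmaD1[OF summ, of \<xi>] by simp
  have rows: "(\<lambda>\<xi>. \<Sum>\<^sub>\<infinity>p. cmod (f (fst p) (snd p) (\<xi> - fst p - snd p))) summable_on UNIV"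
    using summable_on_Sigma_banach[OF summ] by simp
  show "l1 (tri (\<lambda>_ _ _. 1) a b c)"
  proof (rule summable_on_comparison_test[OF rows])
    fix \<xi>
    have "cmod (tri (\<lambda>_ _ _. 1) a b c \<xi>) = cmod (tri (\<lambda>_ _ _. 1) a b c \<xi> * e \<xi>)"
      by (simp add: norm_mult e)
    also have "\<dots> \<le> (\<Sum>\<^sub>\<infinity>p. cmod (f (fst p) (snd p) (\<xi> - fst p - snd p)))"
      unfolding row[symmetric] by (rule norm_infsum_bound[OF row_summable])
    finally show "cmod (tri (\<lambda>_ _ _. 1) a b c \<xi>) \<le> (\<Sum>\<^sub>\<infinity>p. cmod (f (fst p) (snd p) (\<xi> - fst p - snd p)))" .
  qed simp
  have "synth (tri (\<lambda>_ _ _. 1) a b c) x = (\<Sum>\<^sub>\<infinity>\<xi>. \<Sum>\<^sub>\<infinity>p. f (fst p) (snd p) (\<xi> - fst p - snd p))"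
    unfolding synth_def row e_def ..
  also have "\<dots> = (\<Sum>\<^sub>\<infinity>(\<xi>, p)\<in>UNIV \<times> UNIV. f (fst p) (snd p) (\<xi> - fst p - snd p))"
    by (rule infsum_Sigma'_banach[OF summ'])
  also have "\<dots> = (\<Sum>\<^sub>\<infinity>p. f (fst p) (fst (snd p)) (snd (snd p)))"
    by (rule infsum_reindex_bij_witness[where j = "\<lambda>p. (fst (snd p), snd (snd p), fst p - fst (snd p) - snd (snd p))"
            and i = "\<lambda>p. (fst p + fst (snd p) + snd (snd p), fst p, fst (snd p))"]) auto
  also have "\<dots> = (\<Sum>\<^sub>\<infinity>p. (a (fst p) * e (fst p)) * ((\<lambda>q. (b (fst q) * e (fst q)) * (c (snd q) * e (snd q))) (snd p)))"
    by (simp add: f_def mult.assoc)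
  also have "\<dots> = (\<Sum>\<^sub>\<infinity>u. a u * e u) * (\<Sum>\<^sub>\<infinity>q. (b (fst q) * e (fst q)) * (c (snd q) * e (snd q)))"
    by (rule infsum_mult_pairs) (use abc in \<open>simp add: norm_mult e\<close>)
  also have "(\<Sum>\<^sub>\<infinity>q. (b (fst q) * e (fst q)) * (c (snd q) * e (snd q))) = (\<Sum>\<^sub>\<infinity>v. b v * e v) * (\<Sum>\<^sub>\<infinity>w. c w * e w)"
    using infsum_mult_pairs[of "\<lambda>v. b v * e v" "\<lambda>w. c w * e w"] bc by (simp add: norm_mult e)
  finally show "synth (tri (\<lambda>_ _ _. 1) a b c) x = synth a x * synth b x * synth c x"
    by (simp add: synth_def e_def)
qed

lemma hs_le_l1:
  assumes "real CARD('d) / 2 < s" "hs_le s (a :: int ^ 'd::finite \<Rightarrow> complex) A"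
  shows "l1 a"
proof -
  obtain K where "K > 0" and K: "\<And>(a :: int ^ 'd \<Rightarrow> complex) A F. hs_le s a A \<Longrightarrow> finite F \<Longrightarrow> (\<Sum>\<xi>\<in>F. cmod (a \<xi>)) \<le> K * A"
    using hs_le_sum_bound[OF assms(1)] by metis
  have "bdd_above (sum (\<lambda>\<xi>. cmod (a \<xi>)) ` {F. F \<subseteq> UNIV \<and> finite F})"
    by (rule bdd_aboveI2[where M = "K * A"]) (use K[OF assms(2)] in simp)
  then show ?thesis
    by (rule nonneg_bdd_above_summable_on[rotated]) simp
qed

section \<open>The numerical scheme on Fourier coefficients\<close>

lemma hs_le_if_Hs_norm_le:
  assumes "in_Hs s (f :: real ^ 'd::finite \<Rightarrow> complex)" "Hs_norm s f \<le> M"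
  shows "hs_le s (fcoeff f) M"
  unfolding hs_le_def
proof (intro allI impI)
  fix F :: "(int ^ 'd) set"
  assume F: "finite F"
  define S where "S = (\<Sum>\<^sub>\<infinity>\<xi>. (1 + freq_sq \<xi>) powr s * (cmod (fcoeff f \<xi>))\<^sup>2)"
  have "(\<Sum>\<xi>\<in>F. (1 + freq_sq \<xi>) powr s * (cmod (fcoeff f \<xi>))\<^sup>2) \<le> S"
    unfolding S_def using assms(1) F by (intro finite_sum_le_infsum) (auto simp: in_Hs_def)
  moreover have "S \<le> (2 * pi) ^ CARD('d) * S"
  proof -
    have "0 \<le> S" unfolding S_def by (intro infsum_nonneg) auto
    moreover have "1 \<le> (2 * pi) ^ CARD('d)" using pi_ge_two by (intro one_le_power) linarith
    ultimately show ?thesis using mult_right_mono by fastforce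
  qed
  ultimately have "L2_set (\<lambda>\<xi>. wt s \<xi> * cmod (fcoeff f \<xi>)) F \<le> sqrt ((2 * pi) ^ CARD('d) * S)"
    unfolding L2_set_def power_mult_distrib wt_sq by (intro real_sqrt_le_mono) linarith
  then show "L2_set (\<lambda>\<xi>. wt s \<xi> * cmod (fcoeff f \<xi>)) F \<le> M"
    using assms(2) by (simp add: Hs_norm_def S_def)
qed

lemma Hs_norm_le_if_hs_le:
  assumes "hs_le s (fcoeff f) B"
  shows "Hs_norm s (f :: real ^ 'd::finite \<Rightarrow> complex) \<le> sqrt ((2 * pi) ^ CARD('d)) * B"
proof -
  have B: "0 \<le> B" by (rule hs_le_nonneg[OF assms])
  have fin: "(\<Sum>\<xi>\<in>F. (1 + freq_sq \<xi>) powr s * (cmod (fcoeff f \<xi>))\<^sup>2) \<le> B\<^sup>2" if "finite F" for F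
  proof -
    have "sqrt (\<Sum>\<xi>\<in>F. (1 + freq_sq \<xi>) powr s * (cmod (fcoeff f \<xi>))\<^sup>2) \<le> B"
      using assms that by (simp add: hs_le_def L2_set_def power_mult_distrib wt_sq)
    then show ?thesis by (rule sqrt_le_D)
  qed
  have "bdd_above (sum (\<lambda>\<xi>. (1 + freq_sq \<xi>) powr s * (cmod (fcoeff f \<xi>))\<^sup>2) ` {F. F \<subseteq> UNIV \<and> finite F})"
    by (rule bdd_aboveI2[where M = "B\<^sup>2"]) (use fin in simp)
  then have "(\<lambda>\<xi>. (1 + freq_sq \<xi>) powr s * (cmod (fcoeff f \<xi>))\<^sup>2) summable_on UNIV"
    by (rule nonneg_bdd_above_summable_on[rotated]) simp
  then have "(\<Sum>\<^sub>\<infinity>\<xi>. (1 + freq_sq \<xi>) powr s * (cmod (fcoeff f \<xi>))\<^sup>2) \<le> B\<^sup>2"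
    by (rule infsum_le_finite_sums) (rule fin)
  then have "sqrt (\<Sum>\<^sub>\<infinity>\<xi>. (1 + freq_sq \<xi>) powr s * (cmod (fcoeff f \<xi>))\<^sup>2) \<le> B"
    using B by (rule real_le_lsqrt[rotated])
  then show ?thesis
    by (simp add: Hs_norm_def real_sqrt_mult mult_left_mono)
qed

text \<open>The bridge between the two pictures: elements of H^s matter only almost everywhere on
  the cube, the operators of the scheme act on coefficients, and products are taken pointwise.
  Absolute summability makes the series continuous and is preserved by products.\<close>

definition represents :: "(real ^ 'd \<Rightarrow> complex) \<Rightarrow> (int ^ 'd \<Rightarrow> complex) \<Rightarrow> bool" where
  "represents f a \<longleftrightarrow> l1 a \<and> set_borel_measurable lborel torus_cube f \<and>
     (AE x in lborel. x \<in> torus_cube \<longrightarrow> f x = synth a x)"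

lemma represents_fcoeff:
  assumes "represents f (a :: int ^ 'd::finite \<Rightarrow> complex)"
  shows "fcoeff f = a"
proof
  fix \<xi>
  have "fcoeff f \<xi> = fcoeff (synth a) \<xi>"
    using assms by (intro fcoeff_cong_AE set_measurable_torus[OF measurable_synth]) (auto simp: represents_def)
  also have "\<dots> = a \<xi>" using assms by (intro fcoeff_synth) (auto simp: represents_def)
  finally show "fcoeff f \<xi> = a \<xi>" .
qed

lemma represents_synth: "l1 (a :: int ^ 'd::finite \<Rightarrow> complex) \<Longrightarrow> represents (synth a) a"
  by (simp add: represents_def set_measurable_torus measurable_synth)

lemma represents_integrable:
  assumes "represents f (a :: int ^ 'd::finite \<Rightarrow> complex)"
  shows "set_integrable lborel torus_cube f"
proof -
  have "set_integrable lborel torus_cube (synth a)"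
    using assms by (intro set_integrable_synth) (simp add: represents_def)
  then show ?thesis
    unfolding set_integrable_def
  proof (rule integrable_cong_AE_imp)
    show "(\<lambda>x. indicator torus_cube x *\<^sub>R f x) \<in> borel_measurable lborel"
      using assms by (simp add: represents_def set_borel_measurable_def)
    have "AE x in lborel. x \<in> torus_cube \<longrightarrow> f x = synth a x"
      using assms by (simp add: represents_def)
    then show "AE x in lborel. indicator torus_cube x *\<^sub>R synth a x = indicator torus_cube x *\<^sub>R f x"
      by eventually_elim (auto simp: indicator_def)
  qed
qed

lemma represents_cnj:
  assumes "represents f (a :: int ^ 'd::finite \<Rightarrow> complex)"
  shows "represents (\<lambda>x. cnj (f x)) (conjs a)"
proof -
  have "l1 (conjs a)"
    using assms summable_on_reindex_bij_witness[of UNIV uminus uminus UNIV "\<lambda>\<xi>. cmod (a \<xi>)" "\<lambda>\<xi>. cmod (conjs a \<xi>)"]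
    by (simp add: represents_def conjs_def)
  moreover have "set_borel_measurable lborel torus_cube (\<lambda>x. cnj (f x))"
  proof -
    have "(\<lambda>x. cnj (indicator torus_cube x *\<^sub>R f x)) \<in> borel_measurable lborel"
      by (rule measurable_compose[OF _ borel_measurable_continuous_onI[OF continuous_on_cnj[OF continuous_on_id]]])
         (use assms in \<open>simp add: represents_def set_borel_measurable_def\<close>)
    then show ?thesis by (simp add: set_borel_measurable_def)
  qed
  moreover have "AE x in lborel. x \<in> torus_cube \<longrightarrow> f x = synth a x"
    using assms by (simp add: represents_def)
  then have "AE x in lborel. x \<in> torus_cube \<longrightarrow> cnj (f x) = synth (conjs a) x"
    by eventually_elim (simp add: synth_conjs)
  ultimately show ?thesis by (simp add: represents_def)
qed

lemma represents_mult3: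
  assumes "represents f (a :: int ^ 'd::finite \<Rightarrow> complex)" "represents g b" "represents h c"
  shows "represents (\<lambda>x. f x * g x * h x) (tri (\<lambda>_ _ _. 1) a b c)"
proof -
  have m: "set_borel_measurable lborel torus_cube (\<lambda>x. f x * g x * h x)"
  proof -
    have "(\<lambda>x. (indicator torus_cube x *\<^sub>R f x) * (indicator torus_cube x *\<^sub>R g x) * (indicator torus_cube x *\<^sub>R h x))
        \<in> borel_measurable lborel"
      using assms by (intro borel_measurable_times) (simp_all add: represents_def set_borel_measurable_def)
    moreover have "(indicator torus_cube x *\<^sub>R f x) * (indicator torus_cube x *\<^sub>R g x) * (indicator torus_cube x *\<^sub>R h x)
        = indicator torus_cube x *\<^sub>R (f x * g x * h x)" for x
      by (simp add: indicator_def)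
    ultimately show ?thesis by (simp only: set_borel_measurable_def)
  qed
  have l: "l1 a" "l1 b" "l1 c" using assms by (simp_all add: represents_def)
  have "AE x in lborel. x \<in> torus_cube \<longrightarrow> f x = synth a x" "AE x in lborel. x \<in> torus_cube \<longrightarrow> g x = synth b x"
    "AE x in lborel. x \<in> torus_cube \<longrightarrow> h x = synth c x"
    using assms by (simp_all add: represents_def)
  then have "AE x in lborel. x \<in> torus_cube \<longrightarrow> f x * g x * h x = synth (tri (\<lambda>_ _ _. 1) a b c) x"
    by eventually_elim (simp add: synth_mult3[OF l])
  then show ?thesis using m synth_mult3(1)[OF l] by (simp add: represents_def)
qed

lemma in_Hs_integrable:
  assumes "in_Hs s (f :: real ^ 'd::finite \<Rightarrow> complex)"
  shows "set_integrable lborel torus_cube f"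
  unfolding set_integrable_def
proof (rule Bochner_Integration.integrable_bound)
  show "integrable lborel (\<lambda>x. indicator torus_cube x *\<^sub>R (1 + (cmod (f x))\<^sup>2))"
  proof -
    have "set_integrable lborel (torus_cube :: (real ^ 'd) set) (\<lambda>x. 1::real)"
      unfolding set_integrable_def using emeasure_torus_cube_finite sets_torus_cube
      by (intro integrable_indicator) auto
    from set_integral_add(1)[OF this, of "\<lambda>x. (cmod (f x))\<^sup>2"] assms show ?thesis
      by (simp add: in_Hs_def set_integrable_def)
  qed
  show "(\<lambda>x. indicator torus_cube x *\<^sub>R f x) \<in> borel_measurable lborel"
    using assms by (simp add: in_Hs_def set_borel_measurable_def)
  have "t \<le> 1 + t\<^sup>2" for t :: real
    using zero_le_power2[of "t - 1"] by (simp add: power2_diff) (smt (verit) zero_le_power2)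
  then show "AE x in lborel. cmod (indicator torus_cube x *\<^sub>R f x) \<le> norm (indicator torus_cube x *\<^sub>R (1 + (cmod (f x))\<^sup>2))"
    by (intro AE_I2) (simp add: indicator_def abs_of_nonneg add_nonneg_nonneg)
qed

text \<open>The difference between f and its Fourier series is integrable with vanishing
  coefficients, so completeness applies.\<close>

lemma represents_in_Hs:
  assumes f: "in_Hs s (f :: real ^ 'd::finite \<Rightarrow> complex)" and s: "real CARD('d) / 2 < s"
  shows "represents f (fcoeff f)"
proof -
  have l: "l1 (fcoeff f)" by (rule hs_le_l1[OF s hs_le_if_Hs_norm_le[OF f order_refl]])
  have m: "set_borel_measurable lborel torus_cube f" using f by (simp add: in_Hs_def)
  have "AE x in lborel. x \<in> torus_cube \<longrightarrow> f x - synth (fcoeff f) x = 0"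
  proof (rule fcoeff_zero_imp_AE_zero)
    show "set_integrable lborel torus_cube (\<lambda>x. f x - synth (fcoeff f) x)"
      by (intro set_integral_diff(1) in_Hs_integrable[OF f] set_integrable_synth l)
    show "fcoeff (\<lambda>x. f x - synth (fcoeff f) x) \<xi> = 0" for \<xi>
      using fcoeff_diff[OF in_Hs_integrable[OF f] set_integrable_synth[OF l]] fcoeff_synth[OF l] by simp
  qed
  then show ?thesis using l m by (simp add: represents_def)
qed

section \<open>Bounds for exponentials, phi and psi on the imaginary axis\<close>

lemma has_vector_derivative_cis:
  "((\<lambda>t. cis (c * t)) has_vector_derivative \<i> * of_real c * cis (c * t)) (at t within S)"
proof -
  have "((\<lambda>z. exp (\<i> * (of_real c * z))) has_field_derivative \<i> * of_real c * exp (\<i> * (of_real c * of_real t)))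
      (at (of_real t))"
    by (rule derivative_eq_intros refl | simp)+
  from has_vector_derivative_real_field[OF this] show ?thesis
    by (simp add: cis_conv_exp)
qed

lemma norm_cis_diff_le: "cmod (cis x - cis y) \<le> \<bar>x - y\<bar>"
  using norm_diff_le_vector_derivative[of UNIV "\<lambda>t. cis (1 * t)" _ 1 x y, OF _ has_vector_derivative_cis]
  by (simp add: norm_mult)

lemma norm_cis_taylor2: "cmod (cis x - 1 - \<i> * of_real x) \<le> x\<^sup>2"
proof -
  define S where "S = {t. \<bar>t\<bar> \<le> \<bar>x\<bar>}"
  have "cmod ((cis (1 * x) - of_real x * \<i>) - (cis (1 * 0) - of_real 0 * \<i>)) \<le> \<bar>x\<bar> * \<bar>x - 0\<bar>"
  proof (rule norm_diff_le_vector_derivative[where S = S])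
    show "convex S"
      unfolding S_def using convex_cball[of "0::real" "\<bar>x\<bar>"] by (simp add: cball_def dist_norm)
    fix t assume t: "t \<in> S"
    show "((\<lambda>t. cis (1 * t) - of_real t * \<i>) has_vector_derivative \<i> * of_real 1 * cis (1 * t) - \<i>) (at t within S)"
      by (intro has_vector_derivative_diff has_vector_derivative_cis)
         (auto intro!: derivative_eq_intros)
    have "\<i> * of_real 1 * cis (1 * t) - \<i> = \<i> * (cis t - cis 0)" by (simp add: algebra_simps)
    then show "cmod (\<i> * of_real 1 * cis (1 * t) - \<i>) \<le> \<bar>x\<bar>"
      using norm_cis_diff_le[of t 0] t by (simp add: norm_mult S_def)
  qed (auto simp: S_def)
  then show ?thesis by (simp add: power2_eq_square mult.commute diff_diff_eq add.commute)
qed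

lemma norm_phi_le: "cmod (phi (\<i> * of_real y)) \<le> 1"
proof (cases "y = 0")
  case False
  have "cmod (exp (\<i> * of_real y) - 1) \<le> \<bar>y\<bar>"
    using norm_cis_diff_le[of y 0] by (simp add: cis_conv_exp)
  then show ?thesis using False by (simp add: phi_def norm_divide norm_mult divide_le_eq)
qed (simp add: phi_def)

lemma norm_psi_le: "cmod (psi (\<i> * of_real y)) \<le> 2"
proof (cases "y = 0")
  case False
  \<comment> \<open>Splits the numerator of \<open>psi\<close> into two terms of size at most y^2
    each, so that division by y^2 leaves a bound uniform in y.\<close>
  have "exp (\<i> * of_real y) - 1 - \<i> * of_real y * exp (\<i> * of_real y)
      = (cis y - 1 - \<i> * of_real y) - \<i> * of_real y * (cis y - 1)"
    by (simp add: cis_conv_exp algebra_simps)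
  also have "cmod \<dots> \<le> y\<^sup>2 + \<bar>y\<bar> * \<bar>y\<bar>"
  proof -
    have "cmod (\<i> * of_real y * (cis y - 1)) \<le> \<bar>y\<bar> * \<bar>y\<bar>"
      unfolding norm_mult using norm_cis_diff_le[of y 0] by (simp add: mult_left_mono del: abs_mult_self_eq)
    then show ?thesis
      using norm_cis_taylor2[of y] norm_triangle_ineq4 by (meson add_mono order_trans)
  qed
  also have "\<dots> = 2 * y\<^sup>2" by (simp add: power2_eq_square)
  finally show ?thesis using False
    by (simp add: psi_def norm_divide norm_mult norm_power power_mult_distrib divide_le_eq)
qed (simp add: psi_def)

section \<open>The scheme as a map of coefficients\<close>

definition flow :: "real \<Rightarrow> int ^ 'd \<Rightarrow> complex" where
  "flow t \<xi> = cis (- t * freq_sq \<xi>)"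

definition resonance :: "int ^ 'd \<Rightarrow> int ^ 'd \<Rightarrow> int ^ 'd \<Rightarrow> real" where
  "resonance x y z = freq_sq (x + y + z) - freq_sq x - freq_sq y - freq_sq z"

text \<open>The two cubic terms of the scheme with the outer propagator pulled out. In the
  subtracted term the factors are propagated one by one, and compared with propagating their product
  this leaves the phase cis (\<tau> * resonance).\<close>

definition step_kernel :: "real \<Rightarrow> int ^ 'd \<Rightarrow> int ^ 'd \<Rightarrow> int ^ 'd \<Rightarrow> complex" where
  "step_kernel \<tau> x y z = of_real \<tau> * (phi (\<i> * of_real (2 * \<tau> * freq_sq x)) + psi (\<i> * of_real (2 * \<tau> * freq_sq x)))
     - of_real \<tau> * (psi (\<i> * of_real (2 * \<tau> * freq_sq x)) * cis (\<tau> * resonance x y z))"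

abbreviation tri1 :: "(int ^ 'd \<Rightarrow> complex) \<Rightarrow> (int ^ 'd \<Rightarrow> complex) \<Rightarrow> (int ^ 'd \<Rightarrow> complex) \<Rightarrow> int ^ 'd \<Rightarrow> complex" where
  "tri1 \<equiv> tri (\<lambda>_ _ _. 1)"

definition cubic :: "(int ^ 'd \<Rightarrow> complex) \<Rightarrow> int ^ 'd \<Rightarrow> complex" where
  "cubic a = tri1 (conjs a) a a"

text \<open>One of several groupings of |a|^4 a; \<open>quintic_symmetric\<close> supplies the
  others that arise when the cubic term is varied slot by slot.\<close>

definition quintic :: "(int ^ 'd \<Rightarrow> complex) \<Rightarrow> int ^ 'd \<Rightarrow> complex" where
  "quintic a = tri1 (conjs a) a (cubic a)"

definition coeff_step :: "real \<Rightarrow> (int ^ 'd \<Rightarrow> complex) \<Rightarrow> int ^ 'd \<Rightarrow> complex" where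
  "coeff_step \<tau> a \<xi> = flow \<tau> \<xi> *
     (a \<xi> + \<i> * tri (step_kernel \<tau>) (conjs a) a a \<xi> - of_real (\<tau>\<^sup>2 / 2) * quintic a \<xi>)"

lemma norm_flow: "cmod (flow t \<xi>) = 1"
  by (simp add: flow_def)

lemma norm_step_kernel_le:
  assumes "0 \<le> \<tau>"
  shows "cmod (step_kernel \<tau> x y z) \<le> 5 * \<tau>"
proof -
  define p q where "p = phi (\<i> * of_real (2 * \<tau> * freq_sq x))" and "q = psi (\<i> * of_real (2 * \<tau> * freq_sq x))"
  have "cmod p \<le> 1" "cmod q \<le> 2" unfolding p_def q_def by (rule norm_phi_le, rule norm_psi_le)
  have "step_kernel \<tau> x y z = of_real \<tau> * ((p + q) - q * cis (\<tau> * resonance x y z))"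
    by (simp add: step_kernel_def p_def q_def algebra_simps)
  moreover have "cmod ((p + q) - q * cis (\<tau> * resonance x y z)) \<le> (1 + 2) + 2"
    using \<open>cmod p \<le> 1\<close> \<open>cmod q \<le> 2\<close>
    by (intro norm_triangle_le_diff add_mono norm_triangle_le) (auto simp: norm_mult)
  ultimately show ?thesis
    using mult_left_mono[of "cmod ((p + q) - q * cis (\<tau> * resonance x y z))" 5 \<tau>] assms
    by (simp add: norm_mult)
qed

lemma tri_multiplier_left: "tri m (\<lambda>\<xi>. p \<xi> * a \<xi>) b c = tri (\<lambda>x y z. m x y z * p x) a b c"
  unfolding tri_def by (intro ext infsum_cong) (simp add: mult_ac)

lemma represents_cubic: "represents f a \<Longrightarrow> represents (\<lambda>x. of_real ((cmod (f x))\<^sup>2) * f x) (cubic a)"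
  for a :: "int ^ 'd::finite \<Rightarrow> complex"
  using represents_mult3[OF represents_cnj, of f a f a f a]
  by (simp add: cubic_def complex_norm_square mult.commute[of "f _" "cnj _"] del: of_real_power)

lemma represents_quintic: "represents f a \<Longrightarrow> represents (\<lambda>x. of_real (cmod (f x) ^ 4) * f x) (quintic a)"
  for a :: "int ^ 'd::finite \<Rightarrow> complex"
proof -
  assume f: "represents f a"
  have "of_real (cmod (f x) ^ 4) * f x = cnj (f x) * f x * (of_real ((cmod (f x))\<^sup>2) * f x)" for x
  proof -
    have "complex_of_real (cmod (f x) ^ 4) = of_real ((cmod (f x))\<^sup>2) * of_real ((cmod (f x))\<^sup>2)"
      by (simp flip: power_add of_real_mult)
    then show ?thesis by (simp add: complex_norm_square mult_ac del: of_real_power)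
  qed
  then show "represents (\<lambda>x. of_real (cmod (f x) ^ 4) * f x) (quintic a)"
    using represents_mult3[OF represents_cnj[OF f] f represents_cubic[OF f]] by (simp only: quintic_def)
qed

lemma l1_mult:
  assumes "l1 a" "\<And>\<xi>. cmod (m \<xi>) \<le> B"
  shows "l1 (\<lambda>\<xi>. m \<xi> * a \<xi>)"
  by (rule summable_on_comparison_test[OF summable_on_cmult_right[OF assms(1), of B]])
     (auto simp: norm_mult intro!: mult_right_mono assms)

lemma fmult_eq_synth:
  assumes "represents v (a :: int ^ 'd::finite \<Rightarrow> complex)"
  shows "fmult m v = synth (\<lambda>\<xi>. m \<xi> * a \<xi>)"
  by (rule ext) (simp add: fmult_def synth_def represents_fcoeff[OF assms])

text \<open>There is no sign change for the first frequency: the scheme propagates after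
  conjugating, so all three factors carry the same \<open>flow\<close>.\<close>

lemma flow_add_eq: "flow t x * flow t y * flow t z = flow t (x + y + z) * cis (t * resonance x y z)"
  by (simp add: flow_def resonance_def cis_mult algebra_simps)

text \<open>The identity holds at every point although \<open>v\<close> is known only almost
  everywhere, because every term of \<open>scheme_step\<close> is assembled from Fourier series. The
  \<open>hs_le\<close> bound on \<open>a\<close> justifies splitting the kernel inside
  \<open>tri\<close>.\<close>

theorem scheme_step_eq_synth:
  fixes a :: "int ^ 'd::finite \<Rightarrow> complex"
  assumes s: "real CARD('d) / 2 < s" and v: "represents v a" and a: "hs_le s a A"
  shows "scheme_step \<tau> v = synth (coeff_step \<tau> a)"
    and "l1 (coeff_step \<tau> a)"
proof -
  define ph ps where "ph \<xi> = phi (\<i> * of_real (2 * \<tau> * freq_sq \<xi>))"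
    and "ps \<xi> = psi (\<i> * of_real (2 * \<tau> * freq_sq \<xi>))" for \<xi> :: "int ^ 'd"
  have ph: "cmod (ph \<xi>) \<le> 1" and ps: "cmod (ps \<xi>) \<le> 2" for \<xi>
    unfolding ph_def ps_def by (rule norm_phi_le, rule norm_psi_le)
  have phs: "cmod (ph \<xi> + ps \<xi>) \<le> 3" for \<xi>
    using ph[of \<xi>] ps[of \<xi>] norm_triangle_ineq[of "ph \<xi>" "ps \<xi>"] by linarith
  note vc = represents_cnj[OF v]
  have la: "l1 a" and lc: "l1 (conjs a)" using v vc by (simp_all add: represents_def)
  have fl: "cmod (flow \<tau> \<xi>) \<le> 1" for \<xi> :: "int ^ 'd" by (simp add: norm_flow)
  have schr_eq: "schr \<tau> w = synth (\<lambda>\<xi>. flow \<tau> \<xi> * b \<xi>)" if "represents w b" for w b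
    unfolding schr_def fmult_eq_synth[OF that] flow_def ..
  have op_phi: "op_fun phi \<tau> (\<lambda>z. cnj (v z)) = synth (\<lambda>\<xi>. ph \<xi> * conjs a \<xi>)"
    unfolding op_fun_def fmult_eq_synth[OF vc] by (simp add: ph_def mult_ac)
  have op_psi: "op_fun psi \<tau> (\<lambda>z. cnj (v z)) = synth (\<lambda>\<xi>. ps \<xi> * conjs a \<xi>)"
    unfolding op_fun_def fmult_eq_synth[OF vc] by (simp add: ps_def mult_ac)
  have l_ph: "l1 (\<lambda>\<xi>. ph \<xi> * conjs a \<xi>)" and l_ps: "l1 (\<lambda>\<xi>. ps \<xi> * conjs a \<xi>)"
    and l_phs: "l1 (\<lambda>\<xi>. (ph \<xi> + ps \<xi>) * conjs a \<xi>)"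
    by (rule l1_mult[OF lc ph], rule l1_mult[OF lc ps], rule l1_mult[OF lc phs])
  define e1 where "e1 \<xi> = flow \<tau> \<xi> * a \<xi>" for \<xi>
  define e2 where "e2 \<xi> = flow \<tau> \<xi> * tri1 (\<lambda>\<xi>. (ph \<xi> + ps \<xi>) * conjs a \<xi>) a a \<xi>" for \<xi>
  define p3 where "p3 \<xi> = flow \<tau> \<xi> * (ps \<xi> * conjs a \<xi>)" for \<xi>
  define e3 where "e3 = tri1 p3 e1 e1"
  define e4 where "e4 \<xi> = flow \<tau> \<xi> * quintic a \<xi>" for \<xi>
  have l1e: "l1 e1" unfolding e1_def by (rule l1_mult[OF la fl])
  have l2e: "l1 e2" unfolding e2_def by (rule l1_mult[OF synth_mult3(1)[OF l_phs la la] fl])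
  have l3p: "l1 p3" unfolding p3_def by (rule l1_mult[OF l_ps fl])
  have l3e: "l1 e3" unfolding e3_def by (rule synth_mult3(1)[OF l3p l1e l1e])
  have l4e: "l1 e4" unfolding e4_def
    using represents_quintic[OF v] by (intro l1_mult[OF _ fl]) (simp add: represents_def)
  have t1: "schr \<tau> v = synth e1" unfolding schr_eq[OF v] e1_def ..
  have "represents (\<lambda>y. (op_fun phi \<tau> (\<lambda>z. cnj (v z)) y + op_fun psi \<tau> (\<lambda>z. cnj (v z)) y) * (v y)\<^sup>2)
      (tri1 (\<lambda>\<xi>. (ph \<xi> + ps \<xi>) * conjs a \<xi>) a a)"
    using represents_mult3[OF represents_synth[OF l_phs] v v] synth_add[OF l_ph l_ps]
    by (simp add: op_phi op_psi power2_eq_square mult.assoc distrib_right)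
  from schr_eq[OF this]
  have t2: "schr \<tau> (\<lambda>y. (op_fun phi \<tau> (\<lambda>z. cnj (v z)) y + op_fun psi \<tau> (\<lambda>z. cnj (v z)) y) * (v y)\<^sup>2) = synth e2"
    by (simp only: e2_def[abs_def])
  have "schr \<tau> (op_fun psi \<tau> (\<lambda>z. cnj (v z))) = synth p3"
    unfolding op_psi schr_eq[OF represents_synth[OF l_ps]] p3_def ..
  then have t3: "schr \<tau> (op_fun psi \<tau> (\<lambda>z. cnj (v z))) x * (schr \<tau> v x)\<^sup>2 = synth e3 x" for x
    by (simp add: t1 e3_def synth_mult3(2)[OF l3p l1e l1e] power2_eq_square mult.assoc)
  have t4: "schr \<tau> (\<lambda>y. of_real (cmod (v y) ^ 4) * v y) = synth e4"
    unfolding schr_eq[OF represents_quintic[OF v]] e4_def ..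
  have coeff: "coeff_step \<tau> a \<xi> = e1 \<xi> + (\<i> * of_real \<tau>) * e2 \<xi> + ((- \<i> * of_real \<tau>) * e3 \<xi> + (- of_real (\<tau>\<^sup>2 / 2)) * e4 \<xi>)" for \<xi>
  proof -
    have ha: "hs_le s (conjs a) A" by (rule hs_le_conjs[OF a])
    have k1: "cmod (ph x + ps x) \<le> 3" and k2: "cmod (ps x * cis (\<tau> * resonance x y z)) \<le> 2" for x y z
      using phs ps by (auto simp: norm_mult)
    have k1': "cmod (of_real \<tau> * (ph x + ps x)) \<le> \<bar>\<tau>\<bar> * 3"
      and k2': "cmod (- of_real \<tau> * (ps x * cis (\<tau> * resonance x y z))) \<le> \<bar>\<tau>\<bar> * 2" for x y z
      using k1 k2 by (auto simp: norm_mult intro!: mult_left_mono)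
    have kern: "step_kernel \<tau> = (\<lambda>x y z. of_real \<tau> * (ph x + ps x) + (- of_real \<tau>) * (ps x * cis (\<tau> * resonance x y z)))"
      by (intro ext) (simp add: step_kernel_def ph_def ps_def)
    have E1: "tri (step_kernel \<tau>) (conjs a) a a \<xi> = of_real \<tau> * tri (\<lambda>x y z. ph x + ps x) (conjs a) a a \<xi>
        + (- of_real \<tau>) * tri (\<lambda>x y z. ps x * cis (\<tau> * resonance x y z)) (conjs a) a a \<xi>"
      unfolding kern tri_kernel_add[OF s k1' k2' ha a a] tri_kernel_cmult ..
    have E2: "tri1 (\<lambda>\<xi>. (ph \<xi> + ps \<xi>) * conjs a \<xi>) a a \<xi> = tri (\<lambda>x y z. ph x + ps x) (conjs a) a a \<xi>"
      unfolding tri_multiplier_left by simp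
    have E3: "e3 \<xi> = flow \<tau> \<xi> * tri (\<lambda>x y z. ps x * cis (\<tau> * resonance x y z)) (conjs a) a a \<xi>"
    proof -
      have "e3 = tri1 (\<lambda>\<xi>. (flow \<tau> \<xi> * ps \<xi>) * conjs a \<xi>) (\<lambda>\<xi>. flow \<tau> \<xi> * a \<xi>) (\<lambda>\<xi>. flow \<tau> \<xi> * a \<xi>)"
        by (simp only: e3_def p3_def[abs_def] e1_def[abs_def] mult.assoc)
      also have "\<dots> = tri (\<lambda>x y z. 1 * ((flow \<tau> x * ps x) * flow \<tau> y * flow \<tau> z)) (conjs a) a a"
        by (rule tri_multipliers)
      also have "(\<lambda>x y z. 1 * ((flow \<tau> x * ps x) * flow \<tau> y * flow \<tau> z))
          = (\<lambda>x y z. flow \<tau> (x + y + z) * (ps x * cis (\<tau> * resonance x y z)))"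
      proof (intro ext)
        fix x y z :: "int ^ 'd"
        show "1 * ((flow \<tau> x * ps x) * flow \<tau> y * flow \<tau> z) = flow \<tau> (x + y + z) * (ps x * cis (\<tau> * resonance x y z))"
          using flow_add_eq[of \<tau> x y z] by (simp add: mult_ac)
      qed
      finally show ?thesis by (simp only: tri_outer_multiplier)
    qed
    show ?thesis
      unfolding coeff_step_def e1_def e2_def e4_def E1 E2 E3 by (simp add: algebra_simps)
  qed
  have lsum: "l1 (\<lambda>\<xi>. b \<xi> + c \<xi>)" if "l1 b" "l1 c" for b c :: "int ^ 'd \<Rightarrow> complex"
    by (rule summable_on_comparison_test[OF summable_on_add[OF that]]) (auto simp: norm_triangle_ineq)
  have lmul: "l1 (\<lambda>\<xi>. k * b \<xi>)" if "l1 b" for b :: "int ^ 'd \<Rightarrow> complex" and k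
    by (rule l1_mult[OF that order_refl])
  note ls = lsum[OF l1e lmul[OF l2e]] lsum[OF lmul[OF l3e] lmul[OF l4e]]
  show "l1 (coeff_step \<tau> a)"
    unfolding coeff by (rule lsum[OF ls])
  show "scheme_step \<tau> v = synth (coeff_step \<tau> a)"
  proof
    fix x
    have "synth (coeff_step \<tau> a) x = synth e1 x + (\<i> * of_real \<tau>) * synth e2 x
        + ((- \<i> * of_real \<tau>) * synth e3 x + (- of_real (\<tau>\<^sup>2 / 2)) * synth e4 x)"
      unfolding coeff[abs_def] synth_add[OF ls] synth_add[OF l1e lmul[OF l2e]] synth_add[OF lmul[OF l3e] lmul[OF l4e]] synth_cmult ..
    then show "scheme_step \<tau> v x = synth (coeff_step \<tau> a) x"
      unfolding scheme_step_def mult.assoc[of "\<i> * of_real \<tau>" "schr \<tau> (op_fun psi \<tau> (\<lambda>z. cnj (v z))) x"] t2 t3 t4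
      by (simp add: t1)
  qed
qed

section \<open>The phases of the cubic interaction\<close>

lemma resonance_eq: "resonance x y z = 2 * (freq_ip x y + freq_ip x z + freq_ip y z)"
  by (simp add: resonance_def freq_sq_add freq_ip_add)

text \<open>With p, q, r the lengths of the frequencies, Cauchy-Schwarz leaves only the mixed
  products pq, pr, qr in the resonance, and their squares are terms of the expanded product (1 +
  p^2)(1 + q^2)(1 + r^2). A fourth power p^4 is not among them, which is why the part 2 |x|^2 of the
  phase enters only linearly here and is kept exact in the scheme.\<close>

lemma resonance_bounds:
  defines "J \<equiv> \<lambda>\<xi> :: int ^ 'd. 1 + freq_sq \<xi>"
  shows "\<bar>2 * freq_sq x + resonance x y z\<bar> \<le> 8 * (J x * J y * J z)"
    and "(resonance x y z)\<^sup>2 \<le> 36 * (J x * J y * J z)"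
proof -
  define p q r where "p = sqrt (freq_sq x)" and "q = sqrt (freq_sq y)" and "r = sqrt (freq_sq z)"
  have nn: "0 \<le> p" "0 \<le> q" "0 \<le> r" and sq: "p\<^sup>2 = freq_sq x" "q\<^sup>2 = freq_sq y" "r\<^sup>2 = freq_sq z"
    by (simp_all add: p_def q_def r_def freq_sq_nonneg)
  have J: "J x = 1 + p\<^sup>2" "J y = 1 + q\<^sup>2" "J z = 1 + r\<^sup>2" by (simp_all add: J_def sq)
  have P: "J x * J y * J z = 1 + p\<^sup>2 + q\<^sup>2 + r\<^sup>2 + p\<^sup>2 * q\<^sup>2 + p\<^sup>2 * r\<^sup>2 + q\<^sup>2 * r\<^sup>2 + p\<^sup>2 * q\<^sup>2 * r\<^sup>2"
    unfolding J by (simp add: algebra_simps)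
  have ip: "\<bar>freq_ip x y + freq_ip x z + freq_ip y z\<bar> \<le> p * q + p * r + q * r"
    using freq_ip_Cauchy_Schwarz[of x y] freq_ip_Cauchy_Schwarz[of x z] freq_ip_Cauchy_Schwarz[of y z]
    unfolding p_def q_def r_def by linarith
  have pq: "2 * (p * q) \<le> p\<^sup>2 + q\<^sup>2" "2 * (p * r) \<le> p\<^sup>2 + r\<^sup>2" "2 * (q * r) \<le> q\<^sup>2 + r\<^sup>2"
    using sum_squares_bound[of p q] sum_squares_bound[of p r] sum_squares_bound[of q r] by simp_all
  have n: "0 \<le> p\<^sup>2 * q\<^sup>2" "0 \<le> p\<^sup>2 * r\<^sup>2" "0 \<le> q\<^sup>2 * r\<^sup>2" "0 \<le> p\<^sup>2 * q\<^sup>2 * r\<^sup>2"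
    "0 \<le> p\<^sup>2" "0 \<le> q\<^sup>2" "0 \<le> r\<^sup>2" by simp_all
  have "\<bar>2 * freq_sq x + resonance x y z\<bar> \<le> 2 * p\<^sup>2 + 2 * (p * q + p * r + q * r)"
  proof -
    \<comment> \<open>Stated for arbitrary reals, here and below, so that products of lengths become
      atoms of a linear inequality.\<close>
    have "\<bar>2 * f + 2 * S\<bar> \<le> 2 * f + 2 * T" if "\<bar>S\<bar> \<le> T" "0 \<le> f" for f S T :: real
      using that by linarith
    from this[OF ip freq_sq_nonneg[of x]] show ?thesis unfolding resonance_eq sq .
  qed
  then show "\<bar>2 * freq_sq x + resonance x y z\<bar> \<le> 8 * (J x * J y * J z)"
  proof -
    assume *: "\<bar>2 * freq_sq x + resonance x y z\<bar> \<le> 2 * p\<^sup>2 + 2 * (p * q + p * r + q * r)"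
    have "2 * p2 + 2 * (u + v + w) \<le> 8 * (1 + p2 + q2 + r2 + c1 + c2 + c3 + c4)"
      if "2 * u \<le> p2 + q2" "2 * v \<le> p2 + r2" "2 * w \<le> q2 + r2" "0 \<le> c1" "0 \<le> c2" "0 \<le> c3" "0 \<le> c4"
        "0 \<le> p2" "0 \<le> q2" "0 \<le> r2" for u v w p2 q2 r2 c1 c2 c3 c4 :: real
      using that by (simp add: distrib_left)
    from order_trans[OF * this[OF pq n]] show ?thesis unfolding P .
  qed
  have "(resonance x y z)\<^sup>2 \<le> 4 * (p * q + p * r + q * r)\<^sup>2"
    unfolding resonance_eq power_mult_distrib using abs_le_square_iff[THEN iffD1, OF ip[THEN order_trans, OF abs_ge_self]] by simp
  also have "(p * q + p * r + q * r)\<^sup>2 \<le> 3 * ((p * q)\<^sup>2 + (p * r)\<^sup>2 + (q * r)\<^sup>2)"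
    using sum_squares_bound[of "p * q" "p * r"] sum_squares_bound[of "p * q" "q * r"] sum_squares_bound[of "p * r" "q * r"]
    by (simp add: power2_eq_square algebra_simps)
  also have "4 * (3 * ((p * q)\<^sup>2 + (p * r)\<^sup>2 + (q * r)\<^sup>2)) \<le> 36 * (J x * J y * J z)"
  proof -
    have "4 * (3 * (c1 + c2 + c3)) \<le> 36 * (1 + p2 + q2 + r2 + c1 + c2 + c3 + c4)"
      if "0 \<le> c1" "0 \<le> c2" "0 \<le> c3" "0 \<le> c4" "0 \<le> p2" "0 \<le> q2" "0 \<le> r2" for p2 q2 r2 c1 c2 c3 c4 :: real
      using that by (simp add: distrib_left)
    from this[OF n] show ?thesis unfolding P power_mult_distrib .
  qed
  finally show "(resonance x y z)\<^sup>2 \<le> 36 * (J x * J y * J z)" by simp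
qed

text \<open>\<open>phi\<close> and \<open>- psi\<close> are the integrals of \<open>exp (\<theta> z)\<close> and \<open>\<theta> exp (\<theta> z)\<close> over \<open>0 \<le> \<theta> \<le> 1\<close>.\<close>

lemma has_vector_derivative_phi:
  "((\<lambda>t. of_real t * phi (\<i> * of_real (\<alpha> * t))) has_vector_derivative cis (\<alpha> * t)) (at t within S)"
proof (cases "\<alpha> = 0")
  case True
  then show ?thesis by (auto simp: phi_def intro!: derivative_eq_intros)
next
  case False
  have "of_real t * phi (\<i> * of_real (\<alpha> * t)) = (cis (\<alpha> * t) - 1) / (\<i> * of_real \<alpha>)" for t
    using False by (simp add: phi_def cis_conv_exp field_simps)
  moreover have "((\<lambda>t. (cis (\<alpha> * t) - 1) / (\<i> * of_real \<alpha>)) has_vector_derivative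
      (\<i> * of_real \<alpha> * cis (\<alpha> * t) - 0) / (\<i> * of_real \<alpha>)) (at t within S)"
    by (intro has_vector_derivative_divide has_vector_derivative_diff has_vector_derivative_cis has_vector_derivative_const)
  ultimately show ?thesis using False by simp
qed

lemma has_vector_derivative_psi:
  "((\<lambda>t. - of_real (t\<^sup>2) * psi (\<i> * of_real (\<alpha> * t))) has_vector_derivative of_real t * cis (\<alpha> * t)) (at t within S)"
proof (cases "\<alpha> = 0")
  case True
  then show ?thesis
    by (auto simp: psi_def of_real_power power2_eq_square intro!: derivative_eq_intros)
next
  case False
  have "- of_real (t\<^sup>2) * psi (\<i> * of_real (\<alpha> * t)) = (cis (\<alpha> * t) - 1 - of_real t * (\<i> * of_real \<alpha> * cis (\<alpha> * t))) / of_real (\<alpha>\<^sup>2)" for t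
    using False by (simp add: psi_def cis_conv_exp field_simps power2_eq_square)
  moreover have "((\<lambda>t. (cis (\<alpha> * t) - 1 - of_real t * (\<i> * of_real \<alpha> * cis (\<alpha> * t))) / of_real (\<alpha>\<^sup>2)) has_vector_derivative
      ((\<i> * of_real \<alpha> * cis (\<alpha> * t) - 0) - (of_real t * (\<i> * of_real \<alpha> * (\<i> * of_real \<alpha> * cis (\<alpha> * t))) + 1 * (\<i> * of_real \<alpha> * cis (\<alpha> * t))))
        / of_real (\<alpha>\<^sup>2)) (at t within S)"
    by (intro has_vector_derivative_divide has_vector_derivative_diff has_vector_derivative_cis has_vector_derivative_const
        has_vector_derivative_mult has_vector_derivative_mult_right) (auto intro!: derivative_eq_intros)
  ultimately show ?thesis using False by (simp add: power2_eq_square field_simps)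
qed

definition phase :: "real \<Rightarrow> int ^ 'd \<Rightarrow> int ^ 'd \<Rightarrow> int ^ 'd \<Rightarrow> complex" where
  "phase t x y z = cis ((2 * freq_sq x + resonance x y z) * t)"

text \<open>The phase is kept exactly in the large frequency \<open>2 * freq_sq x\<close> and interpolated linearly
  in time in the resonance, which is a sum of products of different frequencies.\<close>

definition phase_interp :: "real \<Rightarrow> real \<Rightarrow> int ^ 'd \<Rightarrow> int ^ 'd \<Rightarrow> int ^ 'd \<Rightarrow> complex" where
  "phase_interp \<tau> t x y z = cis (2 * freq_sq x * t)
     + of_real t * cis (2 * freq_sq x * t) * ((cis (\<tau> * resonance x y z) - 1) / of_real \<tau>)"

text \<open>The antiderivative of \<open>phase_interp \<tau>\<close> in t that vanishes at 0. At t =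
  \<tau> it is \<open>step_kernel \<tau>\<close>: the cubic part of the scheme is the exact time
  integral of the interpolated phase.\<close>

definition phase_int :: "real \<Rightarrow> real \<Rightarrow> int ^ 'd \<Rightarrow> int ^ 'd \<Rightarrow> int ^ 'd \<Rightarrow> complex" where
  "phase_int \<tau> t x y z = of_real t * phi (\<i> * of_real (2 * freq_sq x * t))
     + (- of_real (t\<^sup>2) * psi (\<i> * of_real (2 * freq_sq x * t))) * ((cis (\<tau> * resonance x y z) - 1) / of_real \<tau>)"

lemma norm_phase: "cmod (phase t x y z) = 1"
  by (simp add: phase_def)

lemma norm_phase_minus_one_le: "cmod (phase t x y z - 1) \<le> 2"
  using norm_triangle_ineq4[of "phase t x y z" 1] by (simp add: norm_phase)

text \<open>For places where one extra factor t is enough: then the weights absorb the full phase,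
  but only its first power.\<close>

lemma norm_phase_minus_one_le_weight:
  assumes "0 \<le> t"
  shows "cmod (phase t x y z - 1) \<le> (8 * t) * ((1 + freq_sq x) * (1 + freq_sq y) * (1 + freq_sq z))"
proof -
  have "cmod (phase t x y z - 1) \<le> \<bar>(2 * freq_sq x + resonance x y z) * t\<bar>"
    using norm_cis_diff_le[of "(2 * freq_sq x + resonance x y z) * t" 0] by (simp add: phase_def)
  also have "\<dots> \<le> 8 * ((1 + freq_sq x) * (1 + freq_sq y) * (1 + freq_sq z)) * t"
    unfolding abs_mult using assms by (intro mult_mono resonance_bounds) (auto simp: freq_sq_nonneg)
  finally show ?thesis by (simp add: mult_ac)
qed

lemma norm_phase_interp_le:
  assumes "0 < \<tau>" "0 \<le> t" "t \<le> \<tau>"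
  shows "cmod (phase_interp \<tau> t x y z) \<le> 3"
proof -
  have "cmod (cis (\<tau> * resonance x y z) - 1) \<le> 2"
    using norm_triangle_ineq4[of "cis (\<tau> * resonance x y z)" 1] by simp
  then have "t * cmod (cis (\<tau> * resonance x y z) - 1) \<le> \<tau> * 2"
    using assms by (intro mult_mono) auto
  then have "cmod (of_real t * cis (2 * freq_sq x * t) * ((cis (\<tau> * resonance x y z) - 1) / of_real \<tau>)) \<le> 2"
    using assms by (simp add: norm_mult norm_divide divide_le_eq mult_ac)
  then show ?thesis
    unfolding phase_interp_def by (intro norm_triangle_le) simp
qed

lemma norm_phase_int_le:
  assumes "0 < \<tau>" "0 \<le> t" "t \<le> \<tau>"
  shows "cmod (phase_int \<tau> t x y z) \<le> 5 * \<tau>"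
proof -
  have "cmod (cis (\<tau> * resonance x y z) - 1) \<le> 2"
    using norm_triangle_ineq4[of "cis (\<tau> * resonance x y z)" 1] by simp
  have "t\<^sup>2 * cmod (psi (\<i> * of_real (2 * freq_sq x * t))) \<le> \<tau>\<^sup>2 * 2"
    using assms by (intro mult_mono norm_psi_le power_mono) auto
  then have "(t\<^sup>2 * cmod (psi (\<i> * of_real (2 * freq_sq x * t)))) * cmod (cis (\<tau> * resonance x y z) - 1) \<le> (\<tau>\<^sup>2 * 2) * 2"
    by (intro mult_mono[OF _ \<open>cmod (cis (\<tau> * resonance x y z) - 1) \<le> 2\<close>]) simp_all
  then have "cmod ((- of_real (t\<^sup>2) * psi (\<i> * of_real (2 * freq_sq x * t))) * ((cis (\<tau> * resonance x y z) - 1) / of_real \<tau>)) \<le> 4 * \<tau>"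
    using assms by (simp add: norm_mult norm_divide norm_power divide_le_eq power2_eq_square mult_ac)
  moreover have "cmod (of_real t * phi (\<i> * of_real (2 * freq_sq x * t))) \<le> \<tau>"
  proof -
    have "t * cmod (phi (\<i> * of_real (2 * freq_sq x * t))) \<le> \<tau> * 1"
      using assms by (intro mult_mono norm_phi_le) auto
    then show ?thesis using assms by (simp add: norm_mult)
  qed
  ultimately show ?thesis
    unfolding phase_int_def using norm_triangle_ineq by (smt (verit))
qed

text \<open>Linear interpolation reproduces constant and linear terms, so only the second-order
  Taylor remainders at t and at \<tau> survive, together at most 2 \<tau>^2 times the squared
  resonance. The 36 of \<open>resonance_bounds\<close> makes this 72.\<close>

lemma norm_phase_diff_interp_le:
  assumes "0 < \<tau>" "0 \<le> t" "t \<le> \<tau>"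
  shows "cmod (phase t x y z - phase_interp \<tau> t x y z) \<le> (72 * \<tau>\<^sup>2) * ((1 + freq_sq x) * (1 + freq_sq y) * (1 + freq_sq z))"
proof -
  define b where "b = resonance x y z"
  define r where "r u = cis u - 1 - \<i> * of_real u" for u
  have "phase t x y z - phase_interp \<tau> t x y z
      = cis (2 * freq_sq x * t) * (cis (b * t) - 1 - of_real (t / \<tau>) * (cis (\<tau> * b) - 1))"
    unfolding phase_def phase_interp_def b_def distrib_right cis_mult[symmetric]
    using assms by (simp add: field_simps)
  moreover have "cis (b * t) - 1 - of_real (t / \<tau>) * (cis (\<tau> * b) - 1) = r (b * t) - of_real (t / \<tau>) * r (\<tau> * b)"
    using assms by (simp add: r_def field_simps)
  ultimately have "cmod (phase t x y z - phase_interp \<tau> t x y z) = cmod (r (b * t) - of_real (t / \<tau>) * r (\<tau> * b))"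
    by (simp add: norm_mult)
  also have "\<dots> \<le> cmod (r (b * t)) + (t / \<tau>) * cmod (r (\<tau> * b))"
    using norm_triangle_ineq4[of "r (b * t)" "of_real (t / \<tau>) * r (\<tau> * b)"] assms
    by (simp add: norm_mult norm_divide)
  also have "\<dots> \<le> (b * t)\<^sup>2 + 1 * (\<tau> * b)\<^sup>2"
    using assms unfolding r_def by (intro add_mono mult_mono norm_cis_taylor2) auto
  also have "\<dots> \<le> (2 * \<tau>\<^sup>2) * b\<^sup>2"
  proof -
    have "t\<^sup>2 * b\<^sup>2 \<le> \<tau>\<^sup>2 * b\<^sup>2"
      using assms by (intro mult_right_mono power_mono) auto
    then show ?thesis by (simp add: power_mult_distrib mult.commute)
  qed
  also have "\<dots> \<le> (2 * \<tau>\<^sup>2) * (36 * ((1 + freq_sq x) * (1 + freq_sq y) * (1 + freq_sq z)))"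
    unfolding b_def by (intro mult_left_mono resonance_bounds) simp
  also have "\<dots> = (72 * \<tau>\<^sup>2) * ((1 + freq_sq x) * (1 + freq_sq y) * (1 + freq_sq z))"
    by simp
  finally show ?thesis .
qed

lemma has_vector_derivative_phase_int:
  "((\<lambda>t. phase_int \<tau> t x y z) has_vector_derivative phase_interp \<tau> t x y z) (at t within S)"
  unfolding phase_int_def phase_interp_def
  by (intro has_vector_derivative_add has_vector_derivative_mult_left has_vector_derivative_phi has_vector_derivative_psi)

lemma phase_int_0: "phase_int \<tau> 0 x y z = 0"
  by (simp add: phase_int_def)

lemma phase_int_eq_step_kernel:
  assumes "\<tau> \<noteq> 0"
  shows "phase_int \<tau> \<tau> = step_kernel \<tau>"
  using assms by (intro ext) (simp add: phase_int_def step_kernel_def field_simps power2_eq_square)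

text \<open>The groupings agree as pointwise products of functions by commutativity, and their
  coefficients are the convolutions in question; this replaces a reindexing of fourfold
  sums.\<close>

lemma quintic_symmetric:
  fixes a :: "int ^ 'd::finite \<Rightarrow> complex"
  assumes "l1 a"
  shows "tri1 (conjs (cubic a)) a a = quintic a" and "tri1 (conjs a) (cubic a) a = quintic a"
proof -
  have f: "represents (synth a) a" by (rule represents_synth[OF assms])
  note fc = represents_cnj[OF f] and g = represents_cubic[OF f]
  have q: "fcoeff (\<lambda>x. cnj (synth a x) * synth a x * (of_real ((cmod (synth a x))\<^sup>2) * synth a x)) = quintic a"
    using represents_fcoeff[OF represents_mult3[OF fc f g]] by (simp only: quintic_def)
  have "fcoeff (\<lambda>x. cnj (of_real ((cmod (synth a x))\<^sup>2) * synth a x) * synth a x * synth a x) = tri1 (conjs (cubic a)) a a"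
    by (rule represents_fcoeff[OF represents_mult3[OF represents_cnj[OF g] f f]])
  then show "tri1 (conjs (cubic a)) a a = quintic a"
    using q by (simp add: mult_ac)
  have "fcoeff (\<lambda>x. cnj (synth a x) * (of_real ((cmod (synth a x))\<^sup>2) * synth a x) * synth a x) = tri1 (conjs a) (cubic a) a"
    by (rule represents_fcoeff[OF represents_mult3[OF fc g f]])
  then show "tri1 (conjs a) (cubic a) a = quintic a"
    using q by (simp add: mult_ac)
qed

section \<open>Local error\<close>

lemma conjs_add: "conjs (\<lambda>\<xi>. a \<xi> + b \<xi>) = (\<lambda>\<xi>. conjs a \<xi> + conjs b \<xi>)"
  by (auto simp: conjs_def)

lemma conjs_diff: "conjs (\<lambda>\<xi>. a \<xi> - b \<xi>) = (\<lambda>\<xi>. conjs a \<xi> - conjs b \<xi>)"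
  by (auto simp: conjs_def)

lemma conjs_cmult: "conjs (\<lambda>\<xi>. k * a \<xi>) = (\<lambda>\<xi>. cnj k * conjs a \<xi>)"
  by (auto simp: conjs_def)

text \<open>One constant serves both orders of regularity, and the type argument fixes the
  dimension. All later constants become explicit expressions in \<open>K\<close>, the bound on the
  solution and T.\<close>

locale tri_algebra =
  fixes \<gamma> K :: real and ty :: "'d::finite itself"
  assumes gamma: "real CARD('d) / 2 < \<gamma>" and K_pos: "0 < K"
    and tri_bound: "\<And>m (a :: int ^ 'd \<Rightarrow> complex) b c \<mu> \<alpha> \<beta> \<kappa>.
      (\<And>x y z. cmod (m x y z) \<le> \<mu>) \<Longrightarrow> hs_le \<gamma> a \<alpha> \<Longrightarrow> hs_le \<gamma> b \<beta> \<Longrightarrow> hs_le \<gamma> c \<kappa>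
      \<Longrightarrow> hs_le \<gamma> (tri m a b c) (K * (\<mu> * \<alpha> * \<beta> * \<kappa>))"
    and tri_bound2: "\<And>m (a :: int ^ 'd \<Rightarrow> complex) b c \<mu> \<alpha> \<beta> \<kappa>.
      (\<And>x y z. cmod (m x y z) \<le> \<mu>) \<Longrightarrow> hs_le (\<gamma> + 2) a \<alpha> \<Longrightarrow> hs_le (\<gamma> + 2) b \<beta> \<Longrightarrow> hs_le (\<gamma> + 2) c \<kappa>
      \<Longrightarrow> hs_le (\<gamma> + 2) (tri m a b c) (K * (\<mu> * \<alpha> * \<beta> * \<kappa>))"

lemma tri_algebra_exists:
  assumes "real CARD('d::finite) / 2 < \<gamma>"
  shows "\<exists>K. tri_algebra TYPE('d) \<gamma> K"
proof -
  obtain K where K: "0 < K" "\<And>m (a :: int ^ 'd \<Rightarrow> complex) b c \<mu> \<alpha> \<beta> \<kappa>.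
    (\<And>x y z. cmod (m x y z) \<le> \<mu>) \<Longrightarrow> hs_le \<gamma> a \<alpha> \<Longrightarrow> hs_le \<gamma> b \<beta> \<Longrightarrow> hs_le \<gamma> c \<kappa>
    \<Longrightarrow> hs_le \<gamma> (tri m a b c) (K * (\<mu> * \<alpha> * \<beta> * \<kappa>))"
    by (rule hs_le_tri_bound[OF assms], rule that) blast+
  have assms2: "real CARD('d) / 2 < \<gamma> + 2" using assms by simp
  obtain K' where K': "0 < K'" "\<And>m (a :: int ^ 'd \<Rightarrow> complex) b c \<mu> \<alpha> \<beta> \<kappa>.
    (\<And>x y z. cmod (m x y z) \<le> \<mu>) \<Longrightarrow> hs_le (\<gamma> + 2) a \<alpha> \<Longrightarrow> hs_le (\<gamma> + 2) b \<beta> \<Longrightarrow> hs_le (\<gamma> + 2) c \<kappa>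
    \<Longrightarrow> hs_le (\<gamma> + 2) (tri m a b c) (K' * (\<mu> * \<alpha> * \<beta> * \<kappa>))"
    by (rule hs_le_tri_bound[OF assms2], rule that) blast+
  have nonneg: "0 \<le> \<mu> * \<alpha> * \<beta> * \<kappa>"
    if "\<And>x y z. cmod (m x y z) \<le> \<mu>" "hs_le s a \<alpha>" "hs_le s b \<beta>" "hs_le s c \<kappa>"
    for s and m :: "int ^ 'd \<Rightarrow> int ^ 'd \<Rightarrow> int ^ 'd \<Rightarrow> complex" and a b c :: "int ^ 'd \<Rightarrow> complex" and \<mu> \<alpha> \<beta> \<kappa>
    using order_trans[OF norm_ge_zero that(1)] that(2-4)[THEN hs_le_nonneg] by simp
  have "tri_algebra TYPE('d) \<gamma> (max K K')"
  proof
    fix m :: "int ^ 'd \<Rightarrow> int ^ 'd \<Rightarrow> int ^ 'd \<Rightarrow> complex" and a b c :: "int ^ 'd \<Rightarrow> complex" and \<mu> \<alpha> \<beta> \<kappa>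
    assume m: "\<And>x y z. cmod (m x y z) \<le> \<mu>"
    show "hs_le \<gamma> (tri m a b c) (max K K' * (\<mu> * \<alpha> * \<beta> * \<kappa>))" if "hs_le \<gamma> a \<alpha>" "hs_le \<gamma> b \<beta>" "hs_le \<gamma> c \<kappa>"
      by (rule hs_le_trans[OF K(2)[OF m that]]) (intro mult_right_mono nonneg[OF m that], simp)
    show "hs_le (\<gamma> + 2) (tri m a b c) (max K K' * (\<mu> * \<alpha> * \<beta> * \<kappa>))"
      if "hs_le (\<gamma> + 2) a \<alpha>" "hs_le (\<gamma> + 2) b \<beta>" "hs_le (\<gamma> + 2) c \<kappa>"
      by (rule hs_le_trans[OF K'(2)[OF m that]]) (intro mult_right_mono nonneg[OF m that], simp)
  qed (use assms K(1) in auto)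
  then show ?thesis ..
qed

context tri_algebra
begin

section \<open>Multilinear estimates for twisted products\<close>

lemma tri_bound_weighted:
  fixes a b c :: "int ^ 'd \<Rightarrow> complex"
  assumes "\<And>x y z. cmod (m x y z) \<le> \<mu> * ((1 + freq_sq x) * (1 + freq_sq y) * (1 + freq_sq z))"
    and "hs_le (\<gamma> + 2) a \<alpha>" "hs_le (\<gamma> + 2) b \<beta>" "hs_le (\<gamma> + 2) c \<kappa>"
  shows "hs_le \<gamma> (tri m a b c) (K * (\<mu> * \<alpha> * \<beta> * \<kappa>))"
  by (rule hs_le_tri_weighted[OF tri_bound assms])

lemma tri_telescope:
  fixes a b c a' b' c' :: "int ^ 'd \<Rightarrow> complex"
  assumes m: "\<And>x y z. cmod (m x y z) \<le> \<mu>"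
    and a: "hs_le \<gamma> a \<alpha>" "hs_le \<gamma> a' \<alpha>'" and b: "hs_le \<gamma> b \<beta>" "hs_le \<gamma> b' \<beta>'" and c: "hs_le \<gamma> c \<kappa>" "hs_le \<gamma> c' \<kappa>'"
  shows "tri m a b c \<xi> - tri m a' b' c' \<xi> = tri m (\<lambda>\<xi>. a \<xi> - a' \<xi>) b c \<xi>
    + tri m a' (\<lambda>\<xi>. b \<xi> - b' \<xi>) c \<xi> + tri m a' b' (\<lambda>\<xi>. c \<xi> - c' \<xi>) \<xi>"
proof -
  have "tri m a b c \<xi> = tri m a' b c \<xi> + tri m (\<lambda>\<xi>. a \<xi> - a' \<xi>) b c \<xi>"
    using tri_add_left[OF gamma m a(2) hs_le_diff[OF a(1,2)] b(1) c(1), where \<xi> = \<xi>] by simp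
  moreover have "tri m a' b c \<xi> = tri m a' b' c \<xi> + tri m a' (\<lambda>\<xi>. b \<xi> - b' \<xi>) c \<xi>"
    using tri_add_mid[OF gamma m a(2) b(2) hs_le_diff[OF b(1,2)] c(1), where \<xi> = \<xi>] by simp
  moreover have "tri m a' b' c \<xi> = tri m a' b' c' \<xi> + tri m a' b' (\<lambda>\<xi>. c \<xi> - c' \<xi>) \<xi>"
    using tri_add_right[OF gamma m a(2) b(2) c(2) hs_le_diff[OF c(1,2)], where \<xi> = \<xi>] by simp
  ultimately show ?thesis by simp
qed

lemma hs_le_tri_diff:
  fixes a b c a' b' c' :: "int ^ 'd \<Rightarrow> complex"
  assumes m: "\<And>x y z. cmod (m x y z) \<le> \<mu>"
    and a: "hs_le \<gamma> a \<alpha>" "hs_le \<gamma> a' \<alpha>" "hs_le \<gamma> (\<lambda>\<xi>. a \<xi> - a' \<xi>) D\<^sub>a"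
    and b: "hs_le \<gamma> b \<beta>" "hs_le \<gamma> b' \<beta>" "hs_le \<gamma> (\<lambda>\<xi>. b \<xi> - b' \<xi>) D\<^sub>b"
    and c: "hs_le \<gamma> c \<kappa>" "hs_le \<gamma> c' \<kappa>" "hs_le \<gamma> (\<lambda>\<xi>. c \<xi> - c' \<xi>) D\<^sub>c"
  shows "hs_le \<gamma> (\<lambda>\<xi>. tri m a b c \<xi> - tri m a' b' c' \<xi>)
    (K * \<mu> * (D\<^sub>a * \<beta> * \<kappa> + \<alpha> * D\<^sub>b * \<kappa> + \<alpha> * \<beta> * D\<^sub>c))"
  unfolding tri_telescope[OF m a(1,2) b(1,2) c(1,2)]
  by (rule hs_le_trans[OF hs_le_add[OF hs_le_add[OF tri_bound[OF m a(3) b(1) c(1)] tri_bound[OF m a(2) b(3) c(1)]]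
        tri_bound[OF m a(2) b(2) c(3)]]]) (simp add: algebra_simps)

lemma tri_phase_split:
  fixes a b c :: "int ^ 'd \<Rightarrow> complex"
  assumes "hs_le \<gamma> a \<alpha>" "hs_le \<gamma> b \<beta>" "hs_le \<gamma> c \<kappa>"
  shows "tri (phase t) a b c \<xi> = tri1 a b c \<xi> + tri (\<lambda>x y z. phase t x y z - 1) a b c \<xi>"
  using tri_kernel_add[OF gamma _ norm_phase_minus_one_le[of t] assms, where m = "\<lambda>_ _ _. 1" and \<mu> = 1 and \<xi> = \<xi>] by simp

lemma hs_le_diff_self: "hs_le \<gamma> (\<lambda>\<xi>. a \<xi> - a \<xi>) 0"
  using hs_le_zero by simp

lemma norm_phase_le: "cmod (phase t x y z) \<le> 1"
  by (simp add: norm_phase)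

lemma hs_le_lower_order: "hs_le (\<gamma> + 2) a A \<Longrightarrow> hs_le \<gamma> a A"
  by (erule hs_le_order) simp

text \<open>Substituting \<open>k * g + r\<close> into one slot of the twisted product: the main part is \<open>k\<close> times the
  untwisted product, since removing the phase costs a factor \<open>t\<close> and two derivatives.\<close>

lemma hs_le_tri_phase_left:
  fixes g r b c :: "int ^ 'd \<Rightarrow> complex"
  assumes t: "0 \<le> t" and g: "hs_le (\<gamma> + 2) g \<Gamma>" and r: "hs_le \<gamma> r R" and b: "hs_le (\<gamma> + 2) b \<beta>" and c: "hs_le (\<gamma> + 2) c \<kappa>"
  shows "hs_le \<gamma> (\<lambda>\<xi>. tri (phase t) (\<lambda>\<xi>. k * g \<xi> + r \<xi>) b c \<xi> - k * tri1 g b c \<xi>)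
    (cmod k * (K * (8 * t * \<Gamma> * \<beta> * \<kappa>)) + K * (1 * R * \<beta> * \<kappa>))"
proof -
  have eq: "tri (phase t) (\<lambda>\<xi>. k * g \<xi> + r \<xi>) b c \<xi> - k * tri1 g b c \<xi>
      = k * tri (\<lambda>x y z. phase t x y z - 1) g b c \<xi> + tri (phase t) r b c \<xi>" for \<xi>
    using tri_add_left[where m = "phase t" and \<xi> = \<xi>, OF gamma norm_phase_le hs_le_cmult[OF hs_le_lower_order[OF g], where c = k] r hs_le_lower_order[OF b] hs_le_lower_order[OF c]]
      tri_phase_split[OF hs_le_lower_order[OF g] hs_le_lower_order[OF b] hs_le_lower_order[OF c], of t \<xi>]
    by (simp add: tri_cmult_left algebra_simps)
  show ?thesis
    unfolding eq by (rule hs_le_add[OF hs_le_cmult[OF tri_bound_weighted[OF norm_phase_minus_one_le_weight[OF t] g b c]]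
        tri_bound[OF norm_phase_le r hs_le_lower_order[OF b] hs_le_lower_order[OF c]]])
qed

lemma hs_le_tri_phase_mid:
  fixes g r b c :: "int ^ 'd \<Rightarrow> complex"
  assumes t: "0 \<le> t" and g: "hs_le (\<gamma> + 2) g \<Gamma>" and r: "hs_le \<gamma> r R" and b: "hs_le (\<gamma> + 2) b \<beta>" and c: "hs_le (\<gamma> + 2) c \<kappa>"
  shows "hs_le \<gamma> (\<lambda>\<xi>. tri (phase t) b (\<lambda>\<xi>. k * g \<xi> + r \<xi>) c \<xi> - k * tri1 b g c \<xi>)
    (cmod k * (K * (8 * t * \<beta> * \<Gamma> * \<kappa>)) + K * (1 * \<beta> * R * \<kappa>))"
proof -
  have eq: "tri (phase t) b (\<lambda>\<xi>. k * g \<xi> + r \<xi>) c \<xi> - k * tri1 b g c \<xi>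
      = k * tri (\<lambda>x y z. phase t x y z - 1) b g c \<xi> + tri (phase t) b r c \<xi>" for \<xi>
    using tri_add_mid[where m = "phase t" and \<xi> = \<xi>, OF gamma norm_phase_le hs_le_lower_order[OF b] hs_le_cmult[OF hs_le_lower_order[OF g], where c = k] r hs_le_lower_order[OF c]]
      tri_phase_split[OF hs_le_lower_order[OF b] hs_le_lower_order[OF g] hs_le_lower_order[OF c], of t \<xi>]
    by (simp add: tri_cmult_mid algebra_simps)
  show ?thesis
    unfolding eq by (rule hs_le_add[OF hs_le_cmult[OF tri_bound_weighted[OF norm_phase_minus_one_le_weight[OF t] b g c]]
        tri_bound[OF norm_phase_le hs_le_lower_order[OF b] r hs_le_lower_order[OF c]]])
qed

lemma hs_le_tri_phase_right:
  fixes g r b c :: "int ^ 'd \<Rightarrow> complex"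
  assumes t: "0 \<le> t" and g: "hs_le (\<gamma> + 2) g \<Gamma>" and r: "hs_le \<gamma> r R" and b: "hs_le (\<gamma> + 2) b \<beta>" and c: "hs_le (\<gamma> + 2) c \<kappa>"
  shows "hs_le \<gamma> (\<lambda>\<xi>. tri (phase t) b c (\<lambda>\<xi>. k * g \<xi> + r \<xi>) \<xi> - k * tri1 b c g \<xi>)
    (cmod k * (K * (8 * t * \<beta> * \<kappa> * \<Gamma>)) + K * (1 * \<beta> * \<kappa> * R))"
proof -
  have eq: "tri (phase t) b c (\<lambda>\<xi>. k * g \<xi> + r \<xi>) \<xi> - k * tri1 b c g \<xi>
      = k * tri (\<lambda>x y z. phase t x y z - 1) b c g \<xi> + tri (phase t) b c r \<xi>" for \<xi>
    using tri_add_right[where m = "phase t" and \<xi> = \<xi>, OF gamma norm_phase_le hs_le_lower_order[OF b] hs_le_lower_order[OF c] hs_le_cmult[OF hs_le_lower_order[OF g], where c = k] r]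
      tri_phase_split[OF hs_le_lower_order[OF b] hs_le_lower_order[OF c] hs_le_lower_order[OF g], of t \<xi>]
    by (simp add: tri_cmult_right algebra_simps)
  show ?thesis
    unfolding eq by (rule hs_le_add[OF hs_le_cmult[OF tri_bound_weighted[OF norm_phase_minus_one_le_weight[OF t] b c g]]
        tri_bound[OF norm_phase_le hs_le_lower_order[OF b] hs_le_lower_order[OF c] r]])
qed

text \<open>The integrating factor removes the linear term. Conjugation reverses the phase of the
  first factor, so the total phase is |x + y + z|^2 + |x|^2 - |y|^2 - |z|^2, the resonance plus 2
  |x|^2.\<close>

lemma twisted_derivative:
  fixes U :: "real \<Rightarrow> int ^ 'd \<Rightarrow> complex"
  assumes U: "((\<lambda>t. U t \<xi>) has_vector_derivative \<i> * (- of_real (freq_sq \<xi>) * U t \<xi> + cubic (U t) \<xi>)) (at t within S)"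
  defines "w \<equiv> \<lambda>t \<xi>. cis (freq_sq \<xi> * t) * U t \<xi>"
  shows "((\<lambda>t. w t \<xi>) has_vector_derivative \<i> * tri (phase t) (conjs (w t)) (w t) (w t) \<xi>) (at t within S)"
proof -
  have Uw: "U t = (\<lambda>\<xi>. flow t \<xi> * w t \<xi>)"
    by (auto simp: w_def flow_def cis_mult mult.assoc[symmetric])
  have cU: "conjs (U t) = (\<lambda>\<xi>. cis (freq_sq \<xi> * t) * conjs (w t) \<xi>)"
    by (auto simp: Uw conjs_def flow_def freq_sq_minus cis_cnj mult.commute)
  have "cis (freq_sq \<xi> * t) * cubic (U t) \<xi>
      = tri (\<lambda>x y z. cis (freq_sq (x + y + z) * t) * (1 * (cis (freq_sq x * t) * flow t y * flow t z))) (conjs (w t)) (w t) (w t) \<xi>"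
    unfolding cubic_def unfolding cU unfolding Uw unfolding tri_multipliers
    by (rule tri_outer_multiplier[where h = "\<lambda>\<xi>. cis (freq_sq \<xi> * t)"])
  also have "(\<lambda>x y z. cis (freq_sq (x + y + z) * t) * (1 * (cis (freq_sq x * t) * flow t y * flow t z))) = phase t"
    by (intro ext) (simp add: phase_def flow_def resonance_def cis_mult algebra_simps)
  finally have cub: "cis (freq_sq \<xi> * t) * cubic (U t) \<xi> = tri (phase t) (conjs (w t)) (w t) (w t) \<xi>" .
  have "((\<lambda>t. w t \<xi>) has_vector_derivative
      cis (freq_sq \<xi> * t) * (\<i> * (- of_real (freq_sq \<xi>) * U t \<xi> + cubic (U t) \<xi>))
      + (\<i> * of_real (freq_sq \<xi>) * cis (freq_sq \<xi> * t)) * U t \<xi>) (at t within S)"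
    unfolding w_def by (rule has_vector_derivative_mult[OF has_vector_derivative_cis U])
  moreover have "cis (freq_sq \<xi> * t) * (\<i> * (- of_real (freq_sq \<xi>) * U t \<xi> + cubic (U t) \<xi>))
      + (\<i> * of_real (freq_sq \<xi>) * cis (freq_sq \<xi> * t)) * U t \<xi> = \<i> * (cis (freq_sq \<xi> * t) * cubic (U t) \<xi>)"
    by (simp add: algebra_simps)
  ultimately show ?thesis by (simp only: cub)
qed

text \<open>The constants follow the time expansion of w: \<open>C\<^sub>1\<close> bounds w' in
  order \<gamma> + 2, \<open>C\<^sub>2\<close> is the rate at which w' leaves its initial value in
  order \<gamma>, and the terms of \<open>C\<^sub>3\<close> are, in this order, the quadratic
  variations of the cubic term, the removal of the phase from the linear ones, the second-order
  remainder of w, and the interpolation error.\<close>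

lemma local_error:
  fixes U :: "real \<Rightarrow> int ^ 'd \<Rightarrow> complex"
  assumes \<tau>: "0 < \<tau>"
    and U: "\<And>t. t \<in> {0..\<tau>} \<Longrightarrow> hs_le (\<gamma> + 2) (U t) M"
    and U': "\<And>\<xi> t. t \<in> {0..\<tau>} \<Longrightarrow> ((\<lambda>t. U t \<xi>) has_vector_derivative
      \<i> * (- of_real (freq_sq \<xi>) * U t \<xi> + cubic (U t) \<xi>)) (at t within {0..\<tau>})"
  defines "C\<^sub>1 \<equiv> K * M ^ 3"
  defines "C\<^sub>2 \<equiv> K * (3 * C\<^sub>1 * M\<^sup>2) + 8 * K * M ^ 3"
  defines "C\<^sub>3 \<equiv> 3 * K * C\<^sub>1\<^sup>2 * M + 24 * K * C\<^sub>1 * M\<^sup>2 + 3 * K * C\<^sub>2 * M\<^sup>2 + 72 * K * M ^ 3"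
  shows "hs_le \<gamma> (\<lambda>\<xi>. U \<tau> \<xi> - coeff_step \<tau> (U 0) \<xi>) (C\<^sub>3 * \<tau> ^ 3)"
proof -
  define w where "w t \<xi> = cis (freq_sq \<xi> * t) * U t \<xi>" for t \<xi>
  define w' where "w' t \<xi> = \<i> * tri (phase t) (conjs (w t)) (w t) (w t) \<xi>" for t \<xi>
  define a where "a = U 0"
  have w0: "w 0 = a" by (auto simp: w_def a_def)
  have M: "0 \<le> M" using U[of 0] \<tau> by (auto intro: hs_le_nonneg)
  have C1: "0 \<le> C\<^sub>1" using M K_pos by (simp add: C\<^sub>1_def)
  have C2: "0 \<le> C\<^sub>2" using M K_pos C1 by (simp add: C\<^sub>2_def)
  have C3: "0 \<le> C\<^sub>3 - 72 * K * M ^ 3" using M K_pos C1 C2 by (simp add: C\<^sub>3_def)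
  have hw: "hs_le (\<gamma> + 2) (w t) M" if "t \<in> {0..\<tau>}" for t
    unfolding w_def by (rule hs_le_unimodular[OF U[OF that]]) simp
  have ha: "hs_le (\<gamma> + 2) a M" using hw[of 0] \<tau> by (simp add: w0)
  note hca = hs_le_conjs[OF ha]
  note ha0 = hs_le_lower_order[OF ha] and hca0 = hs_le_lower_order[OF hca]
  have la: "l1 a" by (rule hs_le_l1[OF gamma ha0])
  have dw: "((\<lambda>t. w t \<xi>) has_vector_derivative w' t \<xi>) (at t within {0..s})"
    if "t \<in> {0..s}" "s \<le> \<tau>" for t s \<xi>
  proof -
    have "((\<lambda>t. w t \<xi>) has_vector_derivative w' t \<xi>) (at t within {0..\<tau>})"
      unfolding w'_def w_def by (rule twisted_derivative, rule U') (use that in auto)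
    then show ?thesis
      by (rule has_vector_derivative_within_subset) (use that in auto)
  qed
  have hw': "hs_le (\<gamma> + 2) (w' t) C\<^sub>1" if t: "t \<in> {0..\<tau>}" for t
    unfolding w'_def
    by (rule hs_le_trans[OF hs_le_unimodular[OF tri_bound2[OF norm_phase_le hs_le_conjs[OF hw[OF t]] hw[OF t] hw[OF t]]]])
       (simp_all add: C\<^sub>1_def power3_eq_cube)
  define G where "G = cubic a"
  define Q where "Q = quintic a"
  have hG: "hs_le (\<gamma> + 2) G C\<^sub>1"
    unfolding G_def cubic_def
    by (rule hs_le_trans[OF tri_bound2[OF _ hca ha ha, where \<mu> = 1]]) (simp_all add: C\<^sub>1_def power3_eq_cube)
  have first: "hs_le \<gamma> (\<lambda>\<xi>. w t \<xi> - a \<xi>) (C\<^sub>1 * t)" if t: "t \<in> {0..\<tau>}" for t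
  proof -
    have "hs_le (\<gamma> + 2) (\<lambda>\<xi>. w t \<xi> - w 0 \<xi>) (C\<^sub>1 * t)"
    proof (rule mean_value_hs_le[where D = "\<lambda>\<xi> t. w t \<xi>" and D' = "\<lambda>\<xi> t. w' t \<xi>"])
      fix s assume s: "s \<in> {0..t}"
      show "((\<lambda>t. w t \<xi>) has_vector_derivative w' s \<xi>) (at s within {0..t})" for \<xi>
        using s t by (intro dw) auto
      show "hs_le (\<gamma> + 2) (w' s) C\<^sub>1" using s t by (intro hw') auto
    qed (use t in auto)
    then show ?thesis unfolding w0 by (rule hs_le_lower_order)
  qed
  have cfirst: "hs_le \<gamma> (\<lambda>\<xi>. conjs (w t) \<xi> - conjs a \<xi>) (C\<^sub>1 * t)" if t: "t \<in> {0..\<tau>}" for t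
    using hs_le_conjs[OF first[OF t]] by (simp only: conjs_diff)
  \<comment> \<open>At t = 0 the phase is 1 and w' is i G. Up to the factor K, moving w back to a
    costs 3 \<open>C\<^sub>1\<close> M^2 t and dropping the phase costs 8 M^3 t.\<close>
  have deriv0: "hs_le \<gamma> (\<lambda>\<xi>. w' t \<xi> - \<i> * G \<xi>) (C\<^sub>2 * t)" if t: "t \<in> {0..\<tau>}" for t
  proof -
    note hwt = hs_le_lower_order[OF hw[OF t]]
    have eq: "w' t \<xi> - \<i> * G \<xi> = \<i> * ((tri (phase t) (conjs (w t)) (w t) (w t) \<xi> - tri (phase t) (conjs a) a a \<xi>)
        + tri (\<lambda>x y z. phase t x y z - 1) (conjs a) a a \<xi>)" for \<xi>
      using tri_phase_split[OF hca0 ha0 ha0, of t \<xi>] by (simp add: w'_def G_def cubic_def algebra_simps)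
    have t0: "0 \<le> t" using t by simp
    show ?thesis
      unfolding eq
      by (rule hs_le_trans[OF hs_le_unimodular[OF hs_le_add[OF
            hs_le_tri_diff[OF norm_phase_le hs_le_conjs[OF hwt] hca0 cfirst[OF t] hwt ha0 first[OF t] hwt ha0 first[OF t]]
            tri_bound_weighted[OF norm_phase_minus_one_le_weight[OF t0] hca ha ha]]]])
         (simp_all add: C\<^sub>2_def power2_eq_square power3_eq_cube algebra_simps)
  qed
  have second: "hs_le \<gamma> (\<lambda>\<xi>. w t \<xi> - a \<xi> - of_real t * (\<i> * G \<xi>)) (C\<^sub>2 * t\<^sup>2)" if t: "t \<in> {0..\<tau>}" for t
  proof -
    have "hs_le \<gamma> (\<lambda>\<xi>. (w t \<xi> - of_real t * (\<i> * G \<xi>)) - (w 0 \<xi> - of_real 0 * (\<i> * G \<xi>))) (C\<^sub>2 * t * t)"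
    proof (rule mean_value_hs_le[where D = "\<lambda>\<xi> t. w t \<xi> - of_real t * (\<i> * G \<xi>)" and D' = "\<lambda>\<xi> t. w' t \<xi> - 1 * (\<i> * G \<xi>)"])
      fix s assume s: "s \<in> {0..t}"
      show "((\<lambda>t. w t \<xi> - of_real t * (\<i> * G \<xi>)) has_vector_derivative w' s \<xi> - 1 * (\<i> * G \<xi>)) (at s within {0..t})" for \<xi>
        using s t by (intro has_vector_derivative_diff dw has_vector_derivative_mult_left) (auto intro!: derivative_eq_intros)
      have "hs_le \<gamma> (\<lambda>\<xi>. w' s \<xi> - \<i> * G \<xi>) (C\<^sub>2 * s)" using s t by (intro deriv0) auto
      then show "hs_le \<gamma> (\<lambda>\<xi>. w' s \<xi> - 1 * (\<i> * G \<xi>)) (C\<^sub>2 * t)"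
        unfolding mult_1 by (rule hs_le_trans) (use s C2 in \<open>simp add: mult_left_mono\<close>)
    qed (use t in auto)
    then show ?thesis by (simp add: w0 power2_eq_square diff_diff_eq add.commute mult.assoc)
  qed
  \<comment> \<open>Both products carry the same phase, so only the motion of w counts; its
    first-order effect is i t Q, and what remains is quadratic in t.\<close>
  have main: "hs_le \<gamma> (\<lambda>\<xi>. tri (phase t) (conjs (w t)) (w t) (w t) \<xi> - tri (phase t) (conjs a) a a \<xi> - \<i> * of_real t * Q \<xi>)
      ((C\<^sub>3 - 72 * K * M ^ 3) * t\<^sup>2)" if t: "t \<in> {0..\<tau>}" for t
  proof -
    have t0: "0 \<le> t" using t by simp
    note hwt = hs_le_lower_order[OF hw[OF t]]
    define k where "k = \<i> * of_real t"
    define r where "r \<xi> = w t \<xi> - a \<xi> - of_real t * (\<i> * G \<xi>)" for \<xi>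
    define \<delta> where "\<delta> \<xi> = w t \<xi> - a \<xi>" for \<xi>
    have nk: "cmod k = t" "cmod (- k) = t" using t0 by (simp_all add: k_def norm_mult)
    have \<delta>_eq: "\<delta> = (\<lambda>\<xi>. k * G \<xi> + r \<xi>)" by (auto simp: \<delta>_def r_def k_def algebra_simps)
    \<comment> \<open>k is imaginary, so the conjugated slot contributes with the opposite
      sign.\<close>
    have c\<delta>_eq: "conjs \<delta> = (\<lambda>\<xi>. (- k) * conjs G \<xi> + conjs r \<xi>)"
      unfolding \<delta>_eq conjs_add conjs_cmult by (simp add: k_def)
    have h\<delta>: "hs_le \<gamma> \<delta> (C\<^sub>1 * t)" unfolding \<delta>_def by (rule first[OF t])
    have hr: "hs_le \<gamma> r (C\<^sub>2 * t\<^sup>2)" unfolding r_def by (rule second[OF t])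
    note hc\<delta> = hs_le_conjs[OF h\<delta>]
    have c\<delta>_diff: "(\<lambda>\<xi>. conjs (w t) \<xi> - conjs a \<xi>) = conjs \<delta>" unfolding \<delta>_def conjs_diff ..
    have l1: "hs_le \<gamma> (\<lambda>\<xi>. tri (phase t) (conjs \<delta>) a a \<xi> - (- k) * Q \<xi>) (cmod (- k) * (K * (8 * t * C\<^sub>1 * M * M)) + K * (1 * (C\<^sub>2 * t\<^sup>2) * M * M))"
      unfolding c\<delta>_eq Q_def quintic_symmetric(1)[OF la, symmetric] G_def[symmetric]
      by (rule hs_le_tri_phase_left[OF t0 hs_le_conjs[OF hG] hs_le_conjs[OF hr] ha ha])
    have l2: "hs_le \<gamma> (\<lambda>\<xi>. tri (phase t) (conjs a) \<delta> a \<xi> - k * Q \<xi>) (cmod k * (K * (8 * t * M * C\<^sub>1 * M)) + K * (1 * M * (C\<^sub>2 * t\<^sup>2) * M))"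
      unfolding \<delta>_eq Q_def quintic_symmetric(2)[OF la, symmetric] G_def[symmetric]
      by (rule hs_le_tri_phase_mid[OF t0 hG hr hca ha])
    have l3: "hs_le \<gamma> (\<lambda>\<xi>. tri (phase t) (conjs a) a \<delta> \<xi> - k * Q \<xi>) (cmod k * (K * (8 * t * M * M * C\<^sub>1)) + K * (1 * M * M * (C\<^sub>2 * t\<^sup>2)))"
      unfolding \<delta>_eq Q_def quintic_def G_def[symmetric]
      by (rule hs_le_tri_phase_right[OF t0 hG hr hca ha])
    have h\<delta>': "hs_le \<gamma> (\<lambda>\<xi>. w t \<xi> - a \<xi>) (C\<^sub>1 * t)" by (rule first[OF t])
    have q1: "hs_le \<gamma> (\<lambda>\<xi>. tri (phase t) (conjs \<delta>) (w t) (w t) \<xi> - tri (phase t) (conjs \<delta>) a a \<xi>)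
        (K * 1 * (0 * M * M + (C\<^sub>1 * t) * (C\<^sub>1 * t) * M + (C\<^sub>1 * t) * M * (C\<^sub>1 * t)))"
      by (rule hs_le_tri_diff[OF norm_phase_le hc\<delta> hc\<delta> hs_le_diff_self hwt ha0 h\<delta>' hwt ha0 h\<delta>'])
    have q2: "hs_le \<gamma> (\<lambda>\<xi>. tri (phase t) (conjs a) \<delta> (w t) \<xi> - tri (phase t) (conjs a) \<delta> a \<xi>)
        (K * 1 * (0 * (C\<^sub>1 * t) * M + M * 0 * M + M * (C\<^sub>1 * t) * (C\<^sub>1 * t)))"
      by (rule hs_le_tri_diff[OF norm_phase_le hca0 hca0 hs_le_diff_self h\<delta> h\<delta> hs_le_diff_self hwt ha0 h\<delta>'])
    \<comment> \<open>Telescoping over the slots, with a put back for w in the slots not yet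
      changed. The multiples of Q add up to -k + k + k = k = i t.\<close>
    have eq: "tri (phase t) (conjs (w t)) (w t) (w t) \<xi> - tri (phase t) (conjs a) a a \<xi> - \<i> * of_real t * Q \<xi>
      = (tri (phase t) (conjs \<delta>) (w t) (w t) \<xi> - tri (phase t) (conjs \<delta>) a a \<xi>)
      + (tri (phase t) (conjs \<delta>) a a \<xi> - (- k) * Q \<xi>)
      + (tri (phase t) (conjs a) \<delta> (w t) \<xi> - tri (phase t) (conjs a) \<delta> a \<xi>)
      + (tri (phase t) (conjs a) \<delta> a \<xi> - k * Q \<xi>)
      + (tri (phase t) (conjs a) a \<delta> \<xi> - k * Q \<xi>)" for \<xi>
      unfolding tri_telescope[where m = "phase t", OF norm_phase_le hs_le_conjs[OF hwt] hca0 hwt ha0 hwt ha0] c\<delta>_diff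
      by (simp add: k_def \<delta>_def[abs_def] algebra_simps)
    show ?thesis
      unfolding eq
      by (rule hs_le_trans[OF hs_le_add[OF hs_le_add[OF hs_le_add[OF hs_le_add[OF q1 l1] q2] l2] l3]])
         (simp only: nk, simp add: C\<^sub>3_def power2_eq_square algebra_simps)
  qed
  \<comment> \<open>The bracket of \<open>coeff_step\<close> continued to intermediate times, with
    the interpolation node \<tau> fixed. Its quintic term is the time integral of i * (i t
    Q).\<close>
  define A where "A t \<xi> = a \<xi> + \<i> * tri (phase_int \<tau> t) (conjs a) a a \<xi> - of_real (t\<^sup>2 / 2) * Q \<xi>" for t \<xi>
  define A' where "A' t \<xi> = 0 + \<i> * tri (phase_interp \<tau> t) (conjs a) a a \<xi> - of_real t * Q \<xi>" for t \<xi>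
  have dA: "((\<lambda>t. A t \<xi>) has_vector_derivative A' t \<xi>) (at t within {0..\<tau>})" if t: "t \<in> {0..\<tau>}" for t \<xi>
  proof -
    have "((\<lambda>t. tri (phase_int \<tau> t) (conjs a) a a \<xi>) has_vector_derivative tri (phase_interp \<tau> t) (conjs a) a a \<xi>) (at t within {0..\<tau>})"
    proof (rule has_vector_derivative_tri[OF gamma hca0 ha0 ha0])
      show "cmod (phase_interp \<tau> s x y z) \<le> 3" if "s \<in> {0..\<tau>}" for x y z s
        using that \<tau> by (intro norm_phase_interp_le) auto
      show "cmod (phase_int \<tau> s x y z) \<le> 5 * \<tau>" if "s \<in> {0..\<tau>}" for x y z s
        using that \<tau> by (intro norm_phase_int_le) auto
    qed (use t in \<open>auto intro: has_vector_derivative_phase_int\<close>)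
    moreover have "((\<lambda>t. complex_of_real (t\<^sup>2 / 2)) has_vector_derivative of_real t) (at t within {0..\<tau>})"
    proof -
      have "((\<lambda>t. t\<^sup>2 / 2) has_real_derivative t) (at t within {0..\<tau>})"
        by (auto intro!: derivative_eq_intros)
      then show ?thesis by (rule has_vector_derivative_of_real)
    qed
    ultimately show ?thesis
      unfolding A_def A'_def
      by (intro has_vector_derivative_diff has_vector_derivative_add has_vector_derivative_const
          has_vector_derivative_mult_right has_vector_derivative_mult_left)
  qed
  have interp: "tri (phase t) (conjs a) a a \<xi> = tri (phase_interp \<tau> t) (conjs a) a a \<xi>
      + tri (\<lambda>x y z. phase t x y z - phase_interp \<tau> t x y z) (conjs a) a a \<xi>" if t: "t \<in> {0..\<tau>}" for t \<xi>
  proof -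
    have b1: "cmod (phase_interp \<tau> t x y z) \<le> 3" for x y z :: "int ^ 'd"
      using t \<tau> by (intro norm_phase_interp_le) auto
    have b2: "cmod (phase t x y z - phase_interp \<tau> t x y z) \<le> 1 + 3" for x y z :: "int ^ 'd"
      using b1[of x y z] norm_phase_le[of t x y z] norm_triangle_ineq4[of "phase t x y z" "phase_interp \<tau> t x y z"] by linarith
    show ?thesis
      using tri_kernel_add[where m = "phase_interp \<tau> t" and m' = "\<lambda>x y z. phase t x y z - phase_interp \<tau> t x y z" and \<xi> = \<xi>,
          OF gamma b1 b2 hca0 ha0 ha0] by simp
  qed
  have hD': "hs_le \<gamma> (\<lambda>\<xi>. w' t \<xi> - A' t \<xi>) (C\<^sub>3 * \<tau>\<^sup>2)" if t: "t \<in> {0..\<tau>}" for t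
  proof -
    have eq: "w' t \<xi> - A' t \<xi> = \<i> * ((tri (phase t) (conjs (w t)) (w t) (w t) \<xi> - tri (phase t) (conjs a) a a \<xi> - \<i> * of_real t * Q \<xi>)
        + tri (\<lambda>x y z. phase t x y z - phase_interp \<tau> t x y z) (conjs a) a a \<xi>)" for \<xi>
      using interp[OF t, of \<xi>] by (simp add: w'_def A'_def algebra_simps)
    have b: "cmod (phase t x y z - phase_interp \<tau> t x y z) \<le> (72 * \<tau>\<^sup>2) * ((1 + freq_sq x) * (1 + freq_sq y) * (1 + freq_sq z))"
      for x y z :: "int ^ 'd"
      using t \<tau> by (intro norm_phase_diff_interp_le) auto
    have "(C\<^sub>3 - 72 * K * M ^ 3) * t\<^sup>2 \<le> (C\<^sub>3 - 72 * K * M ^ 3) * \<tau>\<^sup>2"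
      using t C3 by (intro mult_left_mono power_mono) auto
    then have le: "(C\<^sub>3 - 72 * K * M ^ 3) * t\<^sup>2 + K * (72 * \<tau>\<^sup>2 * M * M * M) \<le> C\<^sub>3 * \<tau>\<^sup>2"
      by (simp add: algebra_simps power3_eq_cube)
    show ?thesis
      unfolding eq
      by (rule hs_le_trans[OF hs_le_unimodular[OF hs_le_add[OF main[OF t] tri_bound_weighted[OF b hca ha ha]]] le]) simp
  qed
  have "hs_le \<gamma> (\<lambda>\<xi>. (w \<tau> \<xi> - A \<tau> \<xi>) - (w 0 \<xi> - A 0 \<xi>)) (C\<^sub>3 * \<tau>\<^sup>2 * \<tau>)"
    by (rule mean_value_hs_le[where D = "\<lambda>\<xi> t. w t \<xi> - A t \<xi>" and D' = "\<lambda>\<xi> t. w' t \<xi> - A' t \<xi>"])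
       (use \<tau> in \<open>auto intro!: has_vector_derivative_diff dw dA hD'\<close>)
  moreover have "A 0 = a"
    by (rule ext) (simp add: A_def phase_int_0[abs_def] tri_def)
  ultimately have "hs_le \<gamma> (\<lambda>\<xi>. w \<tau> \<xi> - A \<tau> \<xi>) (C\<^sub>3 * \<tau> ^ 3)"
    by (simp add: w0 power3_eq_cube power2_eq_square mult.assoc)
  from hs_le_unimodular[OF this norm_flow[of \<tau>]]
  have "hs_le \<gamma> (\<lambda>\<xi>. flow \<tau> \<xi> * (w \<tau> \<xi> - A \<tau> \<xi>)) (C\<^sub>3 * \<tau> ^ 3)" .
  moreover have "flow \<tau> \<xi> * (w \<tau> \<xi> - A \<tau> \<xi>) = U \<tau> \<xi> - coeff_step \<tau> (U 0) \<xi>" for \<xi>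
  proof -
    have "flow \<tau> \<xi> * w \<tau> \<xi> = U \<tau> \<xi>"
      by (simp add: w_def flow_def cis_mult mult.assoc[symmetric])
    moreover have "flow \<tau> \<xi> * A \<tau> \<xi> = coeff_step \<tau> (U 0) \<xi>"
      using \<tau> by (simp add: A_def coeff_step_def phase_int_eq_step_kernel a_def Q_def)
    ultimately show ?thesis by (simp add: right_diff_distrib)
  qed
  ultimately show ?thesis by simp
qed

end

section \<open>Global error\<close>

context tri_algebra
begin

text \<open>The cubic term has three slots and a kernel of size 5 \<tau>, which gives 15 K R^2; the
  quintic term has five slots and two convolutions, which with \<tau>^2 / 2 \<le> \<tau> gives 5 K^2
  R^4. Only the modulus of the kernel enters, so no derivative is lost.\<close>

lemma hs_le_coeff_step_diff:
  fixes a b :: "int ^ 'd \<Rightarrow> complex"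
  assumes \<tau>: "0 \<le> \<tau>" "\<tau> \<le> 1" and a: "hs_le \<gamma> a R" and b: "hs_le \<gamma> b R" and d: "hs_le \<gamma> (\<lambda>\<xi>. a \<xi> - b \<xi>) D"
  shows "hs_le \<gamma> (\<lambda>\<xi>. coeff_step \<tau> a \<xi> - coeff_step \<tau> b \<xi>) ((1 + (15 * K * R\<^sup>2 + 5 * K\<^sup>2 * R ^ 4) * \<tau>) * D)"
proof -
  note ca = hs_le_conjs[OF a] and cb = hs_le_conjs[OF b]
  have cd: "hs_le \<gamma> (\<lambda>\<xi>. conjs a \<xi> - conjs b \<xi>) D"
    using hs_le_conjs[OF d] by (simp only: conjs_diff)
  have one: "cmod 1 \<le> 1" by simp
  have D: "0 \<le> D" by (rule hs_le_nonneg[OF d])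
  have R: "0 \<le> R" by (rule hs_le_nonneg[OF a])
  have cub: "hs_le \<gamma> (cubic v) (K * R ^ 3)" if "hs_le \<gamma> v R" for v :: "int ^ 'd \<Rightarrow> complex"
    unfolding cubic_def
    by (rule hs_le_trans[OF tri_bound[OF _ hs_le_conjs[OF that] that that, where \<mu> = 1]]) (simp_all add: power3_eq_cube)
  have cub_d: "hs_le \<gamma> (\<lambda>\<xi>. cubic a \<xi> - cubic b \<xi>) (K * 1 * (D * R * R + R * D * R + R * R * D))"
    unfolding cubic_def by (rule hs_le_tri_diff[OF one ca cb cd a b d a b d])
  have quint_d: "hs_le \<gamma> (\<lambda>\<xi>. quintic a \<xi> - quintic b \<xi>)
      (K * 1 * (D * R * (K * R ^ 3) + R * D * (K * R ^ 3) + R * R * (K * 1 * (D * R * R + R * D * R + R * R * D))))"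
    unfolding quintic_def by (rule hs_le_tri_diff[OF one ca cb cd a b d cub[OF a] cub[OF b] cub_d])
  have eq: "coeff_step \<tau> a \<xi> - coeff_step \<tau> b \<xi> = flow \<tau> \<xi> * ((a \<xi> - b \<xi>)
      + \<i> * (tri (step_kernel \<tau>) (conjs a) a a \<xi> - tri (step_kernel \<tau>) (conjs b) b b \<xi>)
      - of_real (\<tau>\<^sup>2 / 2) * (quintic a \<xi> - quintic b \<xi>))" for \<xi>
  proof -
    have "f * (a + \<i> * x - q * y) - f * (b + \<i> * x' - q * y') = f * ((a - b) + \<i> * (x - x') - q * (y - y'))"
      for f a b x x' q y y' :: complex
      by (simp add: algebra_simps)
    from this show ?thesis unfolding coeff_step_def .
  qed
  have ti: "hs_le \<gamma> (\<lambda>\<xi>. \<i> * (tri (step_kernel \<tau>) (conjs a) a a \<xi> - tri (step_kernel \<tau>) (conjs b) b b \<xi>))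
      (K * (5 * \<tau>) * (D * R * R + R * D * R + R * R * D))"
    by (rule hs_le_unimodular[OF hs_le_tri_diff[OF norm_step_kernel_le[OF \<tau>(1)] ca cb cd a b d a b d]]) simp
  have "\<tau> * \<tau> \<le> \<tau>" using \<tau> by (simp add: mult_left_le)
  then have "(5 * K\<^sup>2 * R ^ 4 * D) * (\<tau> * \<tau>) \<le> (5 * K\<^sup>2 * R ^ 4 * D) * (2 * \<tau>)"
    using R D \<tau> by (intro mult_left_mono) auto
  then have le: "D + K * (5 * \<tau>) * (D * R * R + R * D * R + R * R * D)
      + cmod (of_real (\<tau>\<^sup>2 / 2)) * (K * 1 * (D * R * (K * R ^ 3) + R * D * (K * R ^ 3) + R * R * (K * 1 * (D * R * R + R * D * R + R * R * D))))
    \<le> (1 + (15 * K * R\<^sup>2 + 5 * K\<^sup>2 * R ^ 4) * \<tau>) * D"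
    by (simp only: norm_of_real) (simp add: power2_eq_square power3_eq_cube power4_eq_xxxx algebra_simps)
  show ?thesis
    unfolding eq
    by (rule hs_le_trans[OF hs_le_unimodular[OF hs_le_diff[OF hs_le_add[OF d ti] hs_le_cmult[OF quint_d]] norm_flow] le])
qed

text \<open>The induction carries the error bound \<open>E n\<close> along with the representation,
  because that bound keeps the current iterate in the ball of radius M + 1 on which the next step is
  Lipschitz.\<close>

theorem global_error:
  fixes M\<^sub>0 T :: real
  assumes T: "0 < T"
  shows "\<exists>\<tau>0>0. \<exists>C>0. \<forall>u :: real \<Rightarrow> real ^ 'd \<Rightarrow> complex.
    nls_solution (\<gamma> + 2) T u \<and> (\<forall>t\<in>{0..T}. Hs_norm (\<gamma> + 2) (u t) \<le> M\<^sub>0) \<longrightarrow>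
    (\<forall>\<tau>. 0 < \<tau> \<and> \<tau> \<le> \<tau>0 \<longrightarrow> (\<forall>n::nat. real n * \<tau> \<le> T \<longrightarrow>
       Hs_norm \<gamma> (\<lambda>x. u (real n * \<tau>) x - scheme \<tau> (u 0) n x) \<le> C * \<tau>\<^sup>2))"
proof -
  \<comment> \<open>\<open>M\<^sub>0\<close> may be negative, while the constants must not
    be.\<close>
  define M where "M = max M\<^sub>0 0"
  have M: "0 \<le> M" by (simp add: M_def)
  define C1 where "C1 = K * M ^ 3"
  define C2 where "C2 = K * (3 * C1 * M\<^sup>2) + 8 * K * M ^ 3"
  define C3 where "C3 = 3 * K * C1\<^sup>2 * M + 24 * K * C1 * M\<^sup>2 + 3 * K * C2 * M\<^sup>2 + 72 * K * M ^ 3"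
  \<comment> \<open>The Lipschitz rate of one step on the ball of radius M + 1.\<close>
  define L where "L = 15 * K * (M + 1)\<^sup>2 + 5 * K\<^sup>2 * (M + 1) ^ 4"
  define C4 where "C4 = C3 * T * exp (L * T)"
  define N where "N = sqrt ((2 * pi) ^ CARD('d))"
  have nonneg: "0 \<le> C3" "0 \<le> L" "0 \<le> C4" "0 \<le> N"
    using T M K_pos by (simp_all add: C1_def C2_def C3_def C4_def L_def N_def)
  have gamma2: "real CARD('d) / 2 < \<gamma> + 2" using gamma by simp
  have bound: "Hs_norm \<gamma> (\<lambda>x. u (real n * \<tau>) x - scheme \<tau> (u 0) n x) \<le> (N * C4 + 1) * \<tau>\<^sup>2"
    if sol: "nls_solution (\<gamma> + 2) T u" and bd: "\<And>t. t \<in> {0..T} \<Longrightarrow> Hs_norm (\<gamma> + 2) (u t) \<le> M\<^sub>0"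
      and \<tau>: "0 < \<tau>" "\<tau> \<le> min 1 (1 / (C4 + 1))" and n: "real n * \<tau> \<le> T"
    for u :: "real \<Rightarrow> real ^ 'd \<Rightarrow> complex" and \<tau> n
  proof -
    have \<tau>1: "\<tau> \<le> 1" and \<tau>2: "\<tau> \<le> 1 / (C4 + 1)" using \<tau>(2) by simp_all
    define U where "U t = fcoeff (u t)" for t
    have inHs: "in_Hs (\<gamma> + 2) (u t)" if "t \<in> {0..T}" for t
      using sol that by (simp add: nls_solution_def)
    have rep: "represents (u t) (U t)" if "t \<in> {0..T}" for t
      unfolding U_def by (rule represents_in_Hs[OF inHs[OF that] gamma2])
    have hU: "hs_le (\<gamma> + 2) (U t) M" if "t \<in> {0..T}" for t
      unfolding U_def M_def by (rule hs_le_trans[OF hs_le_if_Hs_norm_le[OF inHs[OF that] bd[OF that]]]) simp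
    have dU: "((\<lambda>t. U t \<xi>) has_vector_derivative \<i> * (- of_real (freq_sq \<xi>) * U t \<xi> + cubic (U t) \<xi>)) (at t within {0..T})"
      if t: "t \<in> {0..T}" for t \<xi>
    proof -
      have "((\<lambda>t'. fcoeff (u t') \<xi>) has_vector_derivative \<i> * (- of_real (freq_sq \<xi>) * fcoeff (u t) \<xi>
          + fcoeff (\<lambda>x. of_real ((cmod (u t x))\<^sup>2) * u t x) \<xi>)) (at t within {0..T})"
        by (rule sol[unfolded nls_solution_def, THEN conjunct2, rule_format, OF t])
      then show ?thesis
        unfolding represents_fcoeff[OF represents_cubic[OF rep[OF t]]] U_def .
    qed
    have local: "hs_le \<gamma> (\<lambda>\<xi>. U (t + \<tau>) \<xi> - coeff_step \<tau> (U t) \<xi>) (C3 * \<tau> ^ 3)" if t: "0 \<le> t" "t + \<tau> \<le> T" for t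
    proof -
      \<comment> \<open>Writing \<open>t + 0\<close> matches the initial value of the shifted
        solution, to which \<open>local_error\<close> is applied.\<close>
      have "hs_le \<gamma> (\<lambda>\<xi>. U (t + \<tau>) \<xi> - coeff_step \<tau> (U (t + 0)) \<xi>) (C3 * \<tau> ^ 3)"
        unfolding C3_def C2_def C1_def
      proof (rule local_error[where U = "\<lambda>s. U (t + s)", OF \<tau>(1)])
        fix s assume s: "s \<in> {0..\<tau>}"
        show "hs_le (\<gamma> + 2) (U (t + s)) M" using s t by (intro hU) auto
        fix \<xi>
        have "((\<lambda>t. U t \<xi>) has_vector_derivative \<i> * (- of_real (freq_sq \<xi>) * U (t + s) \<xi> + cubic (U (t + s)) \<xi>))
            (at (t + s) within (+) t ` {0..\<tau>})"
          by (rule has_vector_derivative_within_subset[OF dU]) (use s t in auto)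
        moreover have "((+) t has_vector_derivative 1) (at s within {0..\<tau>})"
          unfolding has_real_derivative_iff_has_vector_derivative[symmetric] by (auto intro!: derivative_eq_intros)
        ultimately show "((\<lambda>s. U (t + s) \<xi>) has_vector_derivative \<i> * (- of_real (freq_sq \<xi>) * U (t + s) \<xi> + cubic (U (t + s)) \<xi>))
            (at s within {0..\<tau>})"
          using vector_diff_chain_within[of "(+) t" 1 s "{0..\<tau>}" "\<lambda>t. U t \<xi>"] by (simp add: o_def)
      qed
      then show ?thesis by simp
    qed
    \<comment> \<open>An explicit majorant for the recursion e(n+1) = (1 + L \<tau>) e(n) + C3
      \<tau>^3: one local error per step, each amplified by at most (1 + L \<tau>)^n.\<close>
    define E where "E n = C3 * \<tau> ^ 3 * real n * (1 + L * \<tau>) ^ n" for n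
    have E_le: "E n \<le> C4 * \<tau>\<^sup>2" if "real n * \<tau> \<le> T" for n
    proof -
      have "(1 + L * \<tau>) ^ n \<le> exp (L * \<tau>) ^ n"
        using nonneg \<tau> by (intro power_mono exp_ge_add_one_self) auto
      also have "\<dots> = exp (L * (real n * \<tau>))"
        by (simp add: exp_of_nat_mult[symmetric] mult_ac)
      also have "\<dots> \<le> exp (L * T)"
        using nonneg that by (simp add: mult_left_mono)
      finally have "(real n * \<tau>) * (1 + L * \<tau>) ^ n \<le> T * exp (L * T)"
        using that \<tau> nonneg T by (intro mult_mono) auto
      then have "(C3 * \<tau>\<^sup>2) * ((real n * \<tau>) * (1 + L * \<tau>) ^ n) \<le> (C3 * \<tau>\<^sup>2) * (T * exp (L * T))"
        using nonneg by (intro mult_left_mono) auto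
      then show ?thesis
        by (simp add: E_def C4_def power2_eq_square power3_eq_cube mult_ac)
    qed
    \<comment> \<open>The step-size restriction is spent here: the error never exceeds 1, the margin
      between the radii M and M + 1.\<close>
    have small: "C4 * \<tau>\<^sup>2 \<le> 1"
    proof -
      have "(C4 + 1) * \<tau> \<le> 1" using \<tau>2 nonneg by (simp add: field_simps)
      then have "C4 * \<tau> \<le> 1" using \<tau> by (simp add: distrib_right)
      then have "C4 * \<tau> * \<tau> \<le> 1 * 1" using \<tau>(1) \<tau>1 by (intro mult_mono) auto
      then show ?thesis by (simp add: power2_eq_square mult.assoc)
    qed
    define c where "c n = (coeff_step \<tau> ^^ n) (U 0)" for n
    have "represents (scheme \<tau> (u 0) n) (c n) \<and> hs_le \<gamma> (\<lambda>\<xi>. c n \<xi> - U (real n * \<tau>) \<xi>) (E n)"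
      using n
    proof (induction n)
      case 0
      then show ?case
        using rep[of 0] T hs_le_zero by (simp add: scheme_def c_def E_def)
    next
      case (Suc n)
      have n: "real n * \<tau> + \<tau> \<le> T" using Suc.prems by (simp add: algebra_simps)
      have n': "real n * \<tau> \<le> T" using n \<tau> by simp
      have tn: "real n * \<tau> \<in> {0..T}" using n' \<tau> by simp
      from Suc.IH[OF n'] have IH: "represents (scheme \<tau> (u 0) n) (c n)" "hs_le \<gamma> (\<lambda>\<xi>. c n \<xi> - U (real n * \<tau>) \<xi>) (E n)" by auto
      have E1: "E n \<le> 1" using E_le[OF n'] small by linarith
      have Un: "hs_le \<gamma> (U (real n * \<tau>)) M" by (rule hs_le_lower_order[OF hU[OF tn]])
      have cn: "hs_le \<gamma> (c n) (M + 1)"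
        using hs_le_trans[OF hs_le_add[OF Un IH(2)], of "M + 1"] E1 by simp
      have c_Suc: "c (Suc n) = coeff_step \<tau> (c n)" by (simp add: c_def)
      have "represents (scheme \<tau> (u 0) (Suc n)) (c (Suc n))"
        using scheme_step_eq_synth[OF gamma IH(1) cn, of \<tau>]
        by (simp add: scheme_def c_Suc represents_synth)
      moreover have "hs_le \<gamma> (\<lambda>\<xi>. c (Suc n) \<xi> - U (real (Suc n) * \<tau>) \<xi>) (E (Suc n))"
      proof -
        have eq: "(coeff_step \<tau> (c n) \<xi> - coeff_step \<tau> (U (real n * \<tau>)) \<xi>)
            - (U (real n * \<tau> + \<tau>) \<xi> - coeff_step \<tau> (U (real n * \<tau>)) \<xi>) = c (Suc n) \<xi> - U (real (Suc n) * \<tau>) \<xi>" for \<xi>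
          by (simp add: c_Suc algebra_simps)
        have "hs_le \<gamma> (\<lambda>\<xi>. (coeff_step \<tau> (c n) \<xi> - coeff_step \<tau> (U (real n * \<tau>)) \<xi>)
            - (U (real n * \<tau> + \<tau>) \<xi> - coeff_step \<tau> (U (real n * \<tau>)) \<xi>)) ((1 + L * \<tau>) * E n + C3 * \<tau> ^ 3)"
          unfolding L_def using \<tau>(1) \<tau>1 n
          by (intro hs_le_diff hs_le_coeff_step_diff cn hs_le_trans[OF Un] IH(2) local) auto
        moreover have "(1 + L * \<tau>) * E n + C3 * \<tau> ^ 3 \<le> E (Suc n)"
        proof -
          have "1 \<le> (1 + L * \<tau>) ^ Suc n" using nonneg \<tau> by (intro one_le_power) auto
          then have "C3 * \<tau> ^ 3 * 1 \<le> C3 * \<tau> ^ 3 * (1 + L * \<tau>) ^ Suc n"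
            using nonneg \<tau> by (intro mult_left_mono) auto
          then show ?thesis by (simp add: E_def algebra_simps)
        qed
        ultimately show ?thesis
          unfolding eq by (rule hs_le_trans)
      qed
      ultimately show ?case by simp
    qed
    then have R: "represents (scheme \<tau> (u 0) n) (c n)" and err: "hs_le \<gamma> (\<lambda>\<xi>. c n \<xi> - U (real n * \<tau>) \<xi>) (E n)" by auto
    have tn: "real n * \<tau> \<in> {0..T}" using n \<tau> by simp
    have "fcoeff (\<lambda>x. u (real n * \<tau>) x - scheme \<tau> (u 0) n x) \<xi> = U (real n * \<tau>) \<xi> - c n \<xi>" for \<xi>
      using fcoeff_diff[OF represents_integrable[OF rep[OF tn]] represents_integrable[OF R], of \<xi>]
      by (simp add: represents_fcoeff[OF rep[OF tn]] represents_fcoeff[OF R])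
    then have eq: "fcoeff (\<lambda>x. u (real n * \<tau>) x - scheme \<tau> (u 0) n x) = (\<lambda>\<xi>. - (c n \<xi> - U (real n * \<tau>) \<xi>))"
      by (intro ext) simp
    have "hs_le \<gamma> (fcoeff (\<lambda>x. u (real n * \<tau>) x - scheme \<tau> (u 0) n x)) (C4 * \<tau>\<^sup>2)"
      unfolding eq by (rule hs_le_uminus[OF hs_le_trans[OF err E_le[OF n]]])
    then have "Hs_norm \<gamma> (\<lambda>x. u (real n * \<tau>) x - scheme \<tau> (u 0) n x) \<le> N * (C4 * \<tau>\<^sup>2)"
      unfolding N_def by (rule Hs_norm_le_if_hs_le)
    also have "\<dots> \<le> (N * C4 + 1) * \<tau>\<^sup>2" by (simp add: distrib_right)
    finally show ?thesis .
  qed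
  show ?thesis
  proof (intro exI conjI allI impI)
    \<comment> \<open>These two goals fix the witnesses for \<tau>0 and C. The summand 1 in each
      guards against C4 = 0.\<close>
    show "0 < min 1 (1 / (C4 + 1))" using nonneg by simp
    show "0 < N * C4 + 1" using nonneg by (simp add: add_nonneg_pos)
  qed (elim conjE, rule bound, simp_all)
qed

end

theorem theorem1p1:
  fixes \<gamma> :: real
  assumes "\<gamma> > real CARD('d) / 2"
  shows "\<forall>T>0. \<forall>M. \<exists>\<tau>0>0. \<exists>C>0. \<forall>u :: real \<Rightarrow> real ^ 'd::finite \<Rightarrow> complex.
           nls_solution (\<gamma> + 2) T u \<and> (\<forall>t\<in>{0..T}. Hs_norm (\<gamma> + 2) (u t) \<le> M) \<longrightarrow>
           (\<forall>\<tau>. 0 < \<tau> \<and> \<tau> \<le> \<tau>0 \<longrightarrow>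
              (\<forall>n::nat. real n * \<tau> \<le> T \<longrightarrow>
                 Hs_norm \<gamma> (\<lambda>x. u (real n * \<tau>) x - scheme \<tau> (u 0) n x) \<le> C * \<tau>\<^sup>2))"
proof (rule allI)
  fix T :: real
  \<comment> \<open>\<open>K\<close> depends on \<gamma> and the dimension only, so the constants
    built from it depend on no particular solution.\<close>
  obtain K where "tri_algebra TYPE('d) \<gamma> K"
    using tri_algebra_exists[OF assms] by blast
  then interpret tri_algebra \<gamma> K "TYPE('d)" .
  show "T > 0 \<longrightarrow> (\<forall>M. \<exists>\<tau>0>0. \<exists>C>0. \<forall>u :: real \<Rightarrow> real ^ 'd \<Rightarrow> complex.
           nls_solution (\<gamma> + 2) T u \<and> (\<forall>t\<in>{0..T}. Hs_norm (\<gamma> + 2) (u t) \<le> M) \<longrightarrow>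
           (\<forall>\<tau>. 0 < \<tau> \<and> \<tau> \<le> \<tau>0 \<longrightarrow>
              (\<forall>n::nat. real n * \<tau> \<le> T \<longrightarrow>
                 Hs_norm \<gamma> (\<lambda>x. u (real n * \<tau>) x - scheme \<tau> (u 0) n x) \<le> C * \<tau>\<^sup>2)))"
    by (intro impI allI global_error)
qed

end
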